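(* Let $L$ and $R$ be snarks. Let $xy$ be a bold-edge of $L$ and let $\{ab,cd\}$ be a gadget-pair of $R$. Then any dot product $L\cdot R$ formed by deleting the adjacent vertices $x,y$ from $L$ and the independent edges $ab,cd$ from $R$ is an odd $2$-factored snark.
   Context: All graphs are finite and simple. A snark is a cubic, cyclically $4$-edge-connected graph with edge chromatic number four and girth at least five. A $2$-factor of a graph is a $2$-regular spanning subgraph; a $2$-factor is called odd if each of its cycles has odd length. A graph is odd $2$-factored if each cycle of each of its $2$-factors is odd. Dot product: given cubic graphs $L$ and $R$ of cyclic edge-connectivity at least $4$, remove a pair of adjacent vertices $x,y$ from $L$ and two independent edges $ab$, $cd$ from $R$; let $N(x)\setminus\{y\}=\{r,s\}$ and $N(y)\setminus\{x\}=\{t,u\}$; then join $\{r,s\}$ to $\{a,b\}$ and $\{t,u\}$ to $\{c,d\}$ by a perfect matching (or $\{r,s\}$ to $\{c,d\}$ and $\{t,u\}$ to $\{a,b\}$). The result is denoted $L\cdot R$. Bold-edge: an edge $xy$ of a snark $L$ such that (i) every $2$-factor of $L-x$ and every $2$-factor of $L-y$ is odd; (ii) every $2$-factor of $L$ containing $xy$ is odd; (iii) every $2$-factor of $L$ avoiding $xy$ is odd. Gadget-pair: a pair of independent edges $f=ab$, $g=cd$ of a snark $R$ such that (i) $R$ has no $2$-factor avoiding both $f$ and $g$; (ii) every $2$-factor of $R$ containing exactly one of $f,g$ is odd; (iii) every $2$-factor of $R$ containing both $f$ and $g$ is odd, and in each such $2$-factor $f$ and $g$ lie in different cycles; (iv)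 in the graph $(R-\{f,g\})\cup\{ac,ad,bc,bd\}$, every $2$-factor containing exactly one of the edges $ac,ad,bc,bd$ has the property that the cycle containing that new edge is even and all other cycles are odd. *)

theory Defs
  imports Main "HOL-Library.Extended_Nat"
begin

section \<open>Finite simple graphs\<close>

type_synonym 'v graph = "'v set \<times> 'v set set"

abbreviation verts :: "'v graph \<Rightarrow> 'v set" where "verts G \<equiv> fst G"

abbreviation edges :: "'v graph \<Rightarrow> 'v set set" where "edges G \<equiv> snd G"

definition simple_graph :: "'v graph \<Rightarrow> bool" where
  "simple_graph G \<longleftrightarrow> finite (verts G) \<and> (\<forall>e\<in>edges G. e \<subseteq> verts G \<and> card e = 2)"

definition neighbours :: "'v graph \<Rightarrow> 'v \<Rightarrow> 'v set" where
  "neighbours G v = {w. {v, w} \<in> edges G}"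

definition degree :: "'v graph \<Rightarrow> 'v \<Rightarrow> nat" where
  "degree G v = card {e \<in> edges G. v \<in> e}"

definition regular :: "nat \<Rightarrow> 'v graph \<Rightarrow> bool" where
  "regular k G \<longleftrightarrow> simple_graph G \<and> (\<forall>v\<in>verts G. degree G v = k)"

abbreviation cubic :: "'v graph \<Rightarrow> bool" where "cubic \<equiv> regular 3"

definition delete_edges :: "'v graph \<Rightarrow> 'v set set \<Rightarrow> 'v graph" where
  "delete_edges G X = (verts G, edges G - X)"

definition add_edges :: "'v graph \<Rightarrow> 'v set set \<Rightarrow> 'v graph" where
  "add_edges G X = (verts G, edges G \<union> X)"

definition delete_verts :: "'v graph \<Rightarrow> 'v set \<Rightarrow> 'v graph" where
  "delete_verts G S = (verts G - S, {e \<in> edges G. e \<inter> S = {}})"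


section \<open>Cycles, girth, cyclic edge-connectivity, chromatic index\<close>

text \<open>
  A cycle is given by the cyclic sequence of its vertices, so its length is the length of the
  list. Rotations and reversals of a list describe the same cycle.
\<close>

definition cycle_edges :: "'v list \<Rightarrow> 'v set set" where
  "cycle_edges p = {{p ! i, p ! (Suc i mod length p)} | i. i < length p}"

definition cycle :: "'v graph \<Rightarrow> 'v list \<Rightarrow> bool" where
  "cycle G p \<longleftrightarrow>
     3 \<le> length p \<and> distinct p \<and> set p \<subseteq> verts G \<and> cycle_edges p \<subseteq> edges G"

text \<open>The girth of an acyclic graph is \<open>\<infinity>\<close>.\<close>

definition girth :: "'v graph \<Rightarrow> enat" where
  "girth G = (INF p\<in>{p. cycle G p}. enat (length p))"

definition components :: "'v graph \<Rightarrow> 'v set set" where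
  "components G = {{w. (v, w) \<in> {(a, b). {a, b} \<in> edges G}\<^sup>*} | v. v \<in> verts G}"

text \<open>
  At least \<open>k\<close> edges have to be removed to obtain a graph in which two components contain a
  cycle. With the empty edge set this says that at most one component of the graph itself
  contains a cycle; in particular cubic graphs with this property for \<open>k > 0\<close> are connected.
\<close>

definition cyclically_edge_connected :: "nat \<Rightarrow> 'v graph \<Rightarrow> bool" where
  "cyclically_edge_connected k G \<longleftrightarrow>
     (\<forall>X \<subseteq> edges G. card X < k \<longrightarrow>
        \<not> (\<exists>C \<in> components (delete_edges G X). \<exists>D \<in> components (delete_edges G X). C \<noteq> D \<and>
              (\<exists>p. cycle (delete_edges G X) p \<and> set p \<subseteq> C) \<and>
              (\<exists>q. cycle (delete_edges G X) q \<and> set q \<subseteq> D)))"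

definition edge_colourable :: "nat \<Rightarrow> 'v graph \<Rightarrow> bool" where
  "edge_colourable k G \<longleftrightarrow>
     (\<exists>col :: 'v set \<Rightarrow> nat. (\<forall>e\<in>edges G. col e < k) \<and>
        (\<forall>e\<in>edges G. \<forall>e'\<in>edges G. e \<noteq> e' \<longrightarrow> e \<inter> e' \<noteq> {} \<longrightarrow> col e \<noteq> col e'))"

definition edge_chromatic_number :: "'v graph \<Rightarrow> nat" where
  "edge_chromatic_number G = (LEAST k. edge_colourable k G)"

definition snark :: "'v graph \<Rightarrow> bool" where
  "snark G \<longleftrightarrow>
     cubic G \<and> cyclically_edge_connected 4 G \<and> edge_chromatic_number G = 4 \<and> 5 \<le> girth G"


section \<open>2-factors\<close>

definition two_factor :: "'v graph \<Rightarrow> 'v graph \<Rightarrow> bool" where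
  "two_factor F G \<longleftrightarrow> verts F = verts G \<and> edges F \<subseteq> edges G \<and> regular 2 F"

definition odd_cycles :: "'v graph \<Rightarrow> bool" where
  "odd_cycles F \<longleftrightarrow> (\<forall>p. cycle F p \<longrightarrow> odd (length p))"

definition odd_two_factored :: "'v graph \<Rightarrow> bool" where
  "odd_two_factored G \<longleftrightarrow> (\<forall>F. two_factor F G \<longrightarrow> odd_cycles F)"


section \<open>Bold-edges, gadget-pairs, dot products\<close>

definition bold_edge :: "'v graph \<Rightarrow> 'v \<Rightarrow> 'v \<Rightarrow> bool" where
  "bold_edge L x y \<longleftrightarrow> snark L \<and> {x, y} \<in> edges L \<and>
     (\<forall>F. two_factor F (delete_verts L {x}) \<longrightarrow> odd_cycles F) \<and>
     (\<forall>F. two_factor F (delete_verts L {y}) \<longrightarrow> odd_cycles F) \<and>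
     (\<forall>F. two_factor F L \<and> {x, y} \<in> edges F \<longrightarrow> odd_cycles F) \<and>
     (\<forall>F. two_factor F L \<and> {x, y} \<notin> edges F \<longrightarrow> odd_cycles F)"

text \<open>For \<open>f = {a, b}\<close> and \<open>g = {c, d}\<close> these are the four edges \<open>ac\<close>, \<open>ad\<close>, \<open>bc\<close>, \<open>bd\<close>.\<close>

definition cross_edges :: "'v set \<Rightarrow> 'v set \<Rightarrow> 'v set set" where
  "cross_edges f g = {{p, q} | p q. p \<in> f \<and> q \<in> g}"

definition gadget_pair :: "'v graph \<Rightarrow> 'v set \<Rightarrow> 'v set \<Rightarrow> bool" where
  "gadget_pair R f g \<longleftrightarrow> snark R \<and> f \<in> edges R \<and> g \<in> edges R \<and> f \<inter> g = {} \<and>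
     \<not> (\<exists>F. two_factor F R \<and> f \<notin> edges F \<and> g \<notin> edges F) \<and>
     (\<forall>F. two_factor F R \<and> (f \<in> edges F) \<noteq> (g \<in> edges F) \<longrightarrow> odd_cycles F) \<and>
     (\<forall>F. two_factor F R \<and> f \<in> edges F \<and> g \<in> edges F \<longrightarrow>
        odd_cycles F \<and> \<not> (\<exists>p. cycle F p \<and> f \<in> cycle_edges p \<and> g \<in> cycle_edges p)) \<and>
     (\<forall>F e. two_factor F (add_edges (delete_edges R {f, g}) (cross_edges f g)) \<and>
          edges F \<inter> cross_edges f g = {e} \<longrightarrow>
        (\<forall>p. cycle F p \<longrightarrow> (if e \<in> cycle_edges p then even (length p) else odd (length p))))"

text \<open>
  The result lives on the disjoint sum of the two vertex types. The perfect matching joins \<open>r\<close>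
  to \<open>a\<close>, \<open>s\<close> to \<open>b\<close>, \<open>t\<close> to \<open>c\<close> and \<open>u\<close> to \<open>d\<close>; the other matchings arise by exchanging the
  names within the unordered pairs.
\<close>

definition dot_graph ::
  "'a graph \<Rightarrow> 'a \<Rightarrow> 'a \<Rightarrow> 'b graph \<Rightarrow> 'a \<Rightarrow> 'a \<Rightarrow> 'a \<Rightarrow> 'a \<Rightarrow> 'b \<Rightarrow> 'b \<Rightarrow> 'b \<Rightarrow> 'b \<Rightarrow> ('a + 'b) graph"
where
  "dot_graph L x y R r s t u a b c d =
     (Inl ` verts (delete_verts L {x, y}) \<union> Inr ` verts R,
      (\<lambda>e. Inl ` e) ` edges (delete_verts L {x, y}) \<union>
      (\<lambda>e. Inr ` e) ` edges (delete_edges R {{a, b}, {c, d}}) \<union>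
      {{Inl r, Inr a}, {Inl s, Inr b}, {Inl t, Inr c}, {Inl u, Inr d}})"

text \<open>
  \<open>H\<close> is one of the dot products obtained by deleting the adjacent vertices \<open>x\<close>, \<open>y\<close> and the
  independent edges \<open>f\<close>, \<open>g\<close>. The neighbours of \<open>x\<close> may be joined to the ends of either of the
  two edges.
\<close>

definition dot_product ::
  "'a graph \<Rightarrow> 'a \<Rightarrow> 'a \<Rightarrow> 'b graph \<Rightarrow> 'b set \<Rightarrow> 'b set \<Rightarrow> ('a + 'b) graph \<Rightarrow> bool"
where
  "dot_product L x y R f g H \<longleftrightarrow>
     cubic L \<and> cyclically_edge_connected 4 L \<and> cubic R \<and> cyclically_edge_connected 4 R \<and>
     {x, y} \<in> edges L \<and> f \<in> edges R \<and> g \<in> edges R \<and> f \<inter> g = {} \<and>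
     (\<exists>r s t u a b c d.
        neighbours L x - {y} = {r, s} \<and> neighbours L y - {x} = {t, u} \<and>
        ({a, b} = f \<and> {c, d} = g \<or> {a, b} = g \<and> {c, d} = f) \<and>
        H = dot_graph L x y R r s t u a b c d)"

end

theory Submission
  imports Defs "HOL-Library.Disjoint_Sets"
begin

text \<open>
  A 3-edge-colouring of a cubic graph contains 2-factors all of whose cycles are even, so once the dot
  product \<open>H\<close> is odd 2-factored it only remains to find a 4-edge-colouring of \<open>H\<close> and to bound its girth and
  its cyclic edge-connectivity. The latter is a statement about edge boundaries: in a cubic graph a
  side with more than one vertex and at most three boundary edges contains a cycle.

  A 2-factor \<open>F\<close> of \<open>H\<close> uses an even number of the four connecting edges. Completing its two halves by
  the deleted vertices and edges (or, if one edge from each end of \<open>xy\<close> is used, by one of \<open>ac\<close>, \<open>ad\<close>,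
  \<open>bc\<close>, \<open>bd\<close>) gives 2-factors to which the definitions of bold-edges and gadget-pairs apply. Cycles are
  handled as minimal vertex sets that no edge of the 2-factor leaves, which makes parities of
  lengths additive under gluing.

  As all graphs are simple, condition (iv) of gadget-pairs says nothing if, say, \<open>ac\<close> is already an
  edge of \<open>R\<close>. Tutte's theorem is used to show that this cannot happen in a gadget-pair.
\<close>

text \<open>Half-circuits are never traced as paths. A half of a circuit is a vertex set closed
  under the edges of the 2-factor within that half. Its loose ends are the ends of used links;
  degree counting makes their number even, and closing the half up means adding edges that tie the
  loose ends together.

  The parities balance through the vertices that this adds on the left. A half-circuit that returns
  to the same end of \<open>xy\<close> takes up one deleted vertex, so its own size is even; one
  that runs from end to end takes up both, so its size stays odd. On the right no vertex is added,
  which is why (ii) and (iii) ask for odd cycles and (iv) for an even one.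

  The delicate case is a circuit through all four links, since the left half may pair the terminals
  across \<open>xy\<close>. Condition (iii) controls it: it splits the right half into a part with
  the ends of \<open>ab\<close> and a part with the ends of \<open>cd\<close>, both odd, whatever
  happens on the left.\<close>

section \<open>Edge cuts, closed vertex sets and degree counting\<close>

definition incident :: "'v set set \<Rightarrow> 'v \<Rightarrow> 'v set set" where
  "incident E v = {e \<in> E. v \<in> e}"

definition inside :: "'v set set \<Rightarrow> 'v set \<Rightarrow> 'v set set" where
  "inside E S = {e \<in> E. e \<subseteq> S}"

definition boundary :: "'v set set \<Rightarrow> 'v set \<Rightarrow> 'v set set" where
  "boundary E S = {e \<in> E. e \<inter> S \<noteq> {} \<and> \<not> e \<subseteq> S}"

text \<open>In a graph these are the unions of connected components. They allow arguments about
  cycles without following walks.\<close>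

definition closed_in :: "'v set set \<Rightarrow> 'v set \<Rightarrow> bool" where
  "closed_in E S \<longleftrightarrow> (\<forall>e\<in>E. e \<inter> S \<noteq> {} \<longrightarrow> e \<subseteq> S)"

lemma degree_incident: "degree G v = card (incident (edges G) v)"
  by (simp add: degree_def incident_def)

lemma simple_graph_finite_edges:
  assumes "simple_graph G" shows "finite (edges G)"
proof -
  have "edges G \<subseteq> Pow (verts G)" using assms by (auto simp: simple_graph_def)
  then show ?thesis using assms finite_subset by (auto simp: simple_graph_def)
qed

lemma closed_in_boundary: "closed_in E S \<longleftrightarrow> boundary E S = {}"
  by (auto simp: closed_in_def boundary_def)

lemma closed_in_Diff: "closed_in E S \<Longrightarrow> closed_in E T \<Longrightarrow> closed_in E (S - T)"
  unfolding closed_in_def by blast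

lemma closed_in_Int: "closed_in E S \<Longrightarrow> closed_in E T \<Longrightarrow> closed_in E (S \<inter> T)"
  unfolding closed_in_def by blast

lemma boundary_complement:
  assumes "\<And>e. e \<in> E \<Longrightarrow> e \<subseteq> V"
  shows "boundary E (V - S) = boundary E S"
  using assms unfolding boundary_def by blast

text \<open>Double counting of incidences: an edge inside \<open>S\<close> is counted twice, an edge
  of the cut once.\<close>

lemma handshake:
  assumes "finite E" "finite S" and card2: "\<And>e. e \<in> E \<Longrightarrow> card e = 2"
  shows "(\<Sum>v\<in>S. card (incident E v)) = 2 * card (inside E S) + card (boundary E S)"
proof -
  have "(\<Sum>v\<in>S. card (incident E v)) = (\<Sum>v\<in>S. \<Sum>e\<in>E. of_bool (v \<in> e))"
    using assms by (simp add: incident_def Int_def)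
  also have "\<dots> = (\<Sum>e\<in>E. card (e \<inter> S))"
    using assms by (subst sum.swap) (simp add: Int_commute Int_def)
  also have "\<dots> = (\<Sum>e\<in>E. 2 * of_bool (e \<subseteq> S) + of_bool (e \<inter> S \<noteq> {} \<and> \<not> e \<subseteq> S))"
  proof (rule sum.cong[OF refl])
    fix e assume "e \<in> E"
    then obtain p q where e: "e = {p, q}" "p \<noteq> q" using card2 by (meson card_2_iff)
    show "card (e \<inter> S) = 2 * of_bool (e \<subseteq> S) + of_bool (e \<inter> S \<noteq> {} \<and> \<not> e \<subseteq> S)"
      using e by (cases "p \<in> S"; cases "q \<in> S") (auto simp: Int_insert_left)
  qed
  also have "\<dots> = 2 * card (inside E S) + card (boundary E S)"
    using assms by (simp add: sum.distrib inside_def boundary_def Int_def flip: sum_distrib_left)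
  finally show ?thesis .
qed

lemma handshake_regular:
  assumes "regular k G" "S \<subseteq> verts G"
  shows "k * card S = 2 * card (inside (edges G) S) + card (boundary (edges G) S)"
proof -
  have G: "simple_graph G" and fin: "finite S"
    using assms finite_subset by (auto simp: regular_def simple_graph_def)
  have "(\<Sum>v\<in>S. card (incident (edges G) v)) = (\<Sum>v\<in>S. k)"
    using assms by (intro sum.cong) (auto simp: regular_def degree_incident)
  then show ?thesis
    using handshake[of "edges G" S] G fin simple_graph_finite_edges[OF G]
    by (simp add: simple_graph_def mult.commute)
qed

lemma incident_neighbours:
  assumes "simple_graph G"
  shows "incident (edges G) v = (\<lambda>w. {v, w}) ` neighbours G v"
proof (intro set_eqI iffI)
  fix e assume e: "e \<in> incident (edges G) v"
  then have "card e = 2" "v \<in> e" using assms by (auto simp: incident_def simple_graph_def)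
  then obtain w where "e = {v, w}" by (metis card_2_iff doubleton_eq_iff insertE singletonD)
  then show "e \<in> (\<lambda>w. {v, w}) ` neighbours G v"
    using e by (auto simp: incident_def neighbours_def)
qed (auto simp: incident_def neighbours_def)

lemma inj_on_doubleton: "inj_on (\<lambda>w. {v, w}) A"
  by (auto simp: inj_on_def doubleton_eq_iff)

lemma degree_neighbours: "simple_graph G \<Longrightarrow> degree G v = card (neighbours G v)"
  by (simp add: degree_incident incident_neighbours card_image[OF inj_on_doubleton])

lemma simple_graph_edge_neq: "simple_graph G \<Longrightarrow> {v, w} \<in> edges G \<Longrightarrow> v \<noteq> w"
  by (auto simp: simple_graph_def)

section \<open>Cycles in graphs of minimum degree two\<close>

text \<open>All neighbours in \<open>S\<close> of the first vertex of a longest path lie on that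
  path. One of them is not the second vertex, and the path up to it closes to a cycle.\<close>

lemma min_degree_two_cycle:
  assumes fin: "finite S" and ne: "S \<noteq> {}" and card2: "\<And>e. e \<in> E \<Longrightarrow> card e = 2"
    and deg: "\<And>v. v \<in> S \<Longrightarrow> 2 \<le> card (incident (inside E S) v)"
  shows "\<exists>p. 3 \<le> length p \<and> distinct p \<and> set p \<subseteq> S \<and> cycle_edges p \<subseteq> E"
proof -
  define path where "path p \<longleftrightarrow> p \<noteq> [] \<and> distinct p \<and> set p \<subseteq> S \<and>
    (\<forall>i. Suc i < length p \<longrightarrow> {p ! i, p ! Suc i} \<in> E)" for p
  obtain v0 where "v0 \<in> S" using ne by blast
  then have "path [v0]" by (simp add: path_def)
  moreover have "length p < Suc (card S)" if "path p" for p
    using that card_mono[OF fin, of "set p"] by (simp add: path_def distinct_card less_Suc_eq_le)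
  ultimately obtain p where p: "path p" and longest: "\<And>q. path q \<Longrightarrow> length q \<le> length p"
    using ex_has_greatest_nat[of path "[v0]" length "Suc (card S)"] by (metis less_imp_le)
  define v where "v = p ! 0"
  have vS: "v \<in> S" using p by (auto simp: path_def v_def)
  define N where "N = {w. {v, w} \<in> E \<and> w \<in> S}"
  have "incident (inside E S) v \<subseteq> (\<lambda>w. {v, w}) ` N"
  proof
    fix e assume e: "e \<in> incident (inside E S) v"
    then have "card e = 2" "v \<in> e" using card2 by (auto simp: incident_def inside_def)
    then obtain w where "e = {v, w}" by (metis card_2_iff doubleton_eq_iff insertE singletonD)
    then show "e \<in> (\<lambda>w. {v, w}) ` N" using e by (auto simp: incident_def inside_def N_def)
  qed
  moreover have finN: "finite N" using fin by (auto simp: N_def intro: finite_subset)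
  ultimately have "card (incident (inside E S) v) \<le> card N"
    by (meson card_image_le card_mono finite_imageI le_trans)
  then have N2: "2 \<le> card N" using deg[OF vS] by simp
  have Np: "N \<subseteq> set p"
  proof (rule ccontr)
    assume "\<not> N \<subseteq> set p"
    then obtain w where w: "w \<in> N" "w \<notin> set p" by blast
    have "{(w # p) ! i, p ! i} \<in> E" if "i < length p" for i
      using w p that by (cases i) (auto simp: path_def N_def v_def insert_commute)
    then have "path (w # p)" using w p by (simp add: path_def N_def)
    then show False using longest by force
  qed
  have "\<not> N \<subseteq> {p ! 1}" using N2 card_mono[of "{p ! 1}" N] by auto
  then obtain w where w: "w \<in> N" "w \<noteq> p ! 1" by blast
  then obtain j where j: "j < length p" "w = p ! j" using Np by (metis in_set_conv_nth subsetD)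
  have "v \<notin> N" using card2[of "{v, v}"] by (auto simp: N_def)
  then have "j \<noteq> 0" "j \<noteq> 1" using w j unfolding v_def by metis+
  then have j2: "2 \<le> j" by linarith
  define q where "q = take (Suc j) p"
  have len: "length q = Suc j" using j by (simp add: q_def)
  have nth: "q ! i = p ! i" if "i \<le> j" for i using that by (simp add: q_def)
  have "cycle_edges q \<subseteq> E"
  proof
    fix e assume "e \<in> cycle_edges q"
    then obtain i where i: "i \<le> j" "e = {q ! i, q ! (Suc i mod Suc j)}"
      using len by (auto simp: cycle_edges_def less_Suc_eq_le)
    show "e \<in> E"
    proof (cases "i = j")
      case True
      then show ?thesis using i nth[of j] nth[of 0] w j by (auto simp: N_def v_def insert_commute)
    next
      case False
      then have "Suc i \<le> j" using i by simp
      then show ?thesis using i nth p j by (simp add: path_def)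
    qed
  qed
  moreover have "distinct q" "set q \<subseteq> S"
    using p set_take_subset[of "Suc j" p] by (auto simp: q_def path_def)
  ultimately show ?thesis using len j2 by (intro exI[of _ q]) simp
qed

text \<open>The edge bound for forests. Without a cycle some vertex has degree at most one inside
  \<open>S\<close>, and removing it loses at most one edge.\<close>

lemma acyclic_inside_card:
  assumes "finite E" and card2: "\<And>e. e \<in> E \<Longrightarrow> card e = 2"
    and "finite S" "S \<noteq> {}"
    and "\<not> (\<exists>p. 3 \<le> length p \<and> distinct p \<and> set p \<subseteq> S \<and> cycle_edges p \<subseteq> E)"
  shows "card (inside E S) < card S"
  using assms(3-5)
proof (induction "card S" arbitrary: S rule: less_induct)
  case less
  obtain v where v: "v \<in> S" "card (incident (inside E S) v) \<le> 1"
    using min_degree_two_cycle[OF less.prems(1,2) card2] less.prems(3)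
    by (metis not_less_eq_eq one_add_one plus_1_eq_Suc)
  have eq: "inside E S = inside E (S - {v}) \<union> incident (inside E S) v"
    by (auto simp: inside_def incident_def)
  have "finite (inside E S)" using assms(1) by (simp add: inside_def)
  then have le: "card (inside E S) \<le> card (inside E (S - {v})) + 1"
    using v card_Un_le[of "inside E (S - {v})" "incident (inside E S) v"] eq by simp
  show ?case
  proof (cases "S = {v}")
    case True
    have "inside E {v} = {}"
    proof -
      have "False" if "e \<in> E" "e \<subseteq> {v}" for e
        using card2[OF that(1)] card_mono[of "{v}" e] that by simp
      then show ?thesis by (auto simp: inside_def)
    qed
    then show ?thesis using True by simp
  next
    case False
    have "card (inside E (S - {v})) < card (S - {v})"
    proof (rule less.hyps)
      show "card (S - {v}) < card S" using v less.prems by (meson card_Diff1_less)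
      show "S - {v} \<noteq> {}" using False v by blast
      show "\<not> (\<exists>p. 3 \<le> length p \<and> distinct p \<and> set p \<subseteq> S - {v} \<and> cycle_edges p \<subseteq> E)"
        using less.prems(3) by blast
    qed (use less.prems in simp)
    then show ?thesis using le v less.prems by simp
  qed
qed

section \<open>Circuits of two-regular graphs\<close>

text \<open>In a 2-regular graph the minimal closed vertex sets are the vertex sets of the cycles.\<close>

definition circuit :: "'v set \<Rightarrow> 'v set set \<Rightarrow> 'v set \<Rightarrow> bool" where
  "circuit V E K \<longleftrightarrow> K \<subseteq> V \<and> K \<noteq> {} \<and> closed_in E K \<and>
     (\<forall>K' \<subseteq> K. K' \<noteq> {} \<longrightarrow> closed_in E K' \<longrightarrow> K' = K)"

text \<open>A smallest closed set containing \<open>v\<close> is minimal: a nonempty closed part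
  without \<open>v\<close> would leave a smaller closed set that still contains
  \<open>v\<close>.\<close>

lemma ex_circuit:
  assumes "finite V" "v \<in> V" "closed_in E V"
  shows "\<exists>K. circuit V E K \<and> v \<in> K"
proof -
  define Q where "Q K \<longleftrightarrow> K \<subseteq> V \<and> v \<in> K \<and> closed_in E K" for K
  have "Q V" using assms by (simp add: Q_def)
  then obtain K where K: "Q K" and least: "\<And>K'. Q K' \<Longrightarrow> card K \<le> card K'"
    using ex_has_least_nat[of Q V card] by metis
  have finK: "finite K" using K assms(1) by (auto simp: Q_def intro: finite_subset)
  have big: "K' = K" if "K' \<subseteq> K" "Q K'" for K'
    using card_seteq[OF finK] that least by blast
  have "K' = K" if K': "K' \<subseteq> K" "K' \<noteq> {}" "closed_in E K'" for K'
  proof (cases "v \<in> K'")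
    case True
    then show ?thesis using big[of K'] K K' by (auto simp: Q_def)
  next
    case False
    then have "Q (K - K')" using K K' closed_in_Diff[of E K K'] by (auto simp: Q_def)
    then show ?thesis using big[of "K - K'"] K' by blast
  qed
  then show ?thesis using K unfolding circuit_def Q_def by blast
qed

text \<open>The two cycle edges at a vertex of \<open>p\<close> exhaust its degree two, so no other
  edge of \<open>F\<close> touches the cycle.\<close>

lemma cycle_edges_at:
  assumes reg: "regular 2 F" and p: "cycle F p" and e: "e \<in> edges F" "e \<inter> set p \<noteq> {}"
  shows "e \<in> cycle_edges p"
proof -
  define n where "n = length p"
  have n: "3 \<le> n" and dist: "distinct p" and sub: "set p \<subseteq> verts F" "cycle_edges p \<subseteq> edges F"
    using p by (auto simp: cycle_def n_def)
  obtain i where i: "i < n" "p ! i \<in> e" using e by (auto simp: in_set_conv_nth n_def)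
  \<comment> \<open>\<open>j\<close> and \<open>k\<close> are the positions before and after
    \<open>i\<close> on the cycle; a length of at least three keeps all three distinct.\<close>
  define j where "j = (if i = 0 then n - 1 else i - 1)"
  define k where "k = Suc i mod n"
  have j: "j < n" "Suc j mod n = i" using i n by (auto simp: j_def)
  have k: "k < n" using n by (simp add: k_def)
  have "k = (if Suc i = n then 0 else Suc i)" using i n by (auto simp: k_def)
  then have neq: "j \<noteq> i" "k \<noteq> i" "j \<noteq> k" using i n by (auto simp: j_def split: if_splits)
  then have pneq: "p ! j \<noteq> p ! i" "p ! k \<noteq> p ! i" "p ! j \<noteq> p ! k"
    using dist i j k by (simp_all add: nth_eq_iff_index_eq n_def)
  have e1: "{p ! j, p ! i} \<in> cycle_edges p" and e2: "{p ! i, p ! k} \<in> cycle_edges p"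
    using i j unfolding cycle_edges_def n_def[symmetric] k_def by blast+
  have "{{p ! j, p ! i}, {p ! i, p ! k}} \<subseteq> incident (edges F) (p ! i)"
    using e1 e2 sub by (auto simp: incident_def)
  moreover have "card {{p ! j, p ! i}, {p ! i, p ! k}} = 2"
    using pneq by (simp add: doubleton_eq_iff)
  moreover have "card (incident (edges F) (p ! i)) = 2"
    using reg sub i nth_mem[of i p] by (simp add: regular_def degree_incident n_def subset_iff)
  ultimately have "{{p ! j, p ! i}, {p ! i, p ! k}} = incident (edges F) (p ! i)"
    by (metis card.infinite card_subset_eq zero_neq_numeral)
  then have "e \<in> {{p ! j, p ! i}, {p ! i, p ! k}}" using e i by (auto simp: incident_def)
  then show ?thesis using e1 e2 by blast
qed

lemma cycle_edges_subset: "e \<in> cycle_edges p \<Longrightarrow> e \<subseteq> set p"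
  unfolding cycle_edges_def by (auto intro!: nth_mem mod_less_divisor)

lemma cycle_imp_circuit:
  assumes reg: "regular 2 F" and p: "cycle F p"
  shows "circuit (verts F) (edges F) (set p)"
proof -
  have n: "3 \<le> length p" using p by (simp add: cycle_def)
  have "K = set p" if K: "K \<subseteq> set p" "K \<noteq> {}" "closed_in (edges F) K" for K
  proof -
    obtain i where i: "i < length p" "p ! i \<in> K" using K by (metis all_not_in_conv in_set_conv_nth subsetD)
    have step: "p ! (Suc j mod length p) \<in> K" if "j < length p" "p ! j \<in> K" for j
    proof -
      have "{p ! j, p ! (Suc j mod length p)} \<in> edges F"
        using p that by (auto simp: cycle_def cycle_edges_def)
      then show ?thesis using K(3) that by (auto simp: closed_in_def)
    qed
    have all: "p ! ((i + m) mod length p) \<in> K" for m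
    proof (induction m)
      case (Suc m)
      have "(i + m) mod length p < length p" using n by (intro mod_less_divisor) linarith
      then show ?case using Suc step[of "(i + m) mod length p"] by (simp add: mod_Suc_eq)
    qed (use i in simp)
    \<comment> \<open>Going \<open>length p - i + j\<close> steps around the cycle from position
      \<open>i\<close> leads to position \<open>j\<close>.\<close>
    have "p ! j \<in> K" if "j < length p" for j
      using all[of "length p - i + j"] i that by simp
    then show ?thesis using K(1) by (auto simp: in_set_conv_nth)
  qed
  moreover have "closed_in (edges F) (set p)"
    using cycle_edges_at[OF reg p] cycle_edges_subset by (fastforce simp: closed_in_def)
  ultimately show ?thesis using p n unfolding circuit_def cycle_def by force
qed

text \<open>Degree two inside \<open>K\<close> yields a cycle there. Its vertex set is again a
  circuit, so minimality of \<open>K\<close> makes it all of \<open>K\<close>.\<close>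

lemma circuit_imp_cycle:
  assumes reg: "regular 2 F" and K: "circuit (verts F) (edges F) K"
  shows "\<exists>p. cycle F p \<and> set p = K"
proof -
  have sub: "K \<subseteq> verts F" "K \<noteq> {}" "closed_in (edges F) K" using K by (auto simp: circuit_def)
  have "incident (inside (edges F) K) v = incident (edges F) v" if "v \<in> K" for v
    using sub that by (auto simp: incident_def inside_def closed_in_def)
  then have "\<exists>p. 3 \<le> length p \<and> distinct p \<and> set p \<subseteq> K \<and> cycle_edges p \<subseteq> edges F"
    using reg sub by (intro min_degree_two_cycle)
      (auto simp: regular_def simple_graph_def degree_incident intro: finite_subset)
  then obtain p where p: "cycle F p" "set p \<subseteq> K" using sub by (auto simp: cycle_def)
  have "circuit (verts F) (edges F) (set p)" by (rule cycle_imp_circuit[OF reg p(1)])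
  then have "set p = K" using K p unfolding circuit_def by blast
  then show ?thesis using p by blast
qed

lemma cycle_card: "cycle F p \<Longrightarrow> card (set p) = length p"
  by (simp add: cycle_def distinct_card)

lemma odd_cycles_circuit:
  assumes "regular 2 F"
  shows "odd_cycles F \<longleftrightarrow> (\<forall>K. circuit (verts F) (edges F) K \<longrightarrow> odd (card K))"
  unfolding odd_cycles_def
  using cycle_imp_circuit[OF assms] circuit_imp_cycle[OF assms] cycle_card by metis

section \<open>Cyclic edge-connectivity as a bound on edge boundaries\<close>

lemma sym_adjacency: "sym {(a, b). {a, b} \<in> E}"
  by (auto simp: sym_def insert_commute)

lemma cycle_subset_component:
  assumes "cycle G p"
  shows "\<exists>C \<in> components G. set p \<subseteq> C \<and> p ! 0 \<in> C \<and>
    C = {w. (p ! 0, w) \<in> {(a, b). {a, b} \<in> edges G}\<^sup>*}"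
proof -
  let ?r = "{(a, b). {a, b} \<in> edges G}"
  let ?C = "{w. (p ! 0, w) \<in> ?r\<^sup>*}"
  have p: "3 \<le> length p" "set p \<subseteq> verts G" "cycle_edges p \<subseteq> edges G"
    using assms by (auto simp: cycle_def)
  have "(p ! 0, p ! i) \<in> ?r\<^sup>*" if "i < length p" for i
    using that
  proof (induction i)
    case (Suc i)
    then have "{p ! i, p ! Suc i} \<in> cycle_edges p"
      unfolding cycle_edges_def by (metis (mono_tags, lifting) Suc_lessD mem_Collect_eq mod_less)
    then have "(p ! i, p ! Suc i) \<in> ?r" using p by auto
    then show ?case using Suc by (meson Suc_lessD rtrancl.rtrancl_into_rtrancl)
  qed simp
  then have "set p \<subseteq> ?C" by (auto simp: in_set_conv_nth)
  moreover have "p ! 0 \<in> verts G"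
    using p nth_mem[of 0 p] by (metis gr0I not_numeral_le_zero subsetD)
  then have "?C \<in> components G" by (auto simp: components_def)
  ultimately show ?thesis by blast
qed

lemma component_subset_closed:
  assumes "closed_in (edges G) S" "v \<in> S"
  shows "{w. (v, w) \<in> {(a, b). {a, b} \<in> edges G}\<^sup>*} \<subseteq> S"
proof
  fix w assume "w \<in> {w. (v, w) \<in> {(a, b). {a, b} \<in> edges G}\<^sup>*}"
  then have "(v, w) \<in> {(a, b). {a, b} \<in> edges G}\<^sup>*" by simp
  then show "w \<in> S"
    using assms by (induction rule: rtrancl_induct) (auto simp: closed_in_def)
qed

text \<open>A forest on \<open>S\<close> has at most \<open>card S - 1\<close> edges, so degree
  three would force at least \<open>card S + 2\<close> boundary edges, which is four or
  more.\<close>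

lemma cubic_cycle_in_side:
  assumes cub: "cubic G" and S: "S \<subseteq> verts G" "2 \<le> card S" "card (boundary (edges G) S) < 4"
  shows "\<exists>p. cycle (delete_edges G (boundary (edges G) S)) p \<and> set p \<subseteq> S"
proof -
  have G: "simple_graph G" and fin: "finite S" "S \<noteq> {}"
    using cub S finite_subset by (auto simp: regular_def simple_graph_def)
  have "3 * card S = 2 * card (inside (edges G) S) + card (boundary (edges G) S)"
    by (rule handshake_regular[OF cub S(1)])
  then have "\<not> card (inside (edges G) S) < card S" using S by linarith
  then obtain p where p: "3 \<le> length p" "distinct p" "set p \<subseteq> S" "cycle_edges p \<subseteq> edges G"
    using acyclic_inside_card[of "edges G" S] G fin simple_graph_finite_edges[OF G]
    by (auto simp: simple_graph_def)
  moreover have "cycle_edges p \<inter> boundary (edges G) S = {}"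
    using p cycle_edges_subset[of _ p] by (fastforce simp: boundary_def)
  ultimately show ?thesis
    using S by (intro exI[of _ p]) (auto simp: cycle_def delete_edges_def)
qed

text \<open>Otherwise deleting the boundary would leave a cycle on each side, in different
  components.\<close>

lemma cyclically_4_edge_connected_boundary:
  assumes cub: "cubic G" and con: "cyclically_edge_connected 4 G"
    and S: "S \<subseteq> verts G" "2 \<le> card S" "2 \<le> card (verts G - S)"
  shows "4 \<le> card (boundary (edges G) S)"
proof (rule ccontr)
  assume "\<not> 4 \<le> card (boundary (edges G) S)"
  then have less: "card (boundary (edges G) S) < 4" by simp
  define G' where "G' = delete_edges G (boundary (edges G) S)"
  have compl: "boundary (edges G) (verts G - S) = boundary (edges G) S"
    using cub by (intro boundary_complement) (auto simp: regular_def simple_graph_def)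
  obtain p where p: "cycle G' p" "set p \<subseteq> S"
    using cubic_cycle_in_side[OF cub S(1,2) less] by (auto simp: G'_def)
  obtain q where q: "cycle G' q" "set q \<subseteq> verts G - S"
    using cubic_cycle_in_side[OF cub _ S(3)] less by (auto simp: G'_def compl)
  obtain C where C: "C \<in> components G'" "set p \<subseteq> C"
      "C = {w. (p ! 0, w) \<in> {(a, b). {a, b} \<in> edges G'}\<^sup>*}"
    using cycle_subset_component[OF p(1)] by blast
  obtain D where D: "D \<in> components G'" "set q \<subseteq> D" using cycle_subset_component[OF q(1)] by blast
  have "closed_in (edges G') S"
    by (auto simp: G'_def delete_edges_def closed_in_def boundary_def)
  moreover have "p ! 0 \<in> S" using p by (metis cycle_def gr0I not_numeral_le_zero nth_mem subsetD)
  ultimately have "C \<subseteq> S" using C(3) component_subset_closed by metis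
  moreover have "q ! 0 \<in> set q" using q by (metis cycle_def gr0I not_numeral_le_zero nth_mem)
  ultimately have "C \<noteq> D" using q D by blast
  moreover have "boundary (edges G) S \<subseteq> edges G" by (auto simp: boundary_def)
  ultimately show False
    using con less p q C D unfolding cyclically_edge_connected_def G'_def by metis
qed

text \<open>If two components left by \<open>X\<close> contain cycles, the boundary of one of them
  lies in \<open>X\<close>. The size bounds of three come from the least length of a cycle.\<close>

lemma cyclically_edge_connected_boundaryI:
  assumes G: "simple_graph G"
    and S: "\<And>S. S \<subseteq> verts G \<Longrightarrow> 3 \<le> card S \<Longrightarrow> 3 \<le> card (verts G - S) \<Longrightarrow>
      k \<le> card (boundary (edges G) S)"
  shows "cyclically_edge_connected k G"
  unfolding cyclically_edge_connected_def
proof (intro allI impI notI, elim bexE conjE exE)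
  fix X C D p q
  assume X: "X \<subseteq> edges G" "card X < k"
    and C: "C \<in> components (delete_edges G X)" and D: "D \<in> components (delete_edges G X)" and "C \<noteq> D"
    and p: "cycle (delete_edges G X) p" "set p \<subseteq> C" and q: "cycle (delete_edges G X) q" "set q \<subseteq> D"
  let ?r = "{(a, b). {a, b} \<in> edges (delete_edges G X)}"
  have sub: "e \<subseteq> verts G" if "e \<in> edges G" for e using G that by (auto simp: simple_graph_def)
  obtain v where v: "v \<in> verts G" "C = {w. (v, w) \<in> ?r\<^sup>*}"
    using C by (auto simp: components_def delete_edges_def)
  obtain v' where v': "v' \<in> verts G" "D = {w. (v', w) \<in> ?r\<^sup>*}"
    using D by (auto simp: components_def delete_edges_def)
  have closed: "closed_in (edges (delete_edges G X)) (verts G)"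
    using sub by (auto simp: closed_in_def delete_edges_def)
  have CV: "C \<subseteq> verts G" and DV: "D \<subseteq> verts G"
    using component_subset_closed[OF closed] v v' by metis+
  have symr: "sym (?r\<^sup>*)" by (intro sym_rtrancl sym_adjacency)
  have "C \<inter> D = {}"
  proof (rule ccontr)
    assume "C \<inter> D \<noteq> {}"
    then obtain w where "(v, w) \<in> ?r\<^sup>*" "(v', w) \<in> ?r\<^sup>*" using v(2) v'(2) by blast
    then have vv': "(v, v') \<in> ?r\<^sup>*" "(v', v) \<in> ?r\<^sup>*"
      using symD[OF symr] by (blast intro: rtrancl_trans)+
    then have "C = D" unfolding v(2) v'(2) by (meson Collect_cong rtrancl_trans)
    then show False using \<open>C \<noteq> D\<close> by simp
  qed
  then have "D \<subseteq> verts G - C" using DV by blast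
  then have "set q \<subseteq> verts G - C" using q by blast
  moreover have fin: "finite (verts G)" using G by (simp add: simple_graph_def)
  ultimately have "3 \<le> card (verts G - C)"
    using q(1) card_mono[of "verts G - C" "set q"] by (simp add: cycle_def distinct_card)
  moreover have "3 \<le> card C"
    using p card_mono[OF finite_subset[OF CV fin], of "set p"]
    by (simp add: cycle_def distinct_card)
  ultimately have "k \<le> card (boundary (edges G) C)" using S CV by blast
  also have "boundary (edges G) C \<subseteq> X"
  proof
    fix e assume e: "e \<in> boundary (edges G) C"
    then obtain a where a: "a \<in> e" "a \<in> C" by (auto simp: boundary_def)
    obtain b where b: "b \<in> e" "b \<notin> C" using e by (auto simp: boundary_def)
    have "card e = 2" using e G by (auto simp: boundary_def simple_graph_def)
    then have "e = {a, b}" using a b by (metis card_2_iff insertE singletonD insert_commute)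
    show "e \<in> X"
    proof (rule ccontr)
      assume "e \<notin> X"
      then have "(a, b) \<in> ?r" using e \<open>e = {a, b}\<close> by (auto simp: boundary_def delete_edges_def)
      then show False using a b v by (auto intro: rtrancl_into_rtrancl)
    qed
  qed
  then have "card (boundary (edges G) C) \<le> card X"
    using X simple_graph_finite_edges[OF G] finite_subset by (metis card_mono)
  finally show False using X by simp
qed

text \<open>A single vertex on either side has exactly three boundary edges, and every other cut has
  at least four. So the graph is 3-edge-connected.\<close>

lemma boundary_ge_3:
  assumes cub: "cubic G" and con: "cyclically_edge_connected 4 G"
    and S: "S \<subseteq> verts G" "S \<noteq> {}" "S \<noteq> verts G"
  shows "3 \<le> card (boundary (edges G) S)"
proof -
  have fin: "finite (verts G)" using cub by (simp add: regular_def simple_graph_def)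
  have single: "card (boundary (edges G) {v}) = 3" if "v \<in> verts G" for v
  proof -
    have "e \<subseteq> {v} \<longrightarrow> e \<notin> edges G" for e
      using cub card_mono[of "{v}" e] by (fastforce simp: regular_def simple_graph_def)
    then have "inside (edges G) {v} = {}" by (auto simp: inside_def)
    then show ?thesis using handshake_regular[OF cub, of "{v}"] that by simp
  qed
  have compl: "boundary (edges G) (verts G - S) = boundary (edges G) S"
    using cub by (intro boundary_complement) (auto simp: regular_def simple_graph_def)
  have finS: "finite S" and finS': "finite (verts G - S)" using S fin finite_subset by auto
  have "verts G - S \<noteq> {}" using S by blast
  then have "card S \<noteq> 0" "card (verts G - S) \<noteq> 0" using finS finS' S by simp_all
  then consider "card S = 1" | "card (verts G - S) = 1" | "2 \<le> card S" "2 \<le> card (verts G - S)"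
    by linarith
  then show ?thesis
  proof cases
    case 1
    then show ?thesis using single S by (metis card_1_singletonE insert_subset order_refl)
  next
    case 2
    then obtain v where v: "verts G - S = {v}" by (metis card_1_singletonE)
    then have "v \<in> verts G" by blast
    then show ?thesis using single[of v] compl v by simp
  next
    case 3
    then show ?thesis using cyclically_4_edge_connected_boundary[OF cub con S(1)] by simp
  qed
qed

section \<open>Tutte's theorem\<close>

definition matching :: "'v set set \<Rightarrow> bool" where
  "matching M \<longleftrightarrow> (\<forall>e\<in>M. \<forall>e'\<in>M. e \<noteq> e' \<longrightarrow> e \<inter> e' = {})"

text \<open>Coarser than the partition into components: the classes need not be connected.\<close>

definition separation :: "'v set set \<Rightarrow> 'v set \<Rightarrow> 'v set set \<Rightarrow> bool" where
  "separation E S \<K> \<longleftrightarrow> \<Union>\<K> = S \<and> disjoint \<K> \<and> {} \<notin> \<K> \<and> (\<forall>e \<in> inside E S. \<exists>K\<in>\<K>. e \<subseteq> K)"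

lemma card_Union_matching:
  assumes "finite M" "matching M" "\<And>e. e \<in> M \<Longrightarrow> card e = 2"
  shows "card (\<Union>M) = 2 * card M"
proof -
  have "card (\<Union>M) = (\<Sum>e\<in>M. card e)"
  proof (rule card_Union_disjoint)
    show "finite e" if "e \<in> M" for e using assms(3)[OF that] by (intro card_ge_0_finite) simp
  qed (use assms in \<open>auto simp: matching_def pairwise_def disjnt_def\<close>)
  then show ?thesis using assms by simp
qed

definition max_matching :: "'v set set \<Rightarrow> 'v set \<Rightarrow> 'v set set \<Rightarrow> bool" where
  "max_matching E V M \<longleftrightarrow> M \<subseteq> inside E V \<and> matching M \<and>
     (\<forall>M'. M' \<subseteq> inside E V \<longrightarrow> matching M' \<longrightarrow> card M' \<le> card M)"

context
  fixes E :: "'v set set"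
  assumes card2: "\<And>e. e \<in> E \<Longrightarrow> card e = 2"
begin

lemma finite_inside: "finite V \<Longrightarrow> finite (inside E V)"
  by (rule finite_subset[of _ "Pow V"]) (auto simp: inside_def)

lemma ex_max_matching:
  assumes "finite V" shows "\<exists>M. max_matching E V M"
proof -
  define Q where "Q M \<longleftrightarrow> M \<subseteq> inside E V \<and> matching M" for M
  have "Q {}" by (simp add: Q_def matching_def)
  moreover have "card M < Suc (card (inside E V))" if "Q M" for M
    using that card_mono[OF finite_inside[OF assms]] by (simp add: Q_def less_Suc_eq_le)
  ultimately obtain M where "Q M" "\<And>M'. Q M' \<Longrightarrow> card M' \<le> card M"
    using ex_has_greatest_nat[of Q "{}" card "Suc (card (inside E V))"] by (metis less_imp_le)
  then show ?thesis by (auto simp: max_matching_def Q_def)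
qed

lemma matching_card_Union:
  assumes "finite V" "M \<subseteq> inside E V" "matching M"
  shows "finite M" "finite (\<Union>M)" "\<Union>M \<subseteq> V" "card (\<Union>M) = 2 * card M"
proof -
  show "finite M" using assms finite_inside finite_subset by metis
  then show "card (\<Union>M) = 2 * card M"
    using assms card2 by (intro card_Union_matching) (auto simp: inside_def)
  show "\<Union>M \<subseteq> V" using assms by (auto simp: inside_def)
  then show "finite (\<Union>M)" using assms finite_subset by metis
qed

lemma max_matching_card: "max_matching E V M \<Longrightarrow> max_matching E V N \<Longrightarrow> card M = card N"
  by (simp add: max_matching_def eq_iff)

lemma max_matching_no_edge:
  assumes "finite V" "max_matching E V M" "u \<in> V" "v \<in> V" "u \<notin> \<Union>M" "v \<notin> \<Union>M"
  shows "{u, v} \<notin> E"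
proof
  assume e: "{u, v} \<in> E"
  have M: "M \<subseteq> inside E V" "matching M" using assms by (auto simp: max_matching_def)
  have "insert {u, v} M \<subseteq> inside E V" using M e assms by (auto simp: inside_def)
  moreover have "matching (insert {u, v} M)" using M assms by (auto simp: matching_def)
  ultimately have "card (insert {u, v} M) \<le> card M" using assms by (auto simp: max_matching_def)
  moreover have "{u, v} \<notin> M" using assms by blast
  ultimately show False using matching_card_Union(1)[OF assms(1) M] by simp
qed

text \<open>Schrijver's exchange argument, by induction on the distance of two missed vertices.\<close>

lemma max_matching_deficiency_one:
  assumes fin: "finite V" and conn: "\<And>u v. u \<in> V \<Longrightarrow> v \<in> V \<Longrightarrow> (u, v) \<in> {(a, b). {a, b} \<in> inside E V}\<^sup>*"
    and missed: "\<And>v. v \<in> V \<Longrightarrow> \<exists>M. max_matching E V M \<and> v \<notin> \<Union>M"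
    and M: "max_matching E V M"
    and u: "u \<in> V" "u \<notin> \<Union>M" and v: "v \<in> V" "v \<notin> \<Union>M"
  shows "u = v"
proof -
  let ?r = "{(a, b). {a, b} \<in> inside E V}"
  have "u = v" if "max_matching E V M" "(u, v) \<in> ?r ^^ n"
    "u \<in> V" "u \<notin> \<Union>M" "v \<in> V" "v \<notin> \<Union>M" for M u v n
    using that
  proof (induction n arbitrary: M u v rule: less_induct)
    case (less n)
    show ?case
    proof (rule ccontr)
      assume "u \<noteq> v"
      then obtain m where m: "n = Suc m" using less.prems(2) by (cases n) auto
      then obtain t where t: "(u, t) \<in> ?r" "(t, v) \<in> ?r ^^ m"
        using less.prems(2) by (metis relpow_Suc_D2)
      then have tV: "t \<in> V" and ut: "{u, t} \<in> E" by (auto simp: inside_def)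
      have "t \<noteq> v" using ut less.prems max_matching_no_edge[OF fin] by metis
      then have "m \<noteq> 0" using t by (cases m) auto
      then have 1: "1 < n" "m < n" using m by auto
      have "u \<noteq> t" using card2[OF ut] by auto
      have ut1: "(u, t) \<in> ?r ^^ 1" using t(1) by simp
      define Q where "Q N \<longleftrightarrow> max_matching E V N \<and> t \<notin> \<Union>N" for N
      obtain N0 where "Q N0" using missed[OF tV] by (auto simp: Q_def)
      have M': "M \<subseteq> inside E V" "matching M" using less.prems by (auto simp: max_matching_def)
      note finM = matching_card_Union[OF fin M']
      \<comment> \<open>Among the maximum matchings that miss \<open>t\<close>, choose one that
        shares as many edges as possible with \<open>M\<close>.\<close>
      have "card (M \<inter> N) < Suc (card M)" for N
        using finM(1) by (simp add: less_Suc_eq_le card_mono)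
      then obtain N where N: "Q N" and best: "\<And>N'. Q N' \<Longrightarrow> card (M \<inter> N') \<le> card (M \<inter> N)"
        using ex_has_greatest_nat[of Q N0 "\<lambda>N. card (M \<inter> N)" "Suc (card M)"] \<open>Q N0\<close>
        by (metis less_imp_le)
      have NM: "max_matching E V N" and tN: "t \<notin> \<Union>N" using N by (auto simp: Q_def)
      have N': "N \<subseteq> inside E V" "matching N" using NM by (auto simp: max_matching_def)
      note finN = matching_card_Union[OF fin N']
      \<comment> \<open>The walks from \<open>u\<close> to \<open>t\<close> and from
        \<open>t\<close> to \<open>v\<close> are shorter than \<open>n\<close>, so by induction a
        maximum matching that misses \<open>t\<close> covers both \<open>u\<close> and
        \<open>v\<close>.\<close>
      have uN: "u \<in> \<Union>N" using less.IH[OF 1(1) NM ut1] tN tV less.prems \<open>u \<noteq> t\<close> by blast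
      have vN: "v \<in> \<Union>N" using less.IH[OF 1(2) NM t(2)] tN tV less.prems \<open>t \<noteq> v\<close> by blast
      \<comment> \<open>Maximum matchings cover equally many vertices. As \<open>N\<close> covers
        \<open>u\<close> and \<open>v\<close>, which \<open>M\<close> misses, \<open>M\<close>
        covers at least two vertices missed by \<open>N\<close>, and one of them differs from
        \<open>t\<close>.\<close>
      have "card (\<Union>M) = card (\<Union>N)"
        using finM finN max_matching_card[OF less.prems(1) NM] by simp
      then have "card (\<Union>M - \<Union>N) = card (\<Union>N - \<Union>M)"
        using finM(2) finN(2) by (metis card_Diff_subset_Int Int_commute finite_Int)
      moreover have "{u, v} \<subseteq> \<Union>N - \<Union>M" using uN vN less.prems by blast
      then have "2 \<le> card (\<Union>N - \<Union>M)"
        using card_mono[of "\<Union>N - \<Union>M" "{u, v}"] finN(2) \<open>u \<noteq> v\<close> by simp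
      ultimately have "\<not> \<Union>M - \<Union>N \<subseteq> {t}"
        using card_mono[of "{t}" "\<Union>M - \<Union>N"] by auto
      then obtain x where x: "x \<in> \<Union>M" "x \<notin> \<Union>N" "x \<noteq> t" by blast
      then obtain e where e: "e \<in> M" "x \<in> e" by blast
      have eE: "e \<in> E" "e \<subseteq> V" using e M' by (auto simp: inside_def)
      then obtain y where y: "e = {x, y}" using card2 e
        by (metis card_2_iff doubleton_eq_iff insertE singletonD)
      have "y \<in> \<Union>N" using max_matching_no_edge[OF fin NM, of x y] eE x y by auto
      then obtain f where f: "f \<in> N" "y \<in> f" by blast
      have "f \<noteq> e" using x e f by blast
      have "y \<in> e \<inter> f" using f y by simp
      then have fM: "f \<notin> M"
        using M'(2) e(1) \<open>f \<noteq> e\<close> unfolding matching_def by (metis empty_iff)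
      \<comment> \<open>Exchanging \<open>f\<close> for \<open>e\<close> keeps the size and still
        misses \<open>t\<close>, but gains a common edge with \<open>M\<close>.\<close>
      define N'' where "N'' = insert e (N - {f})"
      have "e \<notin> N" using x e by blast
      then have "card N'' = Suc (card (N - {f}))" using finN(1) unfolding N''_def by simp
      then have cardN: "card N'' = card N" using card_Suc_Diff1[OF finN(1) f(1)] by simp
      have "y \<notin> \<Union>(N - {f})" using f N'(2) by (auto simp: matching_def)
      then have "g \<inter> e = {}" if "g \<in> N - {f}" for g using that x(2) unfolding y by blast
      then have "matching N''" using N'(2) by (auto simp: N''_def matching_def Int_commute)
      moreover have "N'' \<subseteq> inside E V" using N' eE by (auto simp: N''_def inside_def)
      ultimately have "max_matching E V N''" using NM cardN by (simp add: max_matching_def)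
      moreover have "t \<notin> \<Union>N''" using tN x y \<open>y \<in> \<Union>N\<close> by (auto simp: N''_def)
      ultimately have "card (M \<inter> N'') \<le> card (M \<inter> N)" using best by (simp add: Q_def)
      moreover have "M \<inter> N'' = insert e (M \<inter> N)" using e fM by (auto simp: N''_def)
      ultimately show False using \<open>e \<notin> N\<close> finM(1) by simp
    qed
  qed
  then show ?thesis using conn[OF u(1) v(1)] M u v by (meson rtrancl_imp_relpow)
qed

lemma separation_Un:
  assumes "A \<inter> B = {}" "separation E A \<K>" "separation E B \<L>"
    "\<And>e. e \<in> E \<Longrightarrow> e \<subseteq> A \<union> B \<Longrightarrow> e \<subseteq> A \<or> e \<subseteq> B"
  shows "separation E (A \<union> B) (\<K> \<union> \<L>)" "\<K> \<inter> \<L> = {}"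
proof -
  have K: "\<Union>\<K> = A" "disjoint \<K>" "{} \<notin> \<K>" "\<And>e. e \<in> inside E A \<Longrightarrow> \<exists>K\<in>\<K>. e \<subseteq> K"
    using assms(2) by (simp_all add: separation_def)
  have L: "\<Union>\<L> = B" "disjoint \<L>" "{} \<notin> \<L>" "\<And>e. e \<in> inside E B \<Longrightarrow> \<exists>K\<in>\<L>. e \<subseteq> K"
    using assms(3) by (simp_all add: separation_def)
  have AB: "X \<inter> Y = {}" if "X \<in> \<K>" "Y \<in> \<L>" for X Y
    using that K(1) L(1) assms(1) by blast
  have "disjoint (\<K> \<union> \<L>)"
    unfolding disjoint_def
  proof (intro ballI impI)
    fix X Y assume "X \<in> \<K> \<union> \<L>" "Y \<in> \<K> \<union> \<L>" "X \<noteq> Y"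
    then show "X \<inter> Y = {}"
      using disjointD[OF K(2), of X Y] disjointD[OF L(2), of X Y] AB[of X Y] AB[of Y X] by blast
  qed
  moreover have "\<exists>K\<in>\<K> \<union> \<L>. e \<subseteq> K" if "e \<in> inside E (A \<union> B)" for e
  proof -
    have "e \<in> inside E A \<or> e \<in> inside E B" using that assms(4)[of e] by (auto simp: inside_def)
    then show ?thesis using K(4) L(4) by blast
  qed
  ultimately show "separation E (A \<union> B) (\<K> \<union> \<L>)"
    using K(1,3) L(1,3) unfolding separation_def by auto
  show "\<K> \<inter> \<L> = {}"
  proof (rule ccontr)
    assume "\<K> \<inter> \<L> \<noteq> {}"
    then obtain X where "X \<in> \<K>" "X \<in> \<L>" by blast
    then show False using AB[of X X] K(3) by auto
  qed
qed

lemma finite_separation: "finite S \<Longrightarrow> separation E S \<K> \<Longrightarrow> finite \<K>"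
  by (auto simp: separation_def intro: finite_UnionD)

text \<open>The nontrivial inequality of the Tutte-Berge formula, by induction on
  \<open>card V\<close>. A disconnected graph splits into smaller ones, a vertex covered by all
  maximum matchings moves into \<open>U\<close>, and otherwise a maximum matching misses at most one
  vertex, so \<open>U\<close> can be empty.\<close>

lemma tutte_berge:
  assumes "finite V"
  shows "\<exists>M U \<K>. max_matching E V M \<and> U \<subseteq> V \<and> separation E (V - U) \<K> \<and>
    card U + card V \<le> card {K \<in> \<K>. odd (card K)} + 2 * card M"
  using assms
proof (induction "card V" arbitrary: V rule: less_induct)
  case less
  note fin = \<open>finite V\<close>
  obtain M where M: "max_matching E V M" using ex_max_matching[OF fin] by blast
  let ?r = "{(a, b). {a, b} \<in> inside E V}"
  show ?case
  proof (cases "\<exists>A B. A \<union> B = V \<and> A \<inter> B = {} \<and> A \<noteq> {} \<and> B \<noteq> {} \<and>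
      (\<forall>e\<in>E. e \<subseteq> V \<longrightarrow> e \<subseteq> A \<or> e \<subseteq> B)")
    case True
    then obtain A B where AB: "A \<union> B = V" "A \<inter> B = {}" "A \<noteq> {}" "B \<noteq> {}"
      and sep: "\<And>e. e \<in> E \<Longrightarrow> e \<subseteq> V \<Longrightarrow> e \<subseteq> A \<or> e \<subseteq> B" by metis
    have finAB: "finite A" "finite B" using AB fin by auto
    have "A \<subset> V" "B \<subset> V" using AB by auto
    then have less_card: "card A < card V" "card B < card V"
      using fin by (auto intro: psubset_card_mono)
    obtain M1 U1 \<K> where 1: "max_matching E A M1" "U1 \<subseteq> A" "separation E (A - U1) \<K>"
        "card U1 + card A \<le> card {K \<in> \<K>. odd (card K)} + 2 * card M1"
      using less.hyps[OF less_card(1) finAB(1)] by blast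
    obtain M2 U2 \<L> where 2: "max_matching E B M2" "U2 \<subseteq> B" "separation E (B - U2) \<L>"
        "card U2 + card B \<le> card {K \<in> \<L>. odd (card K)} + 2 * card M2"
      using less.hyps[OF less_card(2) finAB(2)] by blast
    have m1: "M1 \<subseteq> inside E A" "matching M1" and m2: "M2 \<subseteq> inside E B" "matching M2"
      using 1(1) 2(1) by (simp_all add: max_matching_def)
    note f1 = matching_card_Union[OF finAB(1) m1] and f2 = matching_card_Union[OF finAB(2) m2]
    have eq: "(A - U1) \<union> (B - U2) = V - (U1 \<union> U2)" using AB 1(2) 2(2) by blast
    have disj: "(A - U1) \<inter> (B - U2) = {}" using AB by blast
    have split: "e \<subseteq> A - U1 \<or> e \<subseteq> B - U2" if "e \<in> E" "e \<subseteq> (A - U1) \<union> (B - U2)" for e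
    proof -
      have "e \<subseteq> A \<or> e \<subseteq> B" using that sep[of e] AB(1) by blast
      then show ?thesis using that(2) AB(2) by blast
    qed
    have S: "separation E (V - (U1 \<union> U2)) (\<K> \<union> \<L>)" "\<K> \<inter> \<L> = {}"
      using separation_Un[OF disj 1(3) 2(3) split] eq by auto
    have "e \<inter> e' = {}" if "e \<in> M1" "e' \<in> M2" for e e'
      using that f1(3) f2(3) AB(2) by blast
    then have "matching (M1 \<union> M2)"
      using m1(2) m2(2) unfolding matching_def by (metis Int_commute Un_iff)
    moreover have "M1 \<union> M2 \<subseteq> inside E V" using m1 m2 AB by (auto simp: inside_def)
    ultimately have "card (M1 \<union> M2) \<le> card M" using M by (auto simp: max_matching_def)
    moreover have "M1 \<inter> M2 = {}"
    proof (rule ccontr)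
      assume "M1 \<inter> M2 \<noteq> {}"
      then obtain e where "e \<in> M1" "e \<in> M2" by blast
      then have "e \<subseteq> A \<inter> B" "card e = 2" using m1 m2 card2 by (auto simp: inside_def)
      then show False using AB by auto
    qed
    ultimately have "card M1 + card M2 \<le> card M" using f1 f2 by (simp add: card_Un_disjoint)
    moreover have "card (U1 \<union> U2) = card U1 + card U2"
      using 1 2 AB finAB by (intro card_Un_disjoint) (auto intro: finite_subset)
    moreover have "card V = card A + card B" using AB finAB by (metis card_Un_disjoint)
    moreover have "finite \<K>" "finite \<L>"
      using finite_separation[OF _ 1(3)] finite_separation[OF _ 2(3)] finAB by auto
    then have "card ({K \<in> \<K>. odd (card K)} \<union> {K \<in> \<L>. odd (card K)}) =
        card {K \<in> \<K>. odd (card K)} + card {K \<in> \<L>. odd (card K)}"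
      using S(2) by (intro card_Un_disjoint) auto
    moreover have "{K \<in> \<K> \<union> \<L>. odd (card K)} = {K \<in> \<K>. odd (card K)} \<union> {K \<in> \<L>. odd (card K)}" by blast
    ultimately have "card (U1 \<union> U2) + card V \<le> card {K \<in> \<K> \<union> \<L>. odd (card K)} + 2 * card M"
      using 1(4) 2(4) by simp
    moreover have "U1 \<union> U2 \<subseteq> V" using AB(1) 1(2) 2(2) by blast
    ultimately show ?thesis using M S(1) by blast
  next
    case nosep: False
    have conn: "(u, v) \<in> ?r\<^sup>*" if "u \<in> V" "v \<in> V" for u v
    proof (rule ccontr)
      assume not: "(u, v) \<notin> ?r\<^sup>*"
      define A where "A = {w \<in> V. (u, w) \<in> ?r\<^sup>*}"
      have "e \<subseteq> A \<or> e \<subseteq> V - A" if eV: "e \<in> E" "e \<subseteq> V" for e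
      proof -
        obtain a b where e: "e = {a, b}" using card2[OF eV(1)] by (meson card_2_iff)
        then have "(a, b) \<in> ?r" "(b, a) \<in> ?r" using that by (auto simp: inside_def insert_commute)
        then have "(u, a) \<in> ?r\<^sup>* \<longleftrightarrow> (u, b) \<in> ?r\<^sup>*" by (meson rtrancl_into_rtrancl)
        then have "a \<in> A \<longleftrightarrow> b \<in> A" using that e by (simp add: A_def)
        then show ?thesis using e that by auto
      qed
      moreover have "u \<in> A" "v \<in> V - A" "A \<subseteq> V" using that not by (auto simp: A_def)
      ultimately show False using nosep by (metis Diff_disjoint Diff_partition empty_iff)
    qed
    show ?thesis
    proof (cases "\<exists>v\<in>V. \<forall>M. max_matching E V M \<longrightarrow> v \<in> \<Union>M")
      case True
      then obtain v where v: "v \<in> V" "\<And>M. max_matching E V M \<Longrightarrow> v \<in> \<Union>M" by blast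
      have "card (V - {v}) < card V" using v fin by (metis card_Diff1_less)
      then obtain M1 U \<K> where 1: "max_matching E (V - {v}) M1" "U \<subseteq> V - {v}"
          "separation E (V - {v} - U) \<K>"
          "card U + card (V - {v}) \<le> card {K \<in> \<K>. odd (card K)} + 2 * card M1"
        using less.hyps[of "V - {v}"] fin by auto
      \<comment> \<open>\<open>M1\<close> misses \<open>v\<close>, hence is not maximum in
        \<open>V\<close>. The gain of at least one edge pays for counting \<open>v\<close> both in
        \<open>U\<close> and in \<open>V\<close>.\<close>
      have m1: "M1 \<subseteq> inside E V" "matching M1" "v \<notin> \<Union>M1"
        using 1 by (auto simp: max_matching_def inside_def)
      then have "\<not> max_matching E V M1" using v by blast
      then have "card M1 \<noteq> card M" using m1 M by (auto simp: max_matching_def)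
      moreover have "card M1 \<le> card M" using m1 M by (auto simp: max_matching_def)
      ultimately have "Suc (card M1) \<le> card M" by simp
      moreover have "card (insert v U) = Suc (card U)"
        using 1(2) fin finite_subset by (subst card_insert_disjoint) auto
      moreover have "card V = Suc (card (V - {v}))" using v fin by (metis card_Suc_Diff1)
      ultimately have "card (insert v U) + card V \<le> card {K \<in> \<K>. odd (card K)} + 2 * card M"
        using 1(4) by linarith
      moreover have "V - {v} - U = V - insert v U" by blast
      then have "separation E (V - insert v U) \<K>" using 1(3) by simp
      moreover have "insert v U \<subseteq> V" using 1(2) v(1) by blast
      ultimately show ?thesis using M by blast
    next
      case False
      then have missed: "\<exists>M. max_matching E V M \<and> v \<notin> \<Union>M" if "v \<in> V" for v using that by blast
      have M': "M \<subseteq> inside E V" "matching M" using M by (auto simp: max_matching_def)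
      note f = matching_card_Union[OF fin M']
      have "u = v" if "u \<in> V - \<Union>M" "v \<in> V - \<Union>M" for u v
        using that by (intro max_matching_deficiency_one[OF fin conn missed M]) auto
      then have "card (V - \<Union>M) \<le> Suc 0" using fin by (subst card_le_Suc0_iff_eq) auto
      then have le: "card V \<le> Suc (2 * card M)" using f fin by (simp add: card_Diff_subset)
      \<comment> \<open>A nonempty \<open>V\<close> is the only class. For even
        \<open>card V\<close> it does not count as odd, but then parity removes the deficiency of
        one.\<close>
      define \<K> where "\<K> = (if V = {} then {} else {V})"
      have "separation E (V - {}) \<K>"
        using card2[of "{}"] by (auto simp: \<K>_def separation_def inside_def disjoint_def)
      moreover have "card V \<le> card {K \<in> \<K>. odd (card K)} + 2 * card M"
      proof (cases "odd (card V)")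
        case True
        then have "{K \<in> \<K>. odd (card K)} = {V}" by (auto simp: \<K>_def)
        then show ?thesis using le by simp
      next
        case False
        then have "card V \<noteq> Suc (2 * card M)" by auto
        then show ?thesis using le by simp
      qed
      ultimately show ?thesis
        using M by (intro exI[of _ M] exI[of _ "{}"] exI[of _ \<K>] conjI) simp_all
    qed
  qed
qed

end

section \<open>The ends of a gadget-pair are not adjacent\<close>

lemma even_card_verts_cubic:
  assumes "cubic G" shows "even (card (verts G))"
proof -
  have "boundary (edges G) (verts G) = {}"
    using assms by (auto simp: boundary_def regular_def simple_graph_def)
  then have "3 * card (verts G) = 2 * card (inside (edges G) (verts G))"
    using handshake_regular[OF assms order_refl] by simp
  then show ?thesis by presburger
qed

text \<open>Tutte-Berge on \<open>G\<close> without \<open>W\<close>, where \<open>S\<close> is the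
  union of \<open>W\<close> and the Tutte set. The number of vertices to be matched is even, so the
  deficiency is at least two. Edges leaving a class end in \<open>S\<close>, so the class boundaries
  together fit into that of \<open>S\<close>.\<close>

lemma tutte_cubic:
  assumes cub: "cubic G" and con: "cyclically_edge_connected 4 G"
    and W: "W \<subseteq> verts G" "W \<noteq> {}" "even (card W)"
    and none: "\<not> (\<exists>M. M \<subseteq> inside (edges G) (verts G - W) \<and> matching M \<and> \<Union>M = verts G - W)"
  shows "\<exists>S \<K>. W \<subseteq> S \<and> S \<subseteq> verts G \<and> separation (edges G) (verts G - S) \<K> \<and>
    card S + 2 \<le> card \<K> + card W \<and>
    (\<Sum>K\<in>\<K>. card (boundary (edges G) K)) \<le> card (boundary (edges G) S) \<and>
    (\<forall>K\<in>\<K>. 3 \<le> card (boundary (edges G) K))"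
proof -
  let ?E = "edges G"
  have G: "simple_graph G" and fin: "finite (verts G)"
    using cub by (auto simp: regular_def simple_graph_def)
  have finE: "finite ?E" using simple_graph_finite_edges[OF G] .
  have card2: "card e = 2" "e \<subseteq> verts G" if "e \<in> ?E" for e using G that by (auto simp: simple_graph_def)
  have finW: "finite W" using W fin finite_subset by blast
  obtain M U \<K> where M: "max_matching ?E (verts G - W) M" and U: "U \<subseteq> verts G - W"
    and sep: "separation ?E (verts G - W - U) \<K>"
    and le: "card U + card (verts G - W) \<le> card {K \<in> \<K>. odd (card K)} + 2 * card M"
    using tutte_berge[OF card2(1) finite_Diff[OF fin]] by blast
  have M': "M \<subseteq> inside ?E (verts G - W)" "matching M"
    using M by (auto simp: max_matching_def)
  have f: "\<Union>M \<subseteq> verts G - W" "card (\<Union>M) = 2 * card M"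
    using matching_card_Union(3,4)[OF card2(1) finite_Diff[OF fin] M'] by simp_all
  have "\<Union>M \<noteq> verts G - W" using none M' by metis
  then have "card (\<Union>M) < card (verts G - W)" using f fin by (intro psubset_card_mono) auto
  moreover have "even (card (verts G - W))"
    using even_card_verts_cubic[OF cub] W finW by (simp add: card_Diff_subset card_mono fin)
  ultimately have "2 * card M + 2 \<le> card (verts G - W)" using f(2) by presburger
  then have oddK: "card U + 2 \<le> card {K \<in> \<K>. odd (card K)}" using le by linarith
  have eqS: "verts G - W - U = verts G - (W \<union> U)" by blast
  have fin\<K>: "finite \<K>" using sep fin by (auto simp: separation_def intro: finite_UnionD)
  then have "card {K \<in> \<K>. odd (card K)} \<le> card \<K>" by (intro card_mono) auto
  moreover have "card (W \<union> U) \<le> card U + card W" by (metis add.commute card_Un_le)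
  ultimately have 1: "card (W \<union> U) + 2 \<le> card \<K> + card W" using oddK by linarith
  have K: "\<Union>\<K> = verts G - (W \<union> U)" "{} \<notin> \<K>" "disjoint \<K>"
    and inK: "\<And>e. e \<in> ?E \<Longrightarrow> e \<subseteq> verts G - (W \<union> U) \<Longrightarrow> \<exists>K\<in>\<K>. e \<subseteq> K"
    using sep eqS by (auto simp: separation_def inside_def)
  \<comment> \<open>Every edge outside \<open>W \<union> U\<close> lies in a single class, so an
    edge that leaves a class has its other end in \<open>W \<union> U\<close>.\<close>
  have end_S: "\<exists>k w. e = {k, w} \<and> k \<in> K \<and> w \<in> W \<union> U" if "K \<in> \<K>" "e \<in> boundary ?E K" for K e
  proof -
    have e: "e \<in> ?E" "e \<inter> K \<noteq> {}" "\<not> e \<subseteq> K" using that by (auto simp: boundary_def)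
    obtain k where k: "k \<in> e" "k \<in> K" using e by blast
    then obtain w where w: "e = {k, w}" using card2[OF e(1)]
      by (metis card_2_iff doubleton_eq_iff insertE singletonD)
    have "w \<notin> K" using w e k by auto
    have "w \<in> W \<union> U"
    proof (rule ccontr)
      assume "w \<notin> W \<union> U"
      then have "e \<subseteq> verts G - (W \<union> U)" using w card2[OF e(1)] k K(1) that(1) by auto
      then obtain K' where "K' \<in> \<K>" "e \<subseteq> K'" using inK e by blast
      then have "K' = K" using K(3) that(1) k unfolding disjoint_def by blast
      then show False using \<open>e \<subseteq> K'\<close> e by simp
    qed
    then show ?thesis using w k by blast
  qed
  \<comment> \<open>The boundaries are pairwise disjoint, because such an edge has only one end
    outside \<open>W \<union> U\<close>.\<close>
  have "(\<Sum>K\<in>\<K>. card (boundary ?E K)) = card (\<Union>K\<in>\<K>. boundary ?E K)"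
  proof (rule card_UN_disjoint[symmetric, OF fin\<K>])
    show "\<forall>K\<in>\<K>. finite (boundary ?E K)" using finE by (auto simp: boundary_def)
    show "\<forall>K\<in>\<K>. \<forall>L\<in>\<K>. K \<noteq> L \<longrightarrow> boundary ?E K \<inter> boundary ?E L = {}"
    proof (intro ballI impI, rule ccontr)
      fix K1 L1 assume KL: "K1 \<in> \<K>" "L1 \<in> \<K>" "K1 \<noteq> L1" "boundary ?E K1 \<inter> boundary ?E L1 \<noteq> {}"
      then obtain e where e: "e \<in> boundary ?E K1" "e \<in> boundary ?E L1" by blast
      obtain k w where kw: "e = {k, w}" "k \<in> K1" "w \<in> W \<union> U" using end_S KL e by blast
      obtain l w' where lw: "e = {l, w'}" "l \<in> L1" "w' \<in> W \<union> U" using end_S KL e by blast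
      have "k \<notin> W \<union> U" "l \<notin> W \<union> U" using K(1) KL kw lw by auto
      then have "k = l" using kw lw by (metis doubleton_eq_iff)
      then show False using K(3) KL kw lw unfolding disjoint_def by blast
    qed
  qed
  also have "\<dots> \<le> card (boundary ?E (W \<union> U))"
  proof (rule card_mono)
    show "finite (boundary ?E (W \<union> U))" using finE by (simp add: boundary_def)
    show "(\<Union>K\<in>\<K>. boundary ?E K) \<subseteq> boundary ?E (W \<union> U)"
    proof
      fix e assume "e \<in> (\<Union>K\<in>\<K>. boundary ?E K)"
      then obtain K1 where K1: "K1 \<in> \<K>" "e \<in> boundary ?E K1" by blast
      then obtain k w where kw: "e = {k, w}" "k \<in> K1" "w \<in> W \<union> U" using end_S by blast
      then have "k \<notin> W \<union> U" using K(1) K1 by auto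
      then show "e \<in> boundary ?E (W \<union> U)" using K1 kw by (auto simp: boundary_def)
    qed
  qed
  finally have 2: "(\<Sum>K\<in>\<K>. card (boundary ?E K)) \<le> card (boundary ?E (W \<union> U))" .
  have 3: "3 \<le> card (boundary ?E K1)" if "K1 \<in> \<K>" for K1
  proof (rule boundary_ge_3[OF cub con])
    show "K1 \<subseteq> verts G" "K1 \<noteq> {}" "K1 \<noteq> verts G" using that K W by auto
  qed
  have "W \<union> U \<subseteq> verts G" using W U by blast
  then show ?thesis using 1 2 3 sep[unfolded eqS] by blast
qed

lemma inside_doubleton:
  assumes "simple_graph G" "{a, b} \<in> edges G" "S \<subseteq> verts G" "{a, b} \<subseteq> S"
  shows "1 \<le> card (inside (edges G) S)"
proof -
  have "{{a, b}} \<subseteq> inside (edges G) S" using assms by (simp add: inside_def)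
  then have "card {{a, b}} \<le> card (inside (edges G) S)"
    using simple_graph_finite_edges[OF assms(1)] by (intro card_mono) (auto simp: inside_def)
  then show ?thesis by simp
qed

text \<open>A case of Schoenberger's theorem. A Tutte set \<open>S\<close> would have at least
  \<open>card S\<close> classes and hence at least \<open>3 * card S\<close> boundary edges, but the
  edge \<open>ab\<close> inside \<open>S\<close> uses up two of the \<open>3 * card S\<close>
  incidences.\<close>

lemma perfect_matching_through_edge:
  assumes cub: "cubic G" and con: "cyclically_edge_connected 4 G" and ab: "{a, b} \<in> edges G"
  shows "\<exists>M. M \<subseteq> inside (edges G) (verts G - {a, b}) \<and> matching M \<and> \<Union>M = verts G - {a, b}"
proof (rule ccontr)
  assume none: "\<not> ?thesis"
  have G: "simple_graph G" using cub by (simp add: regular_def)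
  have W: "{a, b} \<subseteq> verts G" "{a, b} \<noteq> {}" "card {a, b} = 2" "even (card {a, b})"
    using G ab by (auto simp: simple_graph_def)
  obtain S \<K> where S: "{a, b} \<subseteq> S" "S \<subseteq> verts G" "card S + 2 \<le> card \<K> + card {a, b}"
      "(\<Sum>K\<in>\<K>. card (boundary (edges G) K)) \<le> card (boundary (edges G) S)"
      and 3: "\<And>K. K \<in> \<K> \<Longrightarrow> 3 \<le> card (boundary (edges G) K)"
    using tutte_cubic[OF cub con W(1,2,4) none] by blast
  have "card \<K> * 3 \<le> (\<Sum>K\<in>\<K>. card (boundary (edges G) K))"
    using sum_bounded_below[of \<K> "3::nat" "\<lambda>K. card (boundary (edges G) K)"] 3 by simp
  moreover have "3 * card S = 2 * card (inside (edges G) S) + card (boundary (edges G) S)"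
    by (rule handshake_regular[OF cub S(2)])
  ultimately show False using S W inside_doubleton[OF G ab S(2,1)] by linarith
qed

text \<open>Together \<open>M\<close> and \<open>X\<close> are a perfect matching, which takes one
  of the three edges at each vertex. The split at \<open>W\<close> leaves room for prescribed edges
  in \<open>X\<close>.\<close>

lemma complement_two_factor:
  assumes cub: "cubic G" and M: "M \<subseteq> inside (edges G) (verts G - W)" "matching M" "\<Union>M = verts G - W"
    and X: "X \<subseteq> inside (edges G) W" "matching X" "\<Union>X = W" and W: "W \<subseteq> verts G"
  shows "two_factor (verts G, edges G - (M \<union> X)) G"
proof -
  have G: "simple_graph G" using cub by (simp add: regular_def)
  have fin: "finite (edges G)" using simple_graph_finite_edges[OF G] .
  have sub: "M \<union> X \<subseteq> edges G" using M X by (auto simp: inside_def)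
  have mat: "matching (M \<union> X)"
  proof -
    have "e \<inter> e' = {}" if "e \<in> M" "e' \<in> X" for e e'
      using that M(1) X(1) by (auto simp: inside_def)
    then show ?thesis using M(2) X(2) unfolding matching_def by (metis Int_commute Un_iff)
  qed
  have "card (incident (edges G - (M \<union> X)) v) = 2" if "v \<in> verts G" for v
  proof -
    have "v \<in> \<Union>(M \<union> X)" using that M X by auto
    then obtain e where e: "e \<in> M \<union> X" "v \<in> e" by blast
    then have "incident (M \<union> X) v = {e}"
      using mat unfolding incident_def matching_def by blast
    then have "incident (edges G - (M \<union> X)) v = incident (edges G) v - {e}" "e \<in> incident (edges G) v"
      using sub e unfolding incident_def by blast+
    moreover have "card (incident (edges G) v) = 3"
      using cub that by (simp add: regular_def degree_incident)
    ultimately show ?thesis by simp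
  qed
  then show ?thesis
    using G by (auto simp: two_factor_def regular_def degree_incident simple_graph_def)
qed

text \<open>Every edge of the circuit joins \<open>A\<close> to its complement. Counting them from
  either side, two per vertex, gives equally many vertices on both sides.\<close>

lemma bipartite_circuit_even:
  assumes reg: "regular 2 F" and K: "circuit (verts F) (edges F) K"
    and bip: "\<And>e. e \<in> edges F \<Longrightarrow> e \<inter> A \<noteq> {} \<and> \<not> e \<subseteq> A"
  shows "even (card K)"
proof -
  have sub: "K \<subseteq> verts F" "closed_in (edges F) K" using K by (auto simp: circuit_def)
  have fin: "finite K" using reg sub finite_subset by (auto simp: regular_def simple_graph_def)
  have e: "e \<inter> A \<noteq> {}" "\<not> e \<subseteq> A" if "e \<in> edges F" for e using bip that by auto
  have ins: "inside (edges F) (K \<inter> A) = {}" "inside (edges F) (K - A) = {}"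
    using e by (fastforce simp: inside_def)+
  have bd: "boundary (edges F) (K \<inter> A) = inside (edges F) K" "boundary (edges F) (K - A) = inside (edges F) K"
    using e sub(2) unfolding boundary_def inside_def closed_in_def by blast+
  have "2 * card (K \<inter> A) = 2 * card (K - A)"
    using handshake_regular[OF reg le_infI1[OF sub(1)], of A]
      handshake_regular[OF reg subset_trans[OF Diff_subset sub(1)], of A] ins bd
    by simp
  moreover have "card K = card (K \<inter> A) + card (K - A)"
    using fin by (metis card_Int_Diff)
  ultimately show ?thesis by simp
qed

text \<open>
  In a perfect matching through \<open>ab\<close> and \<open>cd\<close> the edge \<open>ac\<close> is not used, so its complement
  contradicts (i). By Tutte's theorem and edge counting, the absence of such a matching forces the
  graph to be bipartite up to the edges \<open>ab\<close>, \<open>ac\<close>, \<open>cd\<close>. Then the complement of a perfect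
  matching through \<open>ab\<close>, which contains \<open>cd\<close> by (i) and is odd by (ii), is bipartite.
\<close>

lemma gadget_pair_not_adjacent:
  assumes gp: "gadget_pair G {a, b} {c, d}"
  shows "{a, c} \<notin> edges G"
proof
  assume ac: "{a, c} \<in> edges G"
  let ?E = "edges G"
  have sn: "snark G" and ab: "{a, b} \<in> ?E" and cd: "{c, d} \<in> ?E" and dis: "{a, b} \<inter> {c, d} = {}"
    using gp by (simp_all add: gadget_pair_def)
  have "\<not> (\<exists>F. two_factor F G \<and> {a, b} \<notin> edges F \<and> {c, d} \<notin> edges F)"
    using gp unfolding gadget_pair_def by (elim conjE)
  then have i: "{a, b} \<in> edges F \<or> {c, d} \<in> edges F" if "two_factor F G" for F
    using that by blast
  have "\<forall>F. two_factor F G \<and> ({a, b} \<in> edges F) \<noteq> ({c, d} \<in> edges F) \<longrightarrow> odd_cycles F"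
    using gp unfolding gadget_pair_def by (elim conjE)
  then have ii: "odd_cycles F" if "two_factor F G" "{a, b} \<notin> edges F" "{c, d} \<in> edges F" for F
    using that by blast
  have cub: "cubic G" and con: "cyclically_edge_connected 4 G" using sn by (auto simp: snark_def)
  have G: "simple_graph G" and fin: "finite (verts G)" using cub by (auto simp: regular_def simple_graph_def)
  have finE: "finite ?E" using simple_graph_finite_edges[OF G] .
  have card2: "card e = 2" "e \<subseteq> verts G" if "e \<in> ?E" for e using G that by (auto simp: simple_graph_def)
  have neq: "a \<noteq> b" "c \<noteq> d" "a \<noteq> c" "a \<noteq> d" "b \<noteq> c" "b \<noteq> d"
    using card2[OF ab] card2[OF cd] dis by auto
  let ?W = "{a, b, c, d}"
  have W: "?W \<subseteq> verts G" "?W \<noteq> {}" "card ?W = 4" using card2[OF ab] card2[OF cd] neq by auto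
  have none: "\<not> (\<exists>M. M \<subseteq> inside ?E (verts G - ?W) \<and> matching M \<and> \<Union>M = verts G - ?W)"
  proof
    assume "\<exists>M. M \<subseteq> inside ?E (verts G - ?W) \<and> matching M \<and> \<Union>M = verts G - ?W"
    then obtain M where M: "M \<subseteq> inside ?E (verts G - ?W)" "matching M" "\<Union>M = verts G - ?W" by blast
    have "two_factor (verts G, ?E - (M \<union> {{a, b}, {c, d}})) G"
      by (rule complement_two_factor[OF cub M _ _ _ W(1)])
        (use ab cd neq in \<open>auto simp: inside_def matching_def\<close>)
    then show False using i by fastforce
  qed
  have "even (card ?W)" using W(3) by simp
  then obtain S \<K> where S: "?W \<subseteq> S" "S \<subseteq> verts G" and sep: "separation ?E (verts G - S) \<K>"
      and cardS: "card S + 2 \<le> card \<K> + card ?W"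
      and sum: "(\<Sum>K\<in>\<K>. card (boundary ?E K)) \<le> card (boundary ?E S)"
      and 3: "\<And>K. K \<in> \<K> \<Longrightarrow> 3 \<le> card (boundary ?E K)"
    using tutte_cubic[OF cub con W(1,2) _ none] by blast
  have finK: "finite \<K>" using sep fin by (auto simp: separation_def intro: finite_UnionD)
  have finI: "finite (inside ?E S)" using finE by (simp add: inside_def)
  have three: "{{a, b}, {a, c}, {c, d}} \<subseteq> inside ?E S" using S ab ac cd by (auto simp: inside_def)
  have three_card: "card {{a, b}, {a, c}, {c, d}} = 3" using neq by (simp add: doubleton_eq_iff)
  \<comment> \<open>With three edges inside \<open>S\<close>, \<open>3 * card \<K>\<close> is at
    most \<open>3 * card S - 6\<close>, while \<open>card S\<close> is at most
    \<open>card \<K> + 2\<close>. So all these inequalities are equalities.\<close>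
  have "3 \<le> card (inside ?E S)" using card_mono[OF finI three] three_card by simp
  moreover have "card \<K> * 3 \<le> (\<Sum>K\<in>\<K>. card (boundary ?E K))"
    using sum_bounded_below[of \<K> "3::nat" "\<lambda>K. card (boundary ?E K)"] 3 by simp
  moreover have "3 * card S = 2 * card (inside ?E S) + card (boundary ?E S)"
    by (rule handshake_regular[OF cub S(2)])
  ultimately have "card (inside ?E S) = 3" and eq: "(\<Sum>K\<in>\<K>. card (boundary ?E K)) = card \<K> * 3"
    using cardS W(3) sum by linarith+
  then have inS: "inside ?E S = {{a, b}, {a, c}, {c, d}}"
    using card_subset_eq[OF finI three] three_card by simp
  \<comment> \<open>Equality leaves exactly three boundary edges to each class. Its complement
    contains the four ends, so by cyclic connectivity the class is a single vertex.\<close>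
  have single: "card K = 1" if K: "K \<in> \<K>" for K
  proof -
    have sub: "K \<subseteq> verts G - S" "K \<noteq> {}" using K sep by (auto simp: separation_def)
    have "card (boundary ?E K) = 3"
    proof (rule ccontr)
      assume "card (boundary ?E K) \<noteq> 3"
      then have "(\<Sum>K\<in>\<K>. 3) < (\<Sum>K\<in>\<K>. card (boundary ?E K))"
        using finK K 3 by (intro sum_strict_mono_ex1) (auto intro!: bexI[of _ K] simp: order_less_le)
      then show False using eq by simp
    qed
    moreover have "card ?W \<le> card (verts G - K)" using S sub fin by (intro card_mono) auto
    ultimately have "\<not> 2 \<le> card K"
      using cyclically_4_edge_connected_boundary[OF cub con, of K] sub W(3) by auto
    moreover have "finite K" using sub fin finite_subset by blast
    then have "card K \<noteq> 0" using sub by simp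
    ultimately show ?thesis by linarith
  qed
  obtain M where M: "M \<subseteq> inside ?E (verts G - {a, b})" "matching M" "\<Union>M = verts G - {a, b}"
    using perfect_matching_through_edge[OF cub con ab] by blast
  define F where "F = (verts G, ?E - (M \<union> {{a, b}}))"
  have F: "two_factor F G" unfolding F_def
    by (rule complement_two_factor[OF cub M])
      (use ab card2[OF ab] in \<open>auto simp: inside_def matching_def\<close>)
  have abF: "{a, b} \<notin> edges F" by (simp add: F_def)
  then have cdF: "{c, d} \<in> edges F" using i[OF F] by simp
  have odd: "odd_cycles F" using ii[OF F abF cdF] .
  \<comment> \<open>\<open>M\<close> avoids \<open>a\<close>, so \<open>ac\<close> stays in the
    2-factor and, with \<open>cd\<close>, fills the degree of \<open>c\<close>.\<close>
  have acF: "{a, c} \<in> edges F" using M ac neq by (auto simp: F_def inside_def doubleton_eq_iff)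
  have reg: "regular 2 F" and vF: "verts F = verts G" and EF: "edges F \<subseteq> ?E"
    using F by (auto simp: two_factor_def)
  have "c \<in> verts F" using W vF by simp
  then have "card (incident (edges F) c) = 2" using reg by (simp add: regular_def degree_incident)
  moreover have "{{a, c}, {c, d}} \<subseteq> incident (edges F) c" using acF cdF by (auto simp: incident_def)
  moreover have "card {{a, c}, {c, d}} = 2" using neq by (simp add: doubleton_eq_iff)
  ultimately have incc: "incident (edges F) c = {{a, c}, {c, d}}"
    by (metis card.infinite card_subset_eq zero_neq_numeral)
  \<comment> \<open>The two sides are \<open>S\<close> without \<open>c\<close>, and the singleton
    classes together with \<open>c\<close>. Inside \<open>S\<close> only \<open>ac\<close> and
    \<open>cd\<close> remain, and moving \<open>c\<close> across makes both of them cross without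
    spoiling another edge.\<close>
  have bip: "e \<inter> (S - {c}) \<noteq> {} \<and> \<not> e \<subseteq> S - {c}" if e: "e \<in> edges F" for e
  proof -
    have eE: "e \<in> ?E" using e EF by blast
    have "\<not> e \<subseteq> verts G - S"
    proof
      assume "e \<subseteq> verts G - S"
      then obtain K where "K \<in> \<K>" "e \<subseteq> K" using sep eE by (auto simp: separation_def inside_def)
      then have "card e \<le> 1" using single[of K] card_mono[of K e] by (metis card.infinite zero_neq_one)
      then show False using card2[OF eE] by simp
    qed
    then have meets: "e \<inter> S \<noteq> {}" using card2[OF eE] by blast
    show ?thesis
    proof (cases "e \<subseteq> S")
      case True
      then have "e \<in> inside ?E S" using eE by (simp add: inside_def)
      then have "e = {a, c} \<or> e = {c, d}" unfolding inS using e abF by blast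
      then show ?thesis using S neq by auto
    next
      case False
      have "c \<notin> e"
      proof
        assume "c \<in> e"
        then have "e \<in> incident (edges F) c" using e by (simp add: incident_def)
        then have "e \<subseteq> S" unfolding incc using S by auto
        then show False using False by simp
      qed
      then show ?thesis using meets False by blast
    qed
  qed
  have "closed_in (edges F) (verts F)" using EF card2(2) unfolding vF closed_in_def by blast
  then obtain K where K: "circuit (verts F) (edges F) K"
    using ex_circuit[of "verts F" c] fin vF \<open>c \<in> verts F\<close> by auto
  have "even (card K)" by (rule bipartite_circuit_even[OF reg K bip])
  then show False using odd odd_cycles_circuit[OF reg] K by blast
qed

lemma cross_edges_commute: "cross_edges g f = cross_edges f g"
  by (auto simp: cross_edges_def insert_commute)

lemma gadget_pair_commute:
  assumes "gadget_pair R f g" shows "gadget_pair R g f"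
proof -
  have "snark R" "f \<in> edges R" "g \<in> edges R" "f \<inter> g = {}"
    using assms by (simp_all add: gadget_pair_def)
  moreover have "\<not> (\<exists>F. two_factor F R \<and> f \<notin> edges F \<and> g \<notin> edges F)"
    using assms unfolding gadget_pair_def by (elim conjE)
  then have "\<not> (\<exists>F. two_factor F R \<and> g \<notin> edges F \<and> f \<notin> edges F)" by blast
  moreover have "\<forall>F. two_factor F R \<and> (f \<in> edges F) \<noteq> (g \<in> edges F) \<longrightarrow> odd_cycles F"
    using assms unfolding gadget_pair_def by (elim conjE)
  then have "\<forall>F. two_factor F R \<and> (g \<in> edges F) \<noteq> (f \<in> edges F) \<longrightarrow> odd_cycles F" by blast
  moreover have "\<forall>F. two_factor F R \<and> f \<in> edges F \<and> g \<in> edges F \<longrightarrow>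
      odd_cycles F \<and> \<not> (\<exists>p. cycle F p \<and> f \<in> cycle_edges p \<and> g \<in> cycle_edges p)"
    using assms unfolding gadget_pair_def by (elim conjE)
  then have "\<forall>F. two_factor F R \<and> g \<in> edges F \<and> f \<in> edges F \<longrightarrow>
      odd_cycles F \<and> \<not> (\<exists>p. cycle F p \<and> g \<in> cycle_edges p \<and> f \<in> cycle_edges p)" by blast
  moreover have "\<forall>F e. two_factor F (add_edges (delete_edges R {f, g}) (cross_edges f g)) \<and>
      edges F \<inter> cross_edges f g = {e} \<longrightarrow>
      (\<forall>p. cycle F p \<longrightarrow> (if e \<in> cycle_edges p then even (length p) else odd (length p)))"
    using assms unfolding gadget_pair_def by (elim conjE)
  ultimately show ?thesis
    unfolding gadget_pair_def cross_edges_commute[of g f] insert_commute[of g f "{}"] Int_commute[of g f]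
    by (intro conjI)
qed

text \<open>Condition (iv) speaks of 2-factors with exactly one cross edge; this prevents edges
  inherited from \<open>R\<close> from being cross edges.\<close>

lemma gadget_pair_no_cross_edge:
  assumes "gadget_pair G {a, b} {c, d}" shows "edges G \<inter> cross_edges {a, b} {c, d} = {}"
proof -
  have "{a, c} \<notin> edges G" "{b, c} \<notin> edges G" "{a, d} \<notin> edges G" "{b, d} \<notin> edges G"
    using gadget_pair_not_adjacent[of G a b c d] gadget_pair_not_adjacent[of G b a c d]
      gadget_pair_not_adjacent[of G a b d c] gadget_pair_not_adjacent[of G b a d c] assms
    by (simp_all add: insert_commute)
  then show ?thesis unfolding cross_edges_def by blast
qed

section \<open>Girth\<close>

lemma girth_le: "cycle G p \<Longrightarrow> girth G \<le> enat (length p)"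
  unfolding girth_def by (rule INF_lower) simp

lemma cycle_edges_3: "cycle_edges [u, v, w] = {{u, v}, {v, w}, {w, u}}"
proof -
  have "cycle_edges [u, v, w] = (\<lambda>i. {[u, v, w] ! i, [u, v, w] ! (Suc i mod 3)}) ` {..<3}"
    by (auto simp: cycle_edges_def)
  also have "{..<3::nat} = {0, 1, 2}" by auto
  finally show ?thesis by (simp add: insert_commute)
qed

lemma cycle_edges_4: "cycle_edges [u, v, w, z] = {{u, v}, {v, w}, {w, z}, {z, u}}"
proof -
  have "cycle_edges [u, v, w, z] = (\<lambda>i. {[u, v, w, z] ! i, [u, v, w, z] ! (Suc i mod 4)}) ` {..<4}"
    by (auto simp: cycle_edges_def)
  also have "{..<4::nat} = {0, 1, 2, 3}" by auto
  finally show ?thesis by simp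
qed

lemma girth_5_no_triangle:
  assumes G: "simple_graph G" "5 \<le> girth G"
  shows "\<not> ({u, v} \<in> edges G \<and> {v, w} \<in> edges G \<and> {w, u} \<in> edges G)"
proof
  assume e: "{u, v} \<in> edges G \<and> {v, w} \<in> edges G \<and> {w, u} \<in> edges G"
  then have "u \<noteq> v" "v \<noteq> w" "w \<noteq> u" "{u, v, w} \<subseteq> verts G"
    using G(1) by (auto simp: simple_graph_def)
  then have "cycle G [u, v, w]" using e by (simp add: cycle_def cycle_edges_3)
  then have "5 \<le> enat (length [u, v, w])" using girth_le G(2) order_trans by blast
  then show False by (simp add: numeral_eq_enat)
qed

lemma girth_5_no_quadrangle:
  assumes G: "simple_graph G" "5 \<le> girth G" and neq: "u \<noteq> w" "v \<noteq> z"
  shows "\<not> ({u, v} \<in> edges G \<and> {v, w} \<in> edges G \<and> {w, z} \<in> edges G \<and> {z, u} \<in> edges G)"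
proof
  assume e: "{u, v} \<in> edges G \<and> {v, w} \<in> edges G \<and> {w, z} \<in> edges G \<and> {z, u} \<in> edges G"
  then have "u \<noteq> v" "v \<noteq> w" "w \<noteq> z" "z \<noteq> u" "{u, v, w, z} \<subseteq> verts G"
    using G(1) by (auto simp: simple_graph_def)
  then have "cycle G [u, v, w, z]" using e neq by (auto simp: cycle_def cycle_edges_4)
  then have "5 \<le> enat (length [u, v, w, z])" using girth_le G(2) order_trans by blast
  then show False by (simp add: numeral_eq_enat)
qed

lemma girth_ge_5I:
  assumes "\<And>u v w. {u, v} \<in> edges G \<Longrightarrow> {v, w} \<in> edges G \<Longrightarrow> {w, u} \<in> edges G \<Longrightarrow> False"
    and "\<And>u v w z. {u, v} \<in> edges G \<Longrightarrow> {v, w} \<in> edges G \<Longrightarrow> {w, z} \<in> edges G \<Longrightarrow>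
      {z, u} \<in> edges G \<Longrightarrow> u \<noteq> w \<Longrightarrow> v \<noteq> z \<Longrightarrow> False"
  shows "5 \<le> girth G"
  unfolding girth_def
proof (rule INF_greatest)
  fix p assume "p \<in> {p. cycle G p}"
  then have p: "3 \<le> length p" "distinct p" "cycle_edges p \<subseteq> edges G" by (auto simp: cycle_def)
  have "length p \<noteq> 3"
  proof
    assume "length p = 3"
    then obtain u v w where "p = [u, v, w]" by (auto simp: numeral_eq_Suc length_Suc_conv)
    then show False using p assms(1)[of u v w] by (simp add: cycle_edges_3)
  qed
  moreover have "length p \<noteq> 4"
  proof
    assume "length p = 4"
    then obtain u v w z where "p = [u, v, w, z]" by (auto simp: numeral_eq_Suc length_Suc_conv)
    then show False using p assms(2)[of u v w z] by (simp add: cycle_edges_4)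
  qed
  ultimately show "5 \<le> enat (length p)" using p(1) by (simp add: numeral_eq_enat)
qed

section \<open>Graphs glued along a set of connecting edges\<close>

definition link :: "'a \<times> 'b \<Rightarrow> ('a + 'b) set" where
  "link z = {Inl (fst z), Inr (snd z)}"

text \<open>Two edge sets on the summands of a disjoint union, joined along \<open>P\<close>. The
  dot product has this shape, and so does every subset of its edges, so the same counting rules
  serve \<open>H\<close> and its 2-factors.\<close>

definition glue :: "'a set set \<Rightarrow> 'b set set \<Rightarrow> ('a \<times> 'b) set \<Rightarrow> ('a + 'b) set set" where
  "glue A B P = image Inl ` A \<union> image Inr ` B \<union> link ` P"

lemma link_eq_iff [simp]: "link z = link w \<longleftrightarrow> z = w"
  by (auto simp: link_def doubleton_eq_iff prod_eq_iff)

lemma inj_link: "inj_on link P"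
  by (simp add: inj_on_def)

lemma inj_image_Inl: "inj_on (image Inl) A" and inj_image_Inr: "inj_on (image Inr) B"
  by (auto simp: inj_on_def inj_image_eq_iff)

lemma link_neq_image [simp]:
  "link z \<noteq> Inl ` e" "link z \<noteq> Inr ` e'" "Inl ` e \<noteq> link z" "Inr ` e' \<noteq> link z"
proof -
  have "Inl (fst z) \<in> link z" "Inr (snd z) \<in> link z" by (simp_all add: link_def)
  then show "link z \<noteq> Inl ` e" "link z \<noteq> Inr ` e'" "Inl ` e \<noteq> link z" "Inr ` e' \<noteq> link z"
    by (metis Inl_Inr_False imageE Inr_not_Inl)+
qed

lemma Inl_image_neq_Inr_image: "e \<noteq> {} \<Longrightarrow> Inl ` e \<noteq> Inr ` e'"
  by (metis Inl_Inr_False all_not_in_conv imageE imageI)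

text \<open>The empty set has the same image under both injections; excluding it makes the two kinds
  of image disjoint.\<close>

lemma Inl_image_in_glue:
  assumes "{} \<notin> B" shows "Inl ` e \<in> glue A B P \<longleftrightarrow> e \<in> A"
proof -
  have "Inl ` e \<noteq> Inr ` e'" if "e' \<in> B" for e'
    using that assms Inl_image_neq_Inr_image[of e e'] by (cases "e = {}") auto
  then show ?thesis unfolding glue_def Un_iff image_iff by (simp add: inj_image_eq_iff)
qed

lemma Inr_image_in_glue:
  assumes "{} \<notin> A" shows "Inr ` e \<in> glue A B P \<longleftrightarrow> e \<in> B"
proof -
  have "Inr ` e \<noteq> Inl ` e'" if "e' \<in> A" for e'
    using that assms Inl_image_neq_Inr_image[of e' e] by metis
  then show ?thesis unfolding glue_def Un_iff image_iff by (simp add: inj_image_eq_iff)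
qed

lemma link_in_glue: "link z \<in> glue A B P \<longleftrightarrow> z \<in> P"
  unfolding glue_def Un_iff image_iff by simp

lemma doubleton_in_glue:
  assumes "{} \<notin> A" "{} \<notin> B"
  shows "{Inl v, Inl v'} \<in> glue A B P \<longleftrightarrow> {v, v'} \<in> A"
    and "{Inr w, Inr w'} \<in> glue A B P \<longleftrightarrow> {w, w'} \<in> B"
    and "{Inl v, Inr w} \<in> glue A B P \<longleftrightarrow> (v, w) \<in> P"
    and "{Inr w, Inl v} \<in> glue A B P \<longleftrightarrow> (v, w) \<in> P"
  using Inl_image_in_glue[OF assms(2), of "{v, v'}" A P] Inr_image_in_glue[OF assms(1), of "{w, w'}" B P]
    link_in_glue[of "(v, w)" A B P]
  by (simp_all add: link_def insert_commute)

text \<open>The three kinds of edges are disjoint. Degrees and boundaries are both instances, for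
  different \<open>Q\<close>.\<close>

lemma card_filter_glue:
  fixes A :: "'a set set" and B :: "'b set set"
  assumes fin: "finite A" "finite B" "finite P" and ne: "{} \<notin> A" "{} \<notin> B"
  shows "card {e \<in> glue A B P. Q e} =
    card {e \<in> A. Q (Inl ` e)} + card {e \<in> B. Q (Inr ` e)} + card {z \<in> P. Q (link z)}"
proof -
  let ?A = "(image Inl :: _ \<Rightarrow> ('a + 'b) set) ` {e \<in> A. Q (Inl ` e)}"
    and ?B = "(image Inr :: _ \<Rightarrow> ('a + 'b) set) ` {e \<in> B. Q (Inr ` e)}"
    and ?P = "link ` {z \<in> P. Q (link z)}"
  have "{e \<in> glue A B P. Q e} = ?A \<union> ?B \<union> ?P" by (auto simp: glue_def)
  moreover have "Inl ` e \<noteq> Inr ` e'" if "e \<in> A" for e and e' :: "'b set"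
    using that ne(1) by (intro Inl_image_neq_Inr_image) auto
  then have "?A \<inter> ?B = {}" by auto
  moreover have "(?A \<union> ?B) \<inter> ?P = {}" by auto
  ultimately have "card {e \<in> glue A B P. Q e} = card ?A + card ?B + card ?P"
    using fin by (simp add: card_Un_disjoint)
  then show ?thesis by (simp add: card_image inj_image_Inl inj_image_Inr inj_link)
qed

lemma incident_glue:
  fixes A :: "'a set set" and B :: "'b set set"
  assumes "finite A" "finite B" "finite P" "{} \<notin> A" "{} \<notin> B"
  shows "card (incident (glue A B P) (Inl v)) = card (incident A v) + card {z \<in> P. v = fst z}"
    and "card (incident (glue A B P) (Inr w)) = card (incident B w) + card {z \<in> P. w = snd z}"
  unfolding incident_def card_filter_glue[OF assms] by (simp_all add: link_def image_iff)

lemma boundary_glue: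
  assumes "finite A" "finite B" "finite P" "{} \<notin> A" "{} \<notin> B"
  shows "card (boundary (glue A B P) S) = card (boundary A (Inl -` S)) + card (boundary B (Inr -` S)) +
    card {z \<in> P. (Inl (fst z) \<in> S) \<noteq> (Inr (snd z) \<in> S)}"
proof -
  have "{e \<in> A. Inl ` e \<inter> S \<noteq> {} \<and> \<not> Inl ` e \<subseteq> S} = boundary A (Inl -` S)"
    "{e \<in> B. Inr ` e \<inter> S \<noteq> {} \<and> \<not> Inr ` e \<subseteq> S} = boundary B (Inr -` S)"
    "{z \<in> P. link z \<inter> S \<noteq> {} \<and> \<not> link z \<subseteq> S} = {z \<in> P. (Inl (fst z) \<in> S) \<noteq> (Inr (snd z) \<in> S)}"
    by (auto simp: boundary_def link_def)
  then show ?thesis using card_filter_glue[OF assms, of "\<lambda>e. e \<inter> S \<noteq> {} \<and> \<not> e \<subseteq> S"]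
    by (simp add: boundary_def)
qed

lemma closed_in_glue:
  "closed_in (glue A B P) S \<longleftrightarrow> closed_in A (Inl -` S) \<and> closed_in B (Inr -` S) \<and>
    (\<forall>z\<in>P. Inl (fst z) \<in> S \<longleftrightarrow> Inr (snd z) \<in> S)"
proof -
  have "(Inl ` e \<inter> S \<noteq> {} \<longrightarrow> Inl ` e \<subseteq> S) = (e \<inter> Inl -` S \<noteq> {} \<longrightarrow> e \<subseteq> Inl -` S)" for e
    by auto
  moreover have "(Inr ` e \<inter> S \<noteq> {} \<longrightarrow> Inr ` e \<subseteq> S) = (e \<inter> Inr -` S \<noteq> {} \<longrightarrow> e \<subseteq> Inr -` S)" for e
    by auto
  moreover have "(link z \<inter> S \<noteq> {} \<longrightarrow> link z \<subseteq> S) = (Inl (fst z) \<in> S \<longleftrightarrow> Inr (snd z) \<in> S)" for z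
    by (auto simp: link_def)
  ultimately show ?thesis
    unfolding closed_in_def glue_def ball_Un ball_simps by (simp only: conj_assoc)
qed

lemma subset_glue:
  assumes "F \<subseteq> glue A B P"
  shows "F = glue {e \<in> A. Inl ` e \<in> F} {e \<in> B. Inr ` e \<in> F} {z \<in> P. link z \<in> F}"
proof (intro set_eqI iffI)
  fix e assume e: "e \<in> F"
  then have "e \<in> glue A B P" using assms by blast
  then consider e' where "e' \<in> A" "e = Inl ` e'" | e' where "e' \<in> B" "e = Inr ` e'"
    | z where "z \<in> P" "e = link z"
    unfolding glue_def by blast
  then show "e \<in> glue {e \<in> A. Inl ` e \<in> F} {e \<in> B. Inr ` e \<in> F} {z \<in> P. link z \<in> F}"
    unfolding glue_def using e by cases simp_all
next
  fix e assume "e \<in> glue {e \<in> A. Inl ` e \<in> F} {e \<in> B. Inr ` e \<in> F} {z \<in> P. link z \<in> F}"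
  then show "e \<in> F" unfolding glue_def by blast
qed

lemma card_sum_set:
  assumes "S \<subseteq> Inl ` V \<union> Inr ` W" "finite V" "finite W"
  shows "card S = card (Inl -` S) + card (Inr -` S)"
proof -
  have "Inl -` S \<subseteq> V" "Inr -` S \<subseteq> W" using assms(1) by auto
  then have fin: "finite (Inl -` S)" "finite (Inr -` S)" using assms(2,3) by (auto intro: finite_subset)
  have "S = Inl -` S <+> Inr -` S"
  proof (intro set_eqI)
    fix z show "z \<in> S \<longleftrightarrow> z \<in> Inl -` S <+> Inr -` S" by (cases z) auto
  qed
  then have "card S = card (Inl -` S <+> Inr -` S)" by (rule arg_cong)
  then show ?thesis using card_Plus[OF fin] by simp
qed

section \<open>Dot products\<close>

text \<open>The least number of colours is attained because some number suffices, namely one colour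
  per edge.\<close>

lemma snark_edge_colourable_4:
  assumes "snark G" shows "edge_colourable 4 G"
proof -
  have G: "simple_graph G" and chi: "edge_chromatic_number G = 4"
    using assms by (auto simp: snark_def regular_def)
  obtain f :: "'a set \<Rightarrow> nat" and n where "f ` edges G = {i. i < n}" "inj_on f (edges G)"
    using finite_imp_nat_seg_image_inj_on[OF simple_graph_finite_edges[OF G]]
      finite_imp_inj_to_nat_seg[OF simple_graph_finite_edges[OF G]] by metis
  then have "edge_colourable n G"
    unfolding edge_colourable_def by (intro exI[of _ f]) (auto dest: inj_onD)
  then have "edge_colourable (edge_chromatic_number G) G"
    unfolding edge_chromatic_number_def by (rule LeastI)
  then show ?thesis using chi by simp
qed

lemma edge_colourable_mono:
  assumes "edge_colourable k G" "k \<le> l" shows "edge_colourable l G"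
proof -
  obtain col :: "'a set \<Rightarrow> nat" where "\<forall>e\<in>edges G. col e < k"
    "\<forall>e\<in>edges G. \<forall>e'\<in>edges G. e \<noteq> e' \<longrightarrow> e \<inter> e' \<noteq> {} \<longrightarrow> col e \<noteq> col e'"
    using assms(1) unfolding edge_colourable_def by (elim exE conjE)
  moreover from this(1) have "\<forall>e\<in>edges G. col e < l" using assms(2) by (auto intro: less_le_trans)
  ultimately show ?thesis unfolding edge_colourable_def by (intro exI[of _ col] conjI)
qed

text \<open>
  A vertex of a cubic graph sees every colour of a 3-edge-colouring, so two of the colour classes
  form a 2-factor in which every circuit is perfectly matched by one class.
\<close>

lemma odd_two_factored_not_3_edge_colourable:
  assumes cub: "cubic G" and ne: "verts G \<noteq> {}" and odd: "odd_two_factored G"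
  shows "\<not> edge_colourable 3 G"
proof
  assume "edge_colourable 3 G"
  then obtain col :: "'a set \<Rightarrow> nat" where col: "\<forall>e\<in>edges G. col e < 3"
    and proper: "\<forall>e\<in>edges G. \<forall>e'\<in>edges G. e \<noteq> e' \<longrightarrow> e \<inter> e' \<noteq> {} \<longrightarrow> col e \<noteq> col e'"
    unfolding edge_colourable_def by (elim exE conjE)
  have G: "simple_graph G" using cub by (simp add: regular_def)
  have fin: "finite (verts G)" "finite (edges G)"
    using G simple_graph_finite_edges[OF G] by (simp_all add: simple_graph_def)
  have card2: "card e = 2" "e \<subseteq> verts G" if "e \<in> edges G" for e using G that by (auto simp: simple_graph_def)
  have inj: "inj_on col (incident (edges G) v)" for v
  proof (rule inj_onI)
    fix e e' assume e: "e \<in> incident (edges G) v" "e' \<in> incident (edges G) v" "col e = col e'"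
    then have "e \<in> edges G" "e' \<in> edges G" "v \<in> e \<inter> e'" by (auto simp: incident_def)
    then show "e = e'" using proper e(3) by blast
  qed
  have onto: "col ` incident (edges G) v = {..<3::nat}" if "v \<in> verts G" for v
  proof (rule card_subset_eq)
    show "col ` incident (edges G) v \<subseteq> {..<3::nat}" using col by (auto simp: incident_def)
    show "card (col ` incident (edges G) v) = card {..<3::nat}"
      using cub that card_image[OF inj, of v] by (simp add: regular_def degree_incident)
  qed simp
  have class1: "card {e \<in> incident (edges G) v. col e = i} = 1" if v: "v \<in> verts G" and i: "i < 3" for v i
  proof -
    have "i \<in> col ` incident (edges G) v" using onto[OF v] i by simp
    then obtain e where e: "e \<in> incident (edges G) v" "col e = i" by blast
    then have "{e \<in> incident (edges G) v. col e = i} = {e}"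
      using e by (auto dest: inj_onD[OF inj[of v]])
    then show ?thesis by simp
  qed
  define F where "F = (verts G, {e \<in> edges G. col e \<noteq> 2})"
  have "card (incident (edges F) v) = 2" if v: "v \<in> verts G" for v
  proof -
    have "incident (edges F) v = incident (edges G) v - {e \<in> incident (edges G) v. col e = 2}"
      by (auto simp: F_def incident_def)
    moreover have "card (incident (edges G) v) = 3" using cub v by (simp add: regular_def degree_incident)
    moreover have "card (incident (edges G) v - {e \<in> incident (edges G) v. col e = 2}) =
        card (incident (edges G) v) - card {e \<in> incident (edges G) v. col e = 2}"
      using fin(2) by (intro card_Diff_subset) (auto simp: incident_def)
    ultimately show ?thesis using class1[OF v, of 2] by simp
  qed
  then have F: "two_factor F G" and reg: "regular 2 F"
    using G by (auto simp: F_def two_factor_def regular_def degree_incident simple_graph_def)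
  obtain v where v: "v \<in> verts G" using ne by blast
  have "closed_in (edges F) (verts F)" using card2(2) by (auto simp: closed_in_def F_def)
  then obtain K where K: "circuit (verts F) (edges F) K"
    using ex_circuit[of "verts F" v] fin v by (auto simp: F_def)
  have "odd (card K)" using odd F K odd_cycles_circuit[OF reg] unfolding odd_two_factored_def by blast
  moreover have "even (card K)"
  proof -
    let ?C = "{e \<in> edges G. col e = 0}"
    have KV: "K \<subseteq> verts G" "closed_in (edges F) K" using K by (auto simp: circuit_def F_def)
    have "boundary ?C K = {}" using KV(2) by (auto simp: boundary_def closed_in_def F_def)
    moreover have "card (incident ?C w) = 1" if "w \<in> K" for w
      using class1[of w 0] that KV(1) by (auto simp: incident_def conj_ac)
    ultimately have "card K = 2 * card (inside ?C K)"
      using handshake[of ?C K] fin finite_subset[OF KV(1)] card2 by simp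
    then show ?thesis by simp
  qed
  ultimately show False by simp
qed

lemma card_filter_four:
  assumes "distinct [z1, z2, z3, z4]"
  shows "card {z \<in> {z1, z2, z3, z4}. Q z} =
    of_bool (Q z1) + of_bool (Q z2) + of_bool (Q z3) + of_bool (Q z4)"
proof -
  have "card {z \<in> {z1, z2, z3, z4}. Q z} = (\<Sum>z\<in>{z1, z2, z3, z4}. of_bool (Q z))"
    by (simp add: Int_def)
  then show ?thesis using assms by simp
qed

section \<open>Edge cuts of a dot product: the counting\<close>

text \<open>The case where all four parts are nonempty, by checking the positions of the eight
  terminals. The two conditional bounds belong to a half with two terminals on either side of the
  cut, where neither part is a single vertex and four replaces three.\<close>

lemma dot_boundary_arith_proper:
  fixes dl dr :: nat and r s t u a b c d :: bool
  assumes "3 \<le> dl + of_bool r + of_bool s + of_bool t + of_bool u"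
    and "3 \<le> dl + of_bool (\<not> r) + of_bool (\<not> s) + of_bool (\<not> t) + of_bool (\<not> u)"
    and "3 \<le> dl + of_bool (\<not> r) + of_bool (\<not> s) + of_bool t + of_bool u"
    and "3 \<le> dl + of_bool r + of_bool s + of_bool (\<not> t) + of_bool (\<not> u)"
    and "of_bool r + of_bool s + of_bool t + of_bool u = (2::nat) \<Longrightarrow> 2 \<le> dl"
    and "3 \<le> dr + of_bool (a \<noteq> b) + of_bool (c \<noteq> d)"
    and "of_bool a + of_bool b + of_bool c + of_bool d = (2::nat) \<Longrightarrow>
      4 \<le> dr + of_bool (a \<noteq> b) + of_bool (c \<noteq> d)"
  shows "4 \<le> dl + dr + (of_bool (r \<noteq> a) + of_bool (s \<noteq> b) + of_bool (t \<noteq> c) + of_bool (u \<noteq> d))"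
  using assms
  by (cases r; cases s; cases t; cases u; simp; cases a; cases b; cases c; cases d; simp)

text \<open>
  The arithmetic behind the edge connectivity of a dot product. A vertex set of the dot product
  splits into parts of sizes \<open>nl\<close>, \<open>nr\<close> with complements of sizes \<open>ml\<close>, \<open>mr\<close>; \<open>dl\<close>, \<open>dr\<close> count
  the boundary edges within the two parts. The hypotheses on \<open>dl\<close> come from adding none, both or
  one of the deleted vertices to the left part.
\<close>

lemma dot_boundary_arith:
  fixes dl dr nl ml nr mr :: nat and r s t u a b c d :: bool
  assumes size: "3 \<le> nl + nr" "3 \<le> ml + mr"
    and nl: "of_bool r + of_bool s + of_bool t + of_bool u \<le> nl"
    and ml: "of_bool (\<not> r) + of_bool (\<not> s) + of_bool (\<not> t) + of_bool (\<not> u) \<le> ml"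
    and nr: "of_bool a + of_bool b + of_bool c + of_bool d \<le> nr"
    and mr: "of_bool (\<not> a) + of_bool (\<not> b) + of_bool (\<not> c) + of_bool (\<not> d) \<le> mr"
    and none: "1 \<le> nl \<Longrightarrow> 3 \<le> dl + of_bool r + of_bool s + of_bool t + of_bool u"
      "2 \<le> nl \<Longrightarrow> 4 \<le> dl + of_bool r + of_bool s + of_bool t + of_bool u"
    and both: "1 \<le> ml \<Longrightarrow> 3 \<le> dl + of_bool (\<not> r) + of_bool (\<not> s) + of_bool (\<not> t) + of_bool (\<not> u)"
      "2 \<le> ml \<Longrightarrow> 4 \<le> dl + of_bool (\<not> r) + of_bool (\<not> s) + of_bool (\<not> t) + of_bool (\<not> u)"
    and one: "1 \<le> nl \<Longrightarrow> 1 \<le> ml \<Longrightarrow> 3 \<le> dl + of_bool (\<not> r) + of_bool (\<not> s) + of_bool t + of_bool u"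
      "1 \<le> nl \<Longrightarrow> 1 \<le> ml \<Longrightarrow> 3 \<le> dl + of_bool r + of_bool s + of_bool (\<not> t) + of_bool (\<not> u)"
    and right: "1 \<le> nr \<Longrightarrow> 1 \<le> mr \<Longrightarrow> 3 \<le> dr + of_bool (a \<noteq> b) + of_bool (c \<noteq> d)"
      "2 \<le> nr \<Longrightarrow> 2 \<le> mr \<Longrightarrow> 4 \<le> dr + of_bool (a \<noteq> b) + of_bool (c \<noteq> d)"
  shows "4 \<le> dl + dr + (of_bool (r \<noteq> a) + of_bool (s \<noteq> b) + of_bool (t \<noteq> c) + of_bool (u \<noteq> d))"
proof -
  consider "nl = 0" | "ml = 0" | "nr = 0" | "mr = 0" | "1 \<le> nl" "1 \<le> ml" "1 \<le> nr" "1 \<le> mr" by linarith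
  then show ?thesis
  proof cases
    case 1
    then have "\<not> r" "\<not> s" "\<not> t" "\<not> u" "3 \<le> nr" using nl size by (auto split: if_splits)
    \<comment> \<open>A deleted edge with separated ends is matched by a link leaving the part, so
      there are at least as many such links as crossing deleted edges. A direct count is needed only
      if at most one right vertex lies outside.\<close>
    moreover consider "mr = 0" | "mr = 1" | "2 \<le> mr" by linarith
    then have "4 \<le> dr + (of_bool a + of_bool b + of_bool c + of_bool d)"
      by cases (use mr right \<open>3 \<le> nr\<close> in \<open>cases a; cases b; cases c; cases d; simp\<close>)+
    ultimately show ?thesis by simp
  next
    case 2
    then have "r" "s" "t" "u" "3 \<le> mr" using ml size by (auto split: if_splits)
    moreover consider "nr = 0" | "nr = 1" | "2 \<le> nr" by linarith
    then have "4 \<le> dr + (of_bool (\<not> a) + of_bool (\<not> b) + of_bool (\<not> c) + of_bool (\<not> d))"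
      by cases (use nr right \<open>3 \<le> mr\<close> in \<open>cases a; cases b; cases c; cases d; simp\<close>)+
    ultimately show ?thesis by simp
  next
    case 3
    then have "\<not> a" "\<not> b" "\<not> c" "\<not> d" "2 \<le> nl" using nr size by (auto split: if_splits)
    then show ?thesis using none(2) by simp
  next
    case 4
    then have "a" "b" "c" "d" "2 \<le> ml" using mr size by (auto split: if_splits)
    then show ?thesis using both(2) by simp
  next
    case 5
    show ?thesis
    proof (rule dot_boundary_arith_proper)
      show "2 \<le> dl" if "of_bool r + of_bool s + of_bool t + of_bool u = (2::nat)"
        using that nl none(2) by linarith
      show "4 \<le> dr + of_bool (a \<noteq> b) + of_bool (c \<noteq> d)"
        if two: "of_bool a + of_bool b + of_bool c + of_bool d = (2::nat)"
      proof -
        have "of_bool (\<not> a) + of_bool (\<not> b) + of_bool (\<not> c) + of_bool (\<not> d) = (2::nat)"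
          using two by (cases a; cases b; cases c; cases d; simp)
        then show ?thesis using right(2) nr mr two by linarith
      qed
    qed (use 5 none(1) both(1) one right(1) in auto)
  qed
qed

text \<open>
  Five permutations of four colours that send any two given colours to five different pairs. Hence
  a requirement that the image of one pair misses a colour outside another fails at most once.
\<close>

definition recolour :: "nat \<Rightarrow> nat \<Rightarrow> nat" where
  "recolour n c = [[0, 1, 2, 3], [0, 2, 3, 1], [1, 2, 0, 3], [2, 3, 1, 0], [3, 0, 1, 2]] ! n ! c"

lemma recolour_less: "n < 5 \<Longrightarrow> c < 4 \<Longrightarrow> recolour n c < 4"
proof -
  have "\<forall>n\<in>set [0..<5]. \<forall>c\<in>set [0..<4]. recolour n c < 4" by code_simp
  then show "n < 5 \<Longrightarrow> c < 4 \<Longrightarrow> recolour n c < 4" by simp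
qed

lemma recolour_inj: "n < 5 \<Longrightarrow> inj_on (recolour n) {..<4}"
proof -
  have "\<forall>n\<in>set [0..<5]. \<forall>c\<in>set [0..<4]. \<forall>c'\<in>set [0..<4]. recolour n c = recolour n c' \<longrightarrow> c = c'"
    by code_simp
  then show "n < 5 \<Longrightarrow> inj_on (recolour n) {..<4}" by (simp add: inj_on_def)
qed

lemma recolour_pairs:
  assumes "m < 5" "n < 5" "k < 4" "l < 4" "k \<noteq> l"
    and "{recolour m k, recolour m l} = {recolour n k, recolour n l}"
  shows "m = n"
proof -
  have *: "\<forall>m\<in>set [0..<5]. \<forall>n\<in>set [0..<5]. \<forall>k\<in>set [0..<4]. \<forall>l\<in>set [0..<4]. k \<noteq> l \<longrightarrow>
    (recolour m k = recolour n k \<and> recolour m l = recolour n l \<or>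
     recolour m k = recolour n l \<and> recolour m l = recolour n k) \<longrightarrow> m = n"
    by code_simp
  show ?thesis using *[rule_format, of m n k l] assms by (auto simp: doubleton_eq_iff)
qed

text \<open>A conflict forces the image of \<open>Q\<close> to be the complement of
  \<open>P\<close>, of size two. Different permutations send the pair to different images, so only
  one can conflict.\<close>

lemma recolour_conflict:
  assumes P: "P \<subseteq> {..<4}" "card P \<le> 2" and Q: "Q \<subseteq> {..<4}" "card Q \<le> 2"
  shows "card {n. n < 5 \<and> {..<4} \<subseteq> P \<union> recolour n ` Q} \<le> 1"
proof -
  have fin: "finite P" "finite Q" using P Q finite_subset by blast+
  have eq: "recolour n ` Q = {..<4} - P" "card Q = 2" if n: "n < 5" "{..<4} \<subseteq> P \<union> recolour n ` Q" for n
  proof -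
    have sub: "{..<4} - P \<subseteq> recolour n ` Q" using n(2) by blast
    have "2 \<le> card ({..<4} - P)" using P fin by (simp add: card_Diff_subset)
    moreover have "card (recolour n ` Q) \<le> card Q" using fin(2) by (rule card_image_le)
    moreover have "card ({..<4} - P) \<le> card (recolour n ` Q)" using sub fin(2) by (intro card_mono) auto
    ultimately have "card Q = 2" "card ({..<4} - P) = card (recolour n ` Q)" using Q(2) by linarith+
    then show "recolour n ` Q = {..<4} - P" "card Q = 2"
      using card_subset_eq[OF _ sub] fin(2) by auto
  qed
  have "m = n" if m: "m < 5" "{..<4} \<subseteq> P \<union> recolour m ` Q" and n: "n < 5" "{..<4} \<subseteq> P \<union> recolour n ` Q" for m n
  proof -
    obtain k l where kl: "Q = {k, l}" "k \<noteq> l" using eq(2)[OF m] by (meson card_2_iff)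
    have "recolour m ` Q = recolour n ` Q" using eq(1)[OF m] eq(1)[OF n] by simp
    then show ?thesis using recolour_pairs[OF m(1) n(1), of k l] Q(1) kl by auto
  qed
  then have "card {n. n < 5 \<and> {..<4} \<subseteq> P \<union> recolour n ` Q} \<le> Suc 0"
    by (subst card_le_Suc0_iff_eq) auto
  then show ?thesis by simp
qed

text \<open>Pigeonhole: each of at most four elements of \<open>Z\<close> excludes at most one of
  the five permutations.\<close>

lemma ex_recolour:
  assumes "finite Z" "card Z \<le> 4"
    and "\<And>z. z \<in> Z \<Longrightarrow> f z \<subseteq> {..<4::nat} \<and> card (f z) \<le> 2"
    and "\<And>z. z \<in> Z \<Longrightarrow> g z \<subseteq> {..<4::nat} \<and> card (g z) \<le> 2"
  shows "\<exists>n<5. \<forall>z\<in>Z. \<exists>c<4. c \<notin> f z \<union> recolour n ` g z"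
proof (rule ccontr)
  assume not: "\<not> ?thesis"
  let ?B = "\<lambda>z. {n. n < 5 \<and> {..<4} \<subseteq> f z \<union> recolour n ` g z}"
  have "{..<5} \<subseteq> (\<Union>z\<in>Z. ?B z)"
  proof
    fix n :: nat assume "n \<in> {..<5}"
    then obtain z where "z \<in> Z" "\<And>c. c < 4 \<Longrightarrow> c \<in> f z \<union> recolour n ` g z" "n < 5" using not by auto
    then show "n \<in> (\<Union>z\<in>Z. ?B z)" by blast
  qed
  then have "card {..<5::nat} \<le> card (\<Union>z\<in>Z. ?B z)"
    using assms(1) by (intro card_mono finite_UN_I) auto
  also have "\<dots> \<le> (\<Sum>z\<in>Z. card (?B z))" by (rule card_UN_le[OF assms(1)])
  also have "\<dots> \<le> (\<Sum>z\<in>Z. 1)" using assms(3,4) recolour_conflict by (intro sum_mono) simp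
  finally show False using assms(2) by simp
qed

lemma boundary_insert:
  assumes "finite E" "{p, q} \<notin> E"
  shows "card (boundary (insert {p, q} E) S) = card (boundary E S) + of_bool ((p \<in> S) \<noteq> (q \<in> S))"
proof -
  have "boundary (insert {p, q} E) S =
      (if (p \<in> S) \<noteq> (q \<in> S) then insert {p, q} (boundary E S) else boundary E S)"
    by (auto simp: boundary_def)
  then show ?thesis using assms by (auto simp: boundary_def)
qed

section \<open>The dot product of two snarks: vertices, edges and degrees\<close>

locale dot =
  fixes L :: "'a graph" and R :: "'b graph" and x y r s t u :: 'a and a b c d :: 'b
  assumes snark_L: "snark L" and snark_R: "snark R"
    and xy: "{x, y} \<in> edges L"
    and neighbours_x: "neighbours L x - {y} = {r, s}" and neighbours_y: "neighbours L y - {x} = {t, u}"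
    and ab: "{a, b} \<in> edges R" and cd: "{c, d} \<in> edges R" and disjoint_ab_cd: "{a, b} \<inter> {c, d} = {}"
begin

definition "VL = verts L - {x, y}"
definition "EL = {e \<in> edges L. e \<inter> {x, y} = {}}"
definition "ER = edges R - {{a, b}, {c, d}}"
definition "T = {(r, a), (s, b), (t, c), (u, d)}"
definition "H = (Inl ` VL \<union> Inr ` verts R, glue EL ER T)"

lemma dot_graph_eq: "dot_graph L x y R r s t u a b c d = H"
  unfolding dot_graph_def H_def VL_def EL_def ER_def T_def glue_def delete_verts_def delete_edges_def
  by (simp add: link_def)

lemma
  shows cubic_L: "cubic L" and con_L: "cyclically_edge_connected 4 L" and girth_L: "5 \<le> girth L"
    and cubic_R: "cubic R" and con_R: "cyclically_edge_connected 4 R" and girth_R: "5 \<le> girth R"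
    and simple_L: "simple_graph L" and simple_R: "simple_graph R"
  using snark_L snark_R by (auto simp: snark_def regular_def)

lemma finite_graphs [simp]:
  "finite (verts L)" "finite (edges L)" "finite (verts R)" "finite (edges R)"
  "finite VL" "finite EL" "finite ER" "finite T"
  using simple_L simple_R simple_graph_finite_edges[OF simple_L] simple_graph_finite_edges[OF simple_R]
  by (simp_all add: simple_graph_def VL_def EL_def ER_def T_def)

lemma edge_L: "e \<in> edges L \<Longrightarrow> e \<subseteq> verts L" "e \<in> edges L \<Longrightarrow> card e = 2"
  using simple_L by (auto simp: simple_graph_def)

lemma edge_R: "e \<in> edges R \<Longrightarrow> e \<subseteq> verts R" "e \<in> edges R \<Longrightarrow> card e = 2"
  using simple_R by (auto simp: simple_graph_def)

lemma edge_EL: "e \<in> EL \<Longrightarrow> e \<subseteq> VL" "e \<in> EL \<Longrightarrow> card e = 2"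
  using edge_L by (auto simp: EL_def VL_def)

lemma edge_ER: "e \<in> ER \<Longrightarrow> e \<subseteq> verts R" "e \<in> ER \<Longrightarrow> card e = 2"
  using edge_R by (auto simp: ER_def)

lemma no_empty_edge [simp]: "{} \<notin> EL" "{} \<notin> ER"
  using edge_EL(2)[of "{}"] edge_ER(2)[of "{}"] by auto

lemma edges_xy: "{x, r} \<in> edges L" "{x, s} \<in> edges L" "{y, t} \<in> edges L" "{y, u} \<in> edges L"
proof -
  have "{r, s} \<subseteq> neighbours L x" "{t, u} \<subseteq> neighbours L y"
    unfolding neighbours_x[symmetric] neighbours_y[symmetric] by blast+
  then show "{x, r} \<in> edges L" "{x, s} \<in> edges L" "{y, t} \<in> edges L" "{y, u} \<in> edges L"
    by (simp_all add: neighbours_def)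
qed

lemma neighbours_x_eq: "neighbours L x = {y, r, s}" and neighbours_y_eq: "neighbours L y = {x, t, u}"
proof -
  have "y \<in> neighbours L x" "x \<in> neighbours L y" using xy by (simp_all add: neighbours_def insert_commute)
  then show "neighbours L x = {y, r, s}" "neighbours L y = {x, t, u}"
    using neighbours_x neighbours_y by (metis insert_Diff)+
qed

text \<open>Degree three makes the two further neighbours of each end of \<open>xy\<close>
  different; a common neighbour of \<open>x\<close> and \<open>y\<close> would close a
  triangle.\<close>

lemma distinct_L: "distinct [x, y, r, s, t, u]"
proof -
  have ne: "x \<noteq> y" "x \<noteq> r" "x \<noteq> s" "y \<noteq> t" "y \<noteq> u"
    using edges_xy xy simple_graph_edge_neq[OF simple_L] by blast+
  have "y \<notin> {r, s}" "x \<notin> {t, u}" unfolding neighbours_x[symmetric] neighbours_y[symmetric] by blast+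
  moreover have "card (neighbours L x) = 3" "card (neighbours L y) = 3"
    using cubic_L edge_L(1)[OF xy] degree_neighbours[OF simple_L, of x] degree_neighbours[OF simple_L, of y]
    by (simp_all add: regular_def)
  then have "r \<noteq> s" "t \<noteq> u"
    unfolding neighbours_x_eq neighbours_y_eq by (auto simp: card_insert_if split: if_splits)
  moreover have "{r, s} \<inter> {t, u} = {}"
  proof (rule ccontr)
    assume "{r, s} \<inter> {t, u} \<noteq> {}"
    then obtain p where "p \<in> {r, s}" "p \<in> {t, u}" by blast
    then have "{x, p} \<in> edges L" "{p, y} \<in> edges L" "{y, x} \<in> edges L"
      using edges_xy xy by (auto simp: insert_commute)
    then show False using girth_5_no_triangle[OF simple_L girth_L] by blast
  qed
  ultimately show ?thesis using ne by (auto simp del: Int_insert_left Int_insert_right)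
qed

lemma distinct_R: "distinct [a, b, c, d]"
  using disjoint_ab_cd simple_graph_edge_neq[OF simple_R ab] simple_graph_edge_neq[OF simple_R cd] by auto

lemma terminals_L: "r \<in> VL" "s \<in> VL" "t \<in> VL" "u \<in> VL"
  using edges_xy edge_L(1) distinct_L by (auto simp: VL_def)

lemma terminals_R: "a \<in> verts R" "b \<in> verts R" "c \<in> verts R" "d \<in> verts R"
  using edge_R(1)[OF ab] edge_R(1)[OF cd] by auto

lemma edges_L: "edges L = insert {x, y} (insert {x, r} (insert {x, s} (insert {y, t} (insert {y, u} EL))))"
proof (intro set_eqI iffI)
  fix e assume e: "e \<in> edges L"
  show "e \<in> insert {x, y} (insert {x, r} (insert {x, s} (insert {y, t} (insert {y, u} EL))))"
  proof (cases "e \<inter> {x, y} = {}")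
    case False
    then have "e \<in> incident (edges L) x \<or> e \<in> incident (edges L) y" using e by (auto simp: incident_def)
    then show ?thesis
      unfolding incident_neighbours[OF simple_L] neighbours_x_eq neighbours_y_eq
      by (auto simp: insert_commute)
  qed (use e in \<open>simp add: EL_def\<close>)
qed (use edges_xy xy in \<open>auto simp: EL_def\<close>)

lemma edges_R: "edges R = insert {a, b} (insert {c, d} ER)"
  using ab cd by (auto simp: ER_def)

lemma new_edges:
  "{x, y} \<notin> EL" "{x, v} \<notin> EL" "{y, v} \<notin> EL" "{a, b} \<notin> ER" "{c, d} \<notin> ER"
  by (auto simp: EL_def ER_def)

lemma boundary_L:
  "card (boundary (edges L) S) = card (boundary EL S) + of_bool ((x \<in> S) \<noteq> (y \<in> S)) +
    of_bool ((x \<in> S) \<noteq> (r \<in> S)) + of_bool ((x \<in> S) \<noteq> (s \<in> S)) +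
    of_bool ((y \<in> S) \<noteq> (t \<in> S)) + of_bool ((y \<in> S) \<noteq> (u \<in> S))"
  using distinct_L new_edges unfolding edges_L
  by (simp add: boundary_insert doubleton_eq_iff add_ac)

lemma boundary_R:
  "card (boundary (edges R) S) = card (boundary ER S) + of_bool ((a \<in> S) \<noteq> (b \<in> S)) +
    of_bool ((c \<in> S) \<noteq> (d \<in> S))"
  using distinct_R new_edges unfolding edges_R
  by (simp add: boundary_insert doubleton_eq_iff add_ac)

lemma terminal_card:
  "card {z \<in> T. v = fst z} = of_bool (v \<in> {r, s, t, u})"
  "card {z \<in> T. w = snd z} = of_bool (w \<in> {a, b, c, d})"
proof -
  have "distinct [(r, a), (s, b), (t, c), (u, d)]" using distinct_L by simp
  note four = card_filter_four[OF this]
  show "card {z \<in> T. v = fst z} = of_bool (v \<in> {r, s, t, u})"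
    unfolding T_def four using distinct_L by auto
  show "card {z \<in> T. w = snd z} = of_bool (w \<in> {a, b, c, d})"
    unfolding T_def four using distinct_R by auto
qed

text \<open>A terminal is joined by exactly one edge to \<open>x\<close> or \<open>y\<close>; its
  link restores degree three in \<open>H\<close>.\<close>

lemma incident_EL: "v \<in> VL \<Longrightarrow> card (incident EL v) + of_bool (v \<in> {r, s, t, u}) = 3"
proof -
  assume v: "v \<in> VL"
  have "incident (edges L) v = incident EL v \<union> {e \<in> {{x, r}, {x, s}, {y, t}, {y, u}}. v \<in> e}"
    using v unfolding edges_L incident_def VL_def by auto
  moreover have "incident EL v \<inter> {e \<in> {{x, r}, {x, s}, {y, t}, {y, u}}. v \<in> e} = {}"
    using new_edges by (auto simp: incident_def)
  moreover have "distinct [{x, r}, {x, s}, {y, t}, {y, u}]" using distinct_L by (auto simp: doubleton_eq_iff)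
  from card_filter_four[OF this, of "\<lambda>e. v \<in> e"]
  have "card {e \<in> {{x, r}, {x, s}, {y, t}, {y, u}}. v \<in> e} = of_bool (v \<in> {r, s, t, u})"
    using v distinct_L by (auto simp: VL_def)
  moreover have "card (incident (edges L) v) = 3"
    using cubic_L v by (simp add: regular_def degree_incident VL_def)
  moreover have "finite (incident EL v)" by (simp add: incident_def)
  ultimately show ?thesis by (simp add: card_Un_disjoint)
qed

lemma incident_ER: "w \<in> verts R \<Longrightarrow> card (incident ER w) + of_bool (w \<in> {a, b, c, d}) = 3"
proof -
  assume w: "w \<in> verts R"
  have "incident (edges R) w = incident ER w \<union> {e \<in> {{a, b}, {c, d}}. w \<in> e}"
    unfolding edges_R incident_def by auto
  moreover have "incident ER w \<inter> {e \<in> {{a, b}, {c, d}}. w \<in> e} = {}"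
    using new_edges by (auto simp: incident_def)
  moreover have "{e \<in> {{a, b}, {c, d}}. w \<in> e} =
      (if w \<in> {a, b} then {{a, b}} else if w \<in> {c, d} then {{c, d}} else {})"
    using disjoint_ab_cd by auto
  then have "card {e \<in> {{a, b}, {c, d}}. w \<in> e} = of_bool (w \<in> {a, b, c, d})" by auto
  moreover have "card (incident (edges R) w) = 3"
    using cubic_R w by (simp add: regular_def degree_incident)
  moreover have "finite (incident ER w)" by (simp add: incident_def)
  ultimately show ?thesis by (simp add: card_Un_disjoint)
qed

lemma link_T: "z \<in> T \<Longrightarrow> fst z \<in> VL \<and> snd z \<in> verts R"
  using terminals_L terminals_R by (auto simp: T_def)

lemma simple_H: "simple_graph H"
proof -
  have "e \<subseteq> verts H \<and> card e = 2" if e: "e \<in> edges H" for e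
  proof -
    consider e' where "e' \<in> EL" "e = Inl ` e'" | e' where "e' \<in> ER" "e = Inr ` e'"
      | z where "z \<in> T" "e = link z"
      using e unfolding H_def glue_def snd_conv by blast
    then show ?thesis
    proof cases
      case 1
      then show ?thesis using edge_EL[of e'] by (auto simp: H_def card_image)
    next
      case 2
      then show ?thesis using edge_ER[of e'] by (auto simp: H_def card_image)
    next
      case 3
      then show ?thesis using link_T[of z] by (auto simp: H_def link_def)
    qed
  qed
  then show ?thesis by (simp add: simple_graph_def H_def)
qed

lemma cubic_H: "cubic H"
proof -
  have "degree H v = 3" if "v \<in> verts H" for v
    using that incident_EL incident_ER
    by (auto simp: H_def degree_incident incident_glue terminal_card simp del: of_bool_eq)
  then show ?thesis using simple_H by (simp add: regular_def)
qed


section \<open>Cyclic edge-connectivity of the dot product\<close>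

lemma con_H: "cyclically_edge_connected 4 H"
proof (rule cyclically_edge_connected_boundaryI[OF simple_H])
  fix S assume S: "S \<subseteq> verts H" "3 \<le> card S" "3 \<le> card (verts H - S)"
  define SL where "SL = Inl -` S"
  define SR where "SR = Inr -` S"
  have subL: "SL \<subseteq> VL" and subR: "SR \<subseteq> verts R" using S by (auto simp: H_def SL_def SR_def)
  have finL: "finite SL" "finite (VL - SL)" and finR: "finite SR" "finite (verts R - SR)"
    using finite_subset[OF subL] finite_subset[OF subR] by simp_all
  have "card S = card SL + card SR"
    unfolding SL_def SR_def using S by (intro card_sum_set[of S VL "verts R"]) (auto simp: H_def)
  moreover have "card (verts H - S) = card (VL - SL) + card (verts R - SR)"
  proof -
    have "Inl -` (verts H - S) = VL - SL" "Inr -` (verts H - S) = verts R - SR"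
      by (auto simp: H_def SL_def SR_def)
    then show ?thesis using card_sum_set[of "verts H - S" VL "verts R"] by (auto simp: H_def)
  qed
  moreover have "of_bool (r \<in> X) + of_bool (s \<in> X) + of_bool (t \<in> X) + of_bool (u \<in> X) \<le> card X"
    if "finite X" for X :: "'a set"
  proof -
    have "card {z \<in> {r, s, t, u}. z \<in> X} \<le> card X" using that by (intro card_mono) auto
    then show ?thesis using card_filter_four[of r s t u "\<lambda>z. z \<in> X"] distinct_L by simp
  qed
  note this[OF finL(1)] this[OF finL(2)]
  moreover have "of_bool (a \<in> X) + of_bool (b \<in> X) + of_bool (c \<in> X) + of_bool (d \<in> X) \<le> card X"
    if "finite X" for X :: "'b set"
  proof -
    have "card {z \<in> {a, b, c, d}. z \<in> X} \<le> card X" using that by (intro card_mono) auto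
    then show ?thesis using card_filter_four[of a b c d "\<lambda>z. z \<in> X"] distinct_R by simp
  qed
  note this[OF finR(1)] this[OF finR(2)]
  moreover have VL: "VL \<subseteq> verts L" "x \<notin> VL" "y \<notin> VL" "{x, y} \<subseteq> verts L" "verts L - VL = {x, y}"
    using edge_L(1)[OF xy] by (auto simp: VL_def)
  have xySL: "x \<notin> SL" "y \<notin> SL" using VL subL by auto
  have xy2: "card {x, y} = 2" using distinct_L by simp
  have EL_only: "boundary EL (SL \<union> X) = boundary EL SL" if "X \<subseteq> {x, y}" for X
    using edge_EL(1) that VL unfolding boundary_def by blast
  have bigL: "4 \<le> card (boundary (edges L) Y)"
    if "Y \<subseteq> verts L" "2 \<le> card Y" "2 \<le> card (verts L - Y)" for Y
    using cyclically_4_edge_connected_boundary[OF cubic_L con_L] that by blast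
  have atL: "x \<noteq> r" "x \<noteq> s" "x \<noteq> t" "x \<noteq> u" "y \<noteq> r" "y \<noteq> s" "y \<noteq> t" "y \<noteq> u" "x \<noteq> y"
    using distinct_L by auto
  have none: "card (boundary (edges L) SL) =
      card (boundary EL SL) + of_bool (r \<in> SL) + of_bool (s \<in> SL) + of_bool (t \<in> SL) + of_bool (u \<in> SL)"
    unfolding boundary_L[of SL] using xySL by simp
  have both: "card (boundary (edges L) (SL \<union> {x, y})) = card (boundary EL SL) +
      of_bool (r \<notin> SL) + of_bool (s \<notin> SL) + of_bool (t \<notin> SL) + of_bool (u \<notin> SL)"
    unfolding boundary_L[of "SL \<union> {x, y}"] EL_only[OF order_refl] using atL by auto
  \<comment> \<open>The summand 1 is the edge \<open>xy\<close>. A bound of four on such a cut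
    therefore leaves the three that \<open>dot_boundary_arith\<close> asks for.\<close>
  have onex: "card (boundary (edges L) (SL \<union> {x})) = card (boundary EL SL) + 1 +
      of_bool (r \<notin> SL) + of_bool (s \<notin> SL) + of_bool (t \<in> SL) + of_bool (u \<in> SL)"
    unfolding boundary_L[of "SL \<union> {x}"] using EL_only[of "{x}"] atL xySL by auto
  have oney: "card (boundary (edges L) (SL \<union> {y})) = card (boundary EL SL) + 1 +
      of_bool (r \<in> SL) + of_bool (s \<in> SL) + of_bool (t \<notin> SL) + of_bool (u \<notin> SL)"
    unfolding boundary_L[of "SL \<union> {y}"] using EL_only[of "{y}"] atL xySL by auto
  have compl: "verts L - SL = (VL - SL) \<union> {x, y}" "verts L - (SL \<union> {x, y}) = VL - SL"
    "verts L - (SL \<union> {x}) = insert y (VL - SL)" "verts L - (SL \<union> {y}) = insert x (VL - SL)"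
    using VL xySL atL by (auto simp: VL_def)
  have ge2: "2 \<le> card (verts L - SL)" "2 \<le> card (SL \<union> {x, y})"
  proof -
    have "card {x, y} \<le> card (verts L - SL)" "card {x, y} \<le> card (SL \<union> {x, y})"
      using compl(1) finL by (auto intro!: card_mono)
    then show "2 \<le> card (verts L - SL)" "2 \<le> card (SL \<union> {x, y})" using xy2 by simp_all
  qed
  have subs: "SL \<subseteq> verts L" "SL \<union> {x, y} \<subseteq> verts L" "SL \<union> {x} \<subseteq> verts L" "SL \<union> {y} \<subseteq> verts L"
    using subL VL by auto
  have L1: "3 \<le> card (boundary (edges L) SL)" if "1 \<le> card SL"
  proof (rule boundary_ge_3[OF cubic_L con_L subs(1)])
    show "SL \<noteq> {}" "SL \<noteq> verts L" using that xySL VL by auto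
  qed
  have L2: "4 \<le> card (boundary (edges L) SL)" if "2 \<le> card SL"
    using bigL[OF subs(1) that ge2(1)] .
  have L3: "3 \<le> card (boundary (edges L) (SL \<union> {x, y}))" if "1 \<le> card (VL - SL)"
  proof (rule boundary_ge_3[OF cubic_L con_L subs(2)])
    show "SL \<union> {x, y} \<noteq> {}" by simp
    have "VL - SL \<noteq> {}" using that by (metis card.empty not_one_le_zero)
    then show "SL \<union> {x, y} \<noteq> verts L" using compl(2) by blast
  qed
  have L4: "4 \<le> card (boundary (edges L) (SL \<union> {x, y}))" if "2 \<le> card (VL - SL)"
    using bigL[OF subs(2) ge2(2)] that compl(2) by simp
  \<comment> \<open>With \<open>x\<close> and \<open>y\<close> on different sides, one further
    vertex on each side already makes the cut nontrivial.\<close>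
  have L5: "4 \<le> card (boundary (edges L) (SL \<union> {x}))" "4 \<le> card (boundary (edges L) (SL \<union> {y}))"
    if "1 \<le> card SL" "1 \<le> card (VL - SL)"
    using bigL[OF subs(3)] bigL[OF subs(4)] that xySL VL finL unfolding compl(3,4)
    by simp_all
  have R1: "3 \<le> card (boundary ER SR) + of_bool ((a \<in> SR) \<noteq> (b \<in> SR)) + of_bool ((c \<in> SR) \<noteq> (d \<in> SR))"
    if "1 \<le> card SR" "1 \<le> card (verts R - SR)"
    unfolding boundary_R[symmetric]
  proof (rule boundary_ge_3[OF cubic_R con_R subR])
    show "SR \<noteq> {}" "SR \<noteq> verts R" using that by auto
  qed
  have R2: "4 \<le> card (boundary ER SR) + of_bool ((a \<in> SR) \<noteq> (b \<in> SR)) + of_bool ((c \<in> SR) \<noteq> (d \<in> SR))"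
    if "2 \<le> card SR" "2 \<le> card (verts R - SR)"
    unfolding boundary_R[symmetric]
    using cyclically_4_edge_connected_boundary[OF cubic_R con_R subR that] .
  have inVL: "(p \<in> VL - SL) = (p \<notin> SL)" if "p \<in> VL" for p using that by blast
  have inR: "(p \<in> verts R - SR) = (p \<notin> SR)" if "p \<in> verts R" for p using that by blast
  have dist: "distinct [(r, a), (s, b), (t, c), (u, d)]" using distinct_L by simp
  have T: "card {z \<in> T. (Inl (fst z) \<in> S) \<noteq> (Inr (snd z) \<in> S)} =
      of_bool ((r \<in> SL) \<noteq> (a \<in> SR)) + of_bool ((s \<in> SL) \<noteq> (b \<in> SR)) +
      of_bool ((t \<in> SL) \<noteq> (c \<in> SR)) + of_bool ((u \<in> SL) \<noteq> (d \<in> SR))"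
    unfolding T_def card_filter_four[OF dist] by (simp add: SL_def SR_def)
  have "4 \<le> card (boundary EL SL) + card (boundary ER SR) +
      (of_bool ((r \<in> SL) \<noteq> (a \<in> SR)) + of_bool ((s \<in> SL) \<noteq> (b \<in> SR)) +
      of_bool ((t \<in> SL) \<noteq> (c \<in> SR)) + of_bool ((u \<in> SL) \<noteq> (d \<in> SR)))"
  proof (rule dot_boundary_arith)
    show "3 \<le> card SL + card SR" "3 \<le> card (VL - SL) + card (verts R - SR)"
      using S calculation by simp_all
    show "of_bool (r \<in> SL) + of_bool (s \<in> SL) + of_bool (t \<in> SL) + of_bool (u \<in> SL) \<le> card SL"
      "of_bool (r \<notin> SL) + of_bool (s \<notin> SL) + of_bool (t \<notin> SL) + of_bool (u \<notin> SL) \<le> card (VL - SL)"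
      "of_bool (a \<in> SR) + of_bool (b \<in> SR) + of_bool (c \<in> SR) + of_bool (d \<in> SR) \<le> card SR"
      "of_bool (a \<notin> SR) + of_bool (b \<notin> SR) + of_bool (c \<notin> SR) + of_bool (d \<notin> SR) \<le> card (verts R - SR)"
      using calculation terminals_L terminals_R by (simp_all add: inVL inR)
  qed (use L1 L2 L3 L4 L5 R1 R2 none both onex oney in simp_all)
  then show "4 \<le> card (boundary (edges H) S)"
    unfolding H_def snd_conv boundary_glue[OF finite_graphs(6-8) no_empty_edge]
      SL_def[symmetric] SR_def[symmetric] T .
qed

section \<open>Girth of the dot product\<close>

lemma T_functional: "(v, w) \<in> T \<Longrightarrow> (v, w') \<in> T \<Longrightarrow> w = w'"
  and T_injective: "(v, w) \<in> T \<Longrightarrow> (v', w) \<in> T \<Longrightarrow> v = v'"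
  using distinct_L distinct_R by (auto simp: T_def)

text \<open>Adjacent terminals at the same end of \<open>xy\<close> would close a triangle, those at
  different ends a quadrangle through \<open>xy\<close>.\<close>

lemma terminals_not_adjacent:
  assumes "p \<in> {r, s, t, u}" "q \<in> {r, s, t, u}" shows "{p, q} \<notin> EL"
proof
  assume "{p, q} \<in> EL"
  then have pq: "{p, q} \<in> edges L" "p \<noteq> q" using edge_EL(2)[of "{p, q}"] by (auto simp: EL_def)
  have no3: False if "{v, p} \<in> edges L" "{q, v} \<in> edges L" for v
    using girth_5_no_triangle[OF simple_L girth_L, of v p q] that pq by blast
  have no4: False if "{x, p} \<in> edges L" "{q, y} \<in> edges L" "p \<noteq> y" "q \<noteq> x"
    using girth_5_no_quadrangle[OF simple_L girth_L, of x q p y] that pq xy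
    by (auto simp: insert_commute)
  have no4': False if "{y, p} \<in> edges L" "{q, x} \<in> edges L" "p \<noteq> x" "q \<noteq> y"
    using girth_5_no_quadrangle[OF simple_L girth_L, of y q p x] that pq xy
    by (auto simp: insert_commute)
  have neq: "p \<noteq> x" "p \<noteq> y" "q \<noteq> x" "q \<noteq> y" using assms distinct_L by auto
  have sides: "{x, v} \<in> edges L" "{v, x} \<in> edges L" if "v \<in> {r, s}" for v
    using edges_xy that by (auto simp: insert_commute)
  have sides': "{y, v} \<in> edges L" "{v, y} \<in> edges L" if "v \<in> {t, u}" for v
    using edges_xy that by (auto simp: insert_commute)
  consider "p \<in> {r, s}" "q \<in> {r, s}" | "p \<in> {r, s}" "q \<in> {t, u}" | "p \<in> {t, u}" "q \<in> {r, s}"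
    | "p \<in> {t, u}" "q \<in> {t, u}" using assms by blast
  then show False
    by cases (use no3 no4 no4' neq sides sides' in blast)+
qed

lemma no_empty_adjacent: "{v, v} \<notin> EL" "{w, w} \<notin> ER"
  using edge_EL(2)[of "{v, v}"] edge_ER(2)[of "{w, w}"] by auto

lemma linked_not_adjacent: "(v, w) \<in> T \<Longrightarrow> (v', w') \<in> T \<Longrightarrow> {v, v'} \<notin> EL"
  by (rule terminals_not_adjacent) (auto simp: T_def)

lemma linked_not_adjacent': "(v, w) \<in> T \<Longrightarrow> (v, w') \<in> T \<Longrightarrow> {w, w'} \<notin> ER"
  using T_functional[of v w w'] no_empty_adjacent(2)[of w] by auto

lemma no_triangle:
  "{v1, v2} \<in> EL \<Longrightarrow> {v2, v3} \<in> EL \<Longrightarrow> {v3, v1} \<in> EL \<Longrightarrow> False"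
  "{w1, w2} \<in> ER \<Longrightarrow> {w2, w3} \<in> ER \<Longrightarrow> {w3, w1} \<in> ER \<Longrightarrow> False"
  using girth_5_no_triangle[OF simple_L girth_L, of v1 v2 v3]
    girth_5_no_triangle[OF simple_R girth_R, of w1 w2 w3]
  by (simp_all add: EL_def ER_def)

lemma no_quadrangle:
  "{v1, v2} \<in> EL \<Longrightarrow> {v2, v3} \<in> EL \<Longrightarrow> {v3, v4} \<in> EL \<Longrightarrow> {v4, v1} \<in> EL \<Longrightarrow> v1 \<noteq> v3 \<Longrightarrow> v2 \<noteq> v4 \<Longrightarrow> False"
  "{w1, w2} \<in> ER \<Longrightarrow> {w2, w3} \<in> ER \<Longrightarrow> {w3, w4} \<in> ER \<Longrightarrow> {w4, w1} \<in> ER \<Longrightarrow> w1 \<noteq> w3 \<Longrightarrow> w2 \<noteq> w4 \<Longrightarrow> False"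
  using girth_5_no_quadrangle[OF simple_L girth_L, of v1 v3 v2 v4]
    girth_5_no_quadrangle[OF simple_R girth_R, of w1 w3 w2 w4]
  by (simp_all add: EL_def ER_def)

text \<open>A cycle of length three or four that crosses between the halves would need adjacent
  terminals on the left or two links at one vertex.\<close>

lemma girth_H: "5 \<le> girth H"
proof (rule girth_ge_5I)
  note adj = doubleton_in_glue[OF no_empty_edge]
  fix p q w
  assume "{p, q} \<in> edges H" "{q, w} \<in> edges H" "{w, p} \<in> edges H"
  then show False
    by (cases p; cases q; cases w; simp add: H_def adj)
      (erule (2) no_triangle | blast dest: linked_not_adjacent linked_not_adjacent')+
next
  note adj = doubleton_in_glue[OF no_empty_edge]
  fix p q w z
  assume "{p, q} \<in> edges H" "{q, w} \<in> edges H" "{w, z} \<in> edges H" "{z, p} \<in> edges H"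
    "p \<noteq> w" "q \<noteq> z"
  then show False
    by (cases p; cases q; cases w; cases z; simp add: H_def adj)
      (erule (5) no_quadrangle | blast dest: linked_not_adjacent T_functional T_injective)+
qed


section \<open>Edge colouring of the dot product\<close>

text \<open>Both snarks lend their colourings to the two halves. Each end of a link sees at most two
  colours, and after a permutation of the colours on the right every link finds a colour free at
  both ends. Links form a matching, so they do not disturb one another.\<close>

lemma edge_colourable_H: "edge_colourable 4 H"
proof -
  obtain colL :: "'a set \<Rightarrow> nat" where colL: "\<forall>e\<in>edges L. colL e < 4"
    and properL: "\<forall>e\<in>edges L. \<forall>e'\<in>edges L. e \<noteq> e' \<longrightarrow> e \<inter> e' \<noteq> {} \<longrightarrow> colL e \<noteq> colL e'"
    using snark_edge_colourable_4[OF snark_L] unfolding edge_colourable_def by (elim exE conjE)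
  obtain colR :: "'b set \<Rightarrow> nat" where colR: "\<forall>e\<in>edges R. colR e < 4"
    and properR: "\<forall>e\<in>edges R. \<forall>e'\<in>edges R. e \<noteq> e' \<longrightarrow> e \<inter> e' \<noteq> {} \<longrightarrow> colR e \<noteq> colR e'"
    using snark_edge_colourable_4[OF snark_R] unfolding edge_colourable_def by (elim exE conjE)
  have EL_L: "e \<in> edges L" if "e \<in> EL" for e using that by (simp add: EL_def)
  have ER_R: "e \<in> edges R" if "e \<in> ER" for e using that by (simp add: ER_def)
  define f where "f z = colL ` incident EL (fst z)" for z :: "'a \<times> 'b"
  define g where "g z = colR ` incident ER (snd z)" for z :: "'a \<times> 'b"
  have "\<exists>n<5. \<forall>z\<in>T. \<exists>c<4. c \<notin> f z \<union> recolour n ` g z"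
  proof (rule ex_recolour)
    show "card T \<le> 4" unfolding T_def using card_length[of "[(r, a), (s, b), (t, c), (u, d)]"] by simp
    fix z assume z: "z \<in> T"
    have "fst z \<in> VL" "fst z \<in> {r, s, t, u}" "snd z \<in> verts R" "snd z \<in> {a, b, c, d}"
      using link_T[OF z] z by (auto simp: T_def)
    then have "card (incident EL (fst z)) = 2" "card (incident ER (snd z)) = 2"
      using incident_EL[of "fst z"] incident_ER[of "snd z"] by simp_all
    moreover have "finite (incident EL (fst z))" "finite (incident ER (snd z))"
      by (simp_all add: incident_def)
    ultimately have "card (f z) \<le> 2" "card (g z) \<le> 2"
      unfolding f_def g_def by (metis card_image_le)+
    then show "f z \<subseteq> {..<4} \<and> card (f z) \<le> 2" "g z \<subseteq> {..<4} \<and> card (g z) \<le> 2"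
      using colL colR EL_L ER_R by (auto simp: f_def g_def incident_def)
  qed simp
  then obtain n where n: "n < 5" and "\<forall>z\<in>T. \<exists>c<4. c \<notin> f z \<union> recolour n ` g z" by blast
  then obtain h where h: "\<forall>z\<in>T. h z < 4 \<and> h z \<notin> f z \<union> recolour n ` g z" by metis
  \<comment> \<open>Among the edges that are not links, the preimage under \<open>Inl\<close> is
    nonempty exactly for those of the left half, which decides the colouring to be used.\<close>
  define col where "col e = (if e \<in> link ` T then h (inv_into T link e)
      else if Inl -` e \<noteq> {} then colL (Inl -` e) else recolour n (colR (Inr -` e)))" for e
  have vim: "Inl -` (Inl ` X) = X" "Inl -` (Inr ` Y) = {}" "Inr -` (Inr ` Y) = Y"
    for X :: "'a set" and Y :: "'b set" by auto
  have col_link: "col (link z) = h z" if "z \<in> T" for z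
    using that by (simp add: col_def inv_into_f_f[OF inj_link])
  have col_L: "col (Inl ` e) = colL e" if "e \<in> EL" for e
  proof -
    have "e \<noteq> {}" using that no_empty_edge by blast
    moreover have "Inl ` e \<notin> link ` T" by auto
    ultimately show ?thesis unfolding col_def vim by simp
  qed
  have col_R: "col (Inr ` e) = recolour n (colR e)" for e
  proof -
    have "Inr ` e \<notin> link ` T" by auto
    then show ?thesis unfolding col_def vim by simp
  qed
  have cases_H: thesis
    if "e \<in> edges H" "\<And>e'. e' \<in> EL \<Longrightarrow> e = Inl ` e' \<Longrightarrow> thesis" "\<And>e'. e' \<in> ER \<Longrightarrow> e = Inr ` e' \<Longrightarrow> thesis"
      "\<And>z. z \<in> T \<Longrightarrow> e = link z \<Longrightarrow> thesis" for e thesis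
    using that unfolding H_def glue_def snd_conv by blast
  have less: "col e < 4" if "e \<in> edges H" for e
    using that
  proof (rule cases_H)
    fix e' assume "e' \<in> EL" "e = Inl ` e'" then show ?thesis using col_L colL EL_L by simp
  next
    fix e' assume "e' \<in> ER" "e = Inr ` e'"
    then show ?thesis using recolour_less[OF n] colR ER_R by (simp add: col_R)
  next
    fix z assume "z \<in> T" "e = link z" then show ?thesis using col_link h by simp
  qed
  have link_L: "colL e \<noteq> h z" if "e \<in> EL" "z \<in> T" "Inl ` e \<inter> link z \<noteq> {}" for e z
  proof -
    have "fst z \<in> e" using that(3) by (auto simp: link_def)
    then have "colL e \<in> f z" using that(1) by (auto simp: f_def incident_def)
    then show ?thesis using h that(2) by auto
  qed
  have link_R: "recolour n (colR e) \<noteq> h z" if "e \<in> ER" "z \<in> T" "Inr ` e \<inter> link z \<noteq> {}" for e z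
  proof -
    have "snd z \<in> e" using that(3) by (auto simp: link_def)
    then have "recolour n (colR e) \<in> recolour n ` g z" using that(1) by (auto simp: g_def incident_def)
    then show ?thesis using h that(2) by auto
  qed
  have "col e \<noteq> col e'" if e: "e \<in> edges H" "e' \<in> edges H" and ne: "e \<noteq> e'" "e \<inter> e' \<noteq> {}" for e e'
    using e(1)
  proof (rule cases_H)
    fix p assume p: "p \<in> EL" "e = Inl ` p"
    show ?thesis using e(2)
    proof (rule cases_H)
      fix q assume q: "q \<in> EL" "e' = Inl ` q"
      have "p \<noteq> q" "p \<inter> q \<noteq> {}" using p q ne by auto
      then show ?thesis using properL EL_L p q by (simp add: col_L)
    next
      fix q assume "q \<in> ER" "e' = Inr ` q"
      then show ?thesis using p ne by auto
    next
      fix z assume "z \<in> T" "e' = link z"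
      then show ?thesis using link_L[OF p(1), of z] p ne by (simp add: col_L col_link)
    qed
  next
    fix p assume p: "p \<in> ER" "e = Inr ` p"
    show ?thesis using e(2)
    proof (rule cases_H)
      fix q assume q: "q \<in> ER" "e' = Inr ` q"
      have "p \<noteq> q" "p \<inter> q \<noteq> {}" using p q ne by auto
      then have "colR p \<noteq> colR q" using properR ER_R p q by simp
      then show ?thesis using inj_onD[OF recolour_inj[OF n], of "colR p" "colR q"] colR ER_R p q
        by (auto simp: col_R)
    next
      fix q assume "q \<in> EL" "e' = Inl ` q"
      then show ?thesis using p ne by auto
    next
      fix z assume "z \<in> T" "e' = link z"
      then show ?thesis using link_R[OF p(1), of z] p ne by (simp add: col_R col_link)
    qed
  next
    fix z assume z: "z \<in> T" "e = link z"
    show ?thesis using e(2)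
    proof (rule cases_H)
      fix q assume q: "q \<in> EL" "e' = Inl ` q"
      then show ?thesis using link_L[OF q(1) z(1)] z ne by (simp add: col_L col_link Int_commute)
    next
      fix q assume q: "q \<in> ER" "e' = Inr ` q"
      then show ?thesis using link_R[OF q(1) z(1)] z ne by (simp add: col_R col_link Int_commute)
    next
      fix z' assume z': "z' \<in> T" "e' = link z'"
      obtain v w v' w' where vw: "z = (v, w)" "z' = (v', w')" by (metis surj_pair)
      have "v = v' \<or> w = w'" using ne z z' vw by (auto simp: link_def)
      then have "z = z'" using T_functional[of v w w'] T_injective[of v w v'] z z' vw by blast
      then show ?thesis using ne z z' by simp
    qed
  qed
  then show ?thesis using less unfolding edge_colourable_def by (intro exI[of _ col]) blast
qed

lemma odd_two_factored_imp_snark_H: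
  assumes "odd_two_factored H" shows "snark H"
proof -
  have "verts H \<noteq> {}" using terminals_R by (auto simp: H_def)
  then have not3: "\<not> edge_colourable 3 H"
    using odd_two_factored_not_3_edge_colourable[OF cubic_H] assms by blast
  have "edge_chromatic_number H = 4"
    unfolding edge_chromatic_number_def
  proof (rule Least_equality)
    show "edge_colourable 4 H" by (rule edge_colourable_H)
  next
    fix k assume "edge_colourable k H"
    then have "\<not> k \<le> 3" using edge_colourable_mono not3 by blast
    then show "4 \<le> k" by simp
  qed
  then show ?thesis using cubic_H con_H girth_H by (simp add: snark_def)
qed

end

section \<open>Completing the two halves of a 2-factor\<close>

lemma completion_two_regular:
  assumes "finite V" "finite U" "finite N" and disj: "V \<inter> U = {}" "E \<inter> N = {}"
    and E: "\<And>e. e \<in> E \<Longrightarrow> e \<subseteq> V" "\<And>e. e \<in> E \<Longrightarrow> card e = 2"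
    and N: "\<And>e. e \<in> N \<Longrightarrow> e \<subseteq> V \<union> U" "\<And>e. e \<in> N \<Longrightarrow> card e = 2"
    and degV: "\<And>v. v \<in> V \<Longrightarrow> card (incident E v) + card (incident N v) = 2"
    and degU: "\<And>w. w \<in> U \<Longrightarrow> card (incident N w) = 2"
  shows "regular 2 (V \<union> U, E \<union> N)"
proof -
  have finE: "finite E" using E(1) assms(1) by (auto intro: finite_subset[of E "Pow V"])
  have "card (incident (E \<union> N) v) = 2" if "v \<in> V \<union> U" for v
  proof -
    have "incident (E \<union> N) v = incident E v \<union> incident N v" by (auto simp: incident_def)
    moreover have "incident E v \<inter> incident N v = {}" using disj(2) by (auto simp: incident_def)
    moreover have "finite (incident E v)" "finite (incident N v)"
      using finE assms(3) by (simp_all add: incident_def)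
    ultimately have "card (incident (E \<union> N) v) = card (incident E v) + card (incident N v)"
      by (simp add: card_Un_disjoint)
    moreover have "incident E v = {}" if "v \<in> U" using that E(1) disj(1) by (auto simp: incident_def)
    ultimately show ?thesis using that degV degU by auto
  qed
  moreover have "e \<subseteq> V \<union> U \<and> card e = 2" if "e \<in> E \<union> N" for e using that E N by blast
  ultimately show ?thesis using assms(1,2) by (simp add: regular_def simple_graph_def degree_incident)
qed

text \<open>Inside a closed set the vertices of \<open>D\<close> are those of odd degree, so degree
  counting makes their number even.\<close>

lemma even_card_closed_Int:
  assumes "finite V" and E: "\<And>e. e \<in> E \<Longrightarrow> e \<subseteq> V" "\<And>e. e \<in> E \<Longrightarrow> card e = 2"
    and deg: "\<And>v. v \<in> V \<Longrightarrow> card (incident E v) + of_bool (v \<in> D) = 2"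
    and K: "K \<subseteq> V" "closed_in E K"
  shows "even (card (K \<inter> D))"
proof -
  have fin: "finite E" "finite K"
    using E(1) assms(1) K(1) by (auto intro: finite_subset[of E "Pow V"] finite_subset[of K V])
  have "boundary E K = {}" using K(2) closed_in_boundary by blast
  then have "(\<Sum>v\<in>K. card (incident E v)) = 2 * card (inside E K)"
    using handshake[OF fin E(2)] by simp
  moreover have "(\<Sum>v\<in>K. card (incident E v) + of_bool (v \<in> D)) = (\<Sum>v\<in>K. 2)"
    using K(1) by (intro sum.cong refl deg) blast
  moreover have "(\<Sum>v\<in>K. of_bool (v \<in> D) :: nat) = card (K \<inter> D)" using fin(2) by simp
  ultimately have "2 * card (inside E K) + card (K \<inter> D) = 2 * card K" by (simp add: sum.distrib)
  then show ?thesis by presburger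
qed

text \<open>\<open>D\<close> consists of the loose ends of the half-circuit \<open>K\<close>, and
  the new edges tie them and \<open>U0\<close> into one piece. A nonempty closed part of the
  completion then contains all of \<open>D\<close> and \<open>U0\<close>, and what it leaves of
  \<open>K\<close> would be closed without meeting \<open>D\<close>.\<close>

lemma circuit_completion:
  assumes E: "\<And>e. e \<in> E \<Longrightarrow> e \<subseteq> V" and U: "U \<inter> V = {}" "U0 \<subseteq> U"
    and K: "K \<subseteq> V" "closed_in E K" "D \<subseteq> K" "D \<noteq> {}"
    and min: "\<And>K'. K' \<subseteq> K \<Longrightarrow> K' \<noteq> {} \<Longrightarrow> closed_in E K' \<Longrightarrow> K' \<inter> D \<noteq> {}"
    and N: "\<And>e. e \<in> N \<Longrightarrow> e \<inter> (K \<union> U0) \<noteq> {} \<Longrightarrow> e \<subseteq> D \<union> U0"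
    and conn: "\<And>S. closed_in N S \<Longrightarrow> S \<inter> (D \<union> U0) \<noteq> {} \<Longrightarrow> D \<union> U0 \<subseteq> S"
  shows "circuit (V \<union> U) (E \<union> N) (K \<union> U0)"
  unfolding circuit_def
proof (intro conjI allI impI)
  show "K \<union> U0 \<subseteq> V \<union> U" "K \<union> U0 \<noteq> {}" using K U by auto
  show "closed_in (E \<union> N) (K \<union> U0)"
    unfolding closed_in_def
  proof (intro ballI impI)
    fix e assume e: "e \<in> E \<union> N" "e \<inter> (K \<union> U0) \<noteq> {}"
    show "e \<subseteq> K \<union> U0"
    proof (cases "e \<in> E")
      case True
      then have "e \<inter> K \<noteq> {}" using e(2) E[of e] U by blast
      then show ?thesis using K(2) True by (auto simp: closed_in_def)
    next
      case False
      then have "e \<subseteq> D \<union> U0" using N e by blast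
      then show ?thesis using K(3) by blast
    qed
  qed
  fix K' assume K': "K' \<subseteq> K \<union> U0" "K' \<noteq> {}" "closed_in (E \<union> N) K'"
  have closed: "closed_in E K'" "closed_in N K'" using K'(3) by (simp_all add: closed_in_def)
  have "K' \<inter> (D \<union> U0) \<noteq> {}"
  proof
    assume no: "K' \<inter> (D \<union> U0) = {}"
    then have "K' \<subseteq> K" using K'(1) by blast
    then have "K' \<inter> D \<noteq> {}" using min K'(2) closed(1) by blast
    then show False using no by blast
  qed
  then have sub: "D \<union> U0 \<subseteq> K'" using conn closed(2) by blast
  have "K - K' = {}"
  proof (rule ccontr)
    assume "K - K' \<noteq> {}"
    then have "(K - K') \<inter> D \<noteq> {}" using min[of "K - K'"] closed_in_Diff[OF K(2) closed(1)] by blast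
    then show False using sub by blast
  qed
  then show "K' = K \<union> U0" using K'(1) sub by blast
qed

lemma incident_insert:
  "incident (insert e N) v = (if v \<in> e then insert e (incident N v) else incident N v)"
  and incident_empty: "incident {} v = {}"
  by (auto simp: incident_def)

locale bold_gadget_dot = dot +
  assumes bold: "bold_edge L x y" and gadget: "gadget_pair R {a, b} {c, d}"
begin

text \<open>Conditions (ii) and (iii) cover the 2-factors with and without \<open>xy\<close>, hence
  all of them.\<close>

lemma two_factor_L_odd: "two_factor F L \<Longrightarrow> odd_cycles F"
  and two_factor_L_minus_odd: "two_factor F (delete_verts L {y}) \<Longrightarrow> odd_cycles F"
  using bold unfolding bold_edge_def by blast+

lemma gadget_conditions:
  "\<not> (\<exists>F. two_factor F R \<and> {a, b} \<notin> edges F \<and> {c, d} \<notin> edges F)"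
  "\<forall>F. two_factor F R \<and> ({a, b} \<in> edges F) \<noteq> ({c, d} \<in> edges F) \<longrightarrow> odd_cycles F"
  "\<forall>F. two_factor F R \<and> {a, b} \<in> edges F \<and> {c, d} \<in> edges F \<longrightarrow>
    odd_cycles F \<and> \<not> (\<exists>p. cycle F p \<and> {a, b} \<in> cycle_edges p \<and> {c, d} \<in> cycle_edges p)"
  "\<forall>F e. two_factor F (add_edges (delete_edges R {{a, b}, {c, d}}) (cross_edges {a, b} {c, d})) \<and>
    edges F \<inter> cross_edges {a, b} {c, d} = {e} \<longrightarrow>
    (\<forall>p. cycle F p \<longrightarrow> (if e \<in> cycle_edges p then even (length p) else odd (length p)))"
proof -
  note g = gadget[unfolded gadget_pair_def]
  show "\<not> (\<exists>F. two_factor F R \<and> {a, b} \<notin> edges F \<and> {c, d} \<notin> edges F)" using g by (elim conjE)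
  show "\<forall>F. two_factor F R \<and> ({a, b} \<in> edges F) \<noteq> ({c, d} \<in> edges F) \<longrightarrow> odd_cycles F"
    using g by (elim conjE)
  show "\<forall>F. two_factor F R \<and> {a, b} \<in> edges F \<and> {c, d} \<in> edges F \<longrightarrow>
    odd_cycles F \<and> \<not> (\<exists>p. cycle F p \<and> {a, b} \<in> cycle_edges p \<and> {c, d} \<in> cycle_edges p)"
    using g by (elim conjE)
  show "\<forall>F e. two_factor F (add_edges (delete_edges R {{a, b}, {c, d}}) (cross_edges {a, b} {c, d})) \<and>
    edges F \<inter> cross_edges {a, b} {c, d} = {e} \<longrightarrow>
    (\<forall>p. cycle F p \<longrightarrow> (if e \<in> cycle_edges p then even (length p) else odd (length p)))"
    using g by (elim conjE)
qed

end

section \<open>The two halves of a 2-factor of the dot product\<close>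

locale dot_factor = bold_gadget_dot +
  fixes F :: "('a + 'b) graph"
  assumes F: "two_factor F H"
begin

definition "FL = {e \<in> EL. Inl ` e \<in> edges F}"
definition "FR = {e \<in> ER. Inr ` e \<in> edges F}"
definition "FT = {z. link z \<in> edges F}"
definition "DL = fst ` FT"
definition "DR = snd ` FT"

lemma FT_subset: "FT \<subseteq> T"
  using F link_in_glue[of _ EL ER T] by (auto simp: FT_def two_factor_def H_def)

lemma edges_F: "edges F = glue FL FR FT"
proof -
  have "edges F \<subseteq> glue EL ER T" using F by (simp add: two_factor_def H_def)
  then have "edges F = glue FL FR {z \<in> T. link z \<in> edges F}"
    using subset_glue[of "edges F" EL ER T] by (simp add: FL_def FR_def)
  moreover have "{z \<in> T. link z \<in> edges F} = FT" using FT_subset by (auto simp: FT_def)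
  ultimately show ?thesis by simp
qed

lemma regular_F: "regular 2 F" and verts_F: "verts F = Inl ` VL \<union> Inr ` verts R"
  using F by (simp_all add: two_factor_def H_def)

lemma edge_FL: "e \<in> FL \<Longrightarrow> e \<in> EL" "e \<in> FL \<Longrightarrow> e \<subseteq> VL" "e \<in> FL \<Longrightarrow> card e = 2" "e \<in> FL \<Longrightarrow> e \<in> edges L"
  using edge_EL by (auto simp: FL_def EL_def)

lemma edge_FR: "e \<in> FR \<Longrightarrow> e \<in> ER" "e \<in> FR \<Longrightarrow> e \<subseteq> verts R" "e \<in> FR \<Longrightarrow> card e = 2" "e \<in> FR \<Longrightarrow> e \<in> edges R"
  using edge_ER by (auto simp: FR_def ER_def)

lemma finite_F [simp]: "finite FL" "finite FR" "finite FT"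
  using FT_subset finite_subset[OF FT_subset] by (simp_all add: FL_def FR_def)

lemma card_FT_at:
  "card {z \<in> FT. v = fst z} = of_bool (v \<in> DL)" "card {z \<in> FT. w = snd z} = of_bool (w \<in> DR)"
proof -
  have "{z \<in> FT. v = fst z} = {(v, w)}" if "(v, w) \<in> FT" for w
    using that FT_subset T_functional by fastforce
  moreover have "{z \<in> FT. v = fst z} = {}" if "v \<notin> DL" using that by (force simp: DL_def)
  ultimately show "card {z \<in> FT. v = fst z} = of_bool (v \<in> DL)" by (auto simp: DL_def)
  have "{z \<in> FT. w = snd z} = {(v, w)}" if "(v, w) \<in> FT" for v
    using that FT_subset T_injective by fastforce
  moreover have "{z \<in> FT. w = snd z} = {}" if "w \<notin> DR" using that by (force simp: DR_def)
  ultimately show "card {z \<in> FT. w = snd z} = of_bool (w \<in> DR)" by (auto simp: DR_def)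
qed

lemma degree_FL: "v \<in> VL \<Longrightarrow> card (incident FL v) + of_bool (v \<in> DL) = 2"
  and degree_FR: "w \<in> verts R \<Longrightarrow> card (incident FR w) + of_bool (w \<in> DR) = 2"
proof -
  have ne: "{} \<notin> FL" "{} \<notin> FR" using edge_FL(1) edge_FR(1) no_empty_edge by blast+
  have "card (incident (edges F) p) = 2" if "p \<in> verts F" for p
    using regular_F that by (simp add: regular_def degree_incident)
  note deg = this[unfolded edges_F verts_F]
  show "card (incident FL v) + of_bool (v \<in> DL) = 2" if "v \<in> VL"
    using deg[of "Inl v"] that unfolding incident_glue[OF finite_F ne] card_FT_at by simp
  show "card (incident FR w) + of_bool (w \<in> DR) = 2" if "w \<in> verts R"
    using deg[of "Inr w"] that unfolding incident_glue[OF finite_F ne] card_FT_at by simp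
qed

lemma even_closed_FL: "K \<subseteq> VL \<Longrightarrow> closed_in FL K \<Longrightarrow> even (card (K \<inter> DL))"
  and even_closed_FR: "K' \<subseteq> verts R \<Longrightarrow> closed_in FR K' \<Longrightarrow> even (card (K' \<inter> DR))"
  using even_card_closed_Int[of VL FL DL K] even_card_closed_Int[of "verts R" FR DR K']
    degree_FL degree_FR edge_FL edge_FR by simp_all

text \<open>\<open>VL\<close> itself is closed, and the number of its loose ends is that of the used
  links.\<close>

lemma even_card_FT: "even (card FT)"
proof -
  have "DL \<subseteq> VL" using FT_subset link_T by (auto simp: DL_def)
  then have "even (card DL)"
    using even_closed_FL[of VL] edge_FL(2) by (simp add: closed_in_def Int_absorb1)
  moreover have "inj_on fst FT"
    using FT_subset T_functional by (fastforce simp: inj_on_def)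
  ultimately show ?thesis by (simp add: DL_def card_image)
qed

end

context dot_factor
begin

text \<open>All new edges meet \<open>x\<close> or \<open>y\<close>, which keeps them apart from
  \<open>FL\<close>.\<close>

lemma completion_L:
  assumes "finite U" "finite N" "VL \<inter> U = {}"
    and "\<And>e. e \<in> N \<Longrightarrow> e \<subseteq> VL \<union> U \<and> card e = 2 \<and> e \<inter> {x, y} \<noteq> {}"
    and "\<And>v. v \<in> VL \<Longrightarrow> card (incident N v) = of_bool (v \<in> DL)"
    and "\<And>w. w \<in> U \<Longrightarrow> card (incident N w) = 2"
  shows "regular 2 (VL \<union> U, FL \<union> N)"
proof (rule completion_two_regular)
  show "FL \<inter> N = {}" using assms(4) edge_FL(1) by (fastforce simp: EL_def)
qed (use assms edge_FL degree_FL in auto)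

lemma completion_R:
  assumes "finite N" "FR \<inter> N = {}"
    and "\<And>e. e \<in> N \<Longrightarrow> e \<subseteq> verts R \<and> card e = 2"
    and "\<And>w. w \<in> verts R \<Longrightarrow> card (incident N w) = of_bool (w \<in> DR)"
  shows "regular 2 (verts R, FR \<union> N)"
proof -
  have "regular 2 (verts R \<union> {}, FR \<union> N)"
    by (rule completion_two_regular) (use assms edge_FR degree_FR in auto)
  then show ?thesis by simp
qed

end

section \<open>The two halves of a single circuit\<close>

locale dot_circuit = dot_factor +
  fixes K :: "('a + 'b) set"
  assumes K: "circuit (verts F) (edges F) K"
begin

definition "KL = Inl -` K"
definition "KR = Inr -` K"

lemma K_subset: "KL \<subseteq> VL" "KR \<subseteq> verts R"
  using K by (auto simp: circuit_def verts_F KL_def KR_def)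

lemma K_finite [simp]: "finite KL" "finite KR"
  using finite_subset[OF K_subset(1)] finite_subset[OF K_subset(2)] by simp_all

lemma card_K: "card K = card KL + card KR"
  unfolding KL_def KR_def
  using K by (intro card_sum_set[of K VL "verts R"]) (auto simp: circuit_def verts_F)

lemma K_closed: "closed_in FL KL" "closed_in FR KR" "\<And>v w. (v, w) \<in> FT \<Longrightarrow> v \<in> KL \<longleftrightarrow> w \<in> KR"
proof -
  have "closed_in (glue FL FR FT) K" using K by (simp add: circuit_def edges_F)
  then have *: "closed_in FL KL" "closed_in FR KR" "\<forall>z\<in>FT. fst z \<in> KL \<longleftrightarrow> snd z \<in> KR"
    unfolding closed_in_glue KL_def KR_def by simp_all
  show "closed_in FL KL" "closed_in FR KR" by (rule *)+
  show "v \<in> KL \<longleftrightarrow> w \<in> KR" if "(v, w) \<in> FT" for v w using *(3) that by fastforce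
qed

text \<open>Closed parts of the two halves that agree along the used links together form a closed
  set of \<open>F\<close>, to which minimality of \<open>K\<close> applies.\<close>

lemma K_minimal:
  assumes "A \<subseteq> KL" "B \<subseteq> KR" "A \<noteq> {} \<or> B \<noteq> {}" "closed_in FL A" "closed_in FR B"
    and "\<And>v w. (v, w) \<in> FT \<Longrightarrow> v \<in> A \<longleftrightarrow> w \<in> B"
  shows "A = KL" "B = KR"
proof -
  let ?S = "Inl ` A \<union> Inr ` B"
  have inv: "Inl -` ?S = A" "Inr -` ?S = B" by auto
  have "?S \<subseteq> K" using assms(1,2) by (auto simp: KL_def KR_def)
  moreover have "?S \<noteq> {}" using assms(3) by auto
  moreover have "closed_in (edges F) ?S"
    unfolding edges_F closed_in_glue inv using assms(4-6) by auto
  ultimately have "?S = K" using K unfolding circuit_def by blast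
  then show "A = KL" "B = KR" using inv by (simp_all add: KL_def KR_def)
qed

text \<open>A part of the left half without used terminals is closed in all of \<open>F\<close>, so
  minimality makes it the whole circuit.\<close>

lemma K_minimal_L:
  assumes "A \<subseteq> KL" "A \<noteq> {}" "closed_in FL A" "A \<inter> DL = {}"
  shows "A = KL" "KR = {}"
proof -
  have "v \<notin> A" if "(v, w) \<in> FT" for v w using assms(4) that by (force simp: DL_def)
  then have "A = KL \<and> {} = KR"
    using assms K_minimal[of A "{}"] by (simp add: closed_in_def)
  then show "A = KL" "KR = {}" by auto
qed

lemma K_minimal_R:
  assumes "B \<subseteq> KR" "B \<noteq> {}" "closed_in FR B" "B \<inter> DR = {}"
  shows "B = KR" "KL = {}"
proof -
  have "w \<notin> B" if "(v, w) \<in> FT" for v w using assms(4) that by (force simp: DR_def)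
  then have "{} = KL \<and> B = KR"
    using assms K_minimal[of "{}" B] by (simp add: closed_in_def)
  then show "B = KR" "KL = {}" by auto
qed

lemma K_terminals: "(v, w) \<in> FT \<Longrightarrow> v \<in> KL \<longleftrightarrow> w \<in> KR"
  by (rule K_closed)

lemma K_parity: "even (card (KL \<inter> DL))" "even (card (KR \<inter> DR))"
  by (rule even_closed_FL[OF K_subset(1) K_closed(1)], rule even_closed_FR[OF K_subset(2) K_closed(2)])

text \<open>Without used links the circuit stays in one half and survives every completion whose new
  edges avoid it. Each alternative has its own \<open>N\<close>, since the two halves are completed
  by different edges.\<close>

lemma K_untouched:
  assumes "KL \<inter> DL = {}"
  shows "(KR = {} \<and> (\<forall>U N. (\<forall>e\<in>N. e \<inter> KL = {}) \<longrightarrow> circuit (VL \<union> U) (FL \<union> N) KL)) \<or>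
    (KL = {} \<and> (\<forall>N. (\<forall>e\<in>N. e \<inter> KR = {}) \<longrightarrow> circuit (verts R) (FR \<union> N) KR))"
proof (cases "KL = {}")
  case False
  then have "KR = {}" using K_minimal_L(2)[OF order_refl False K_closed(1) assms] by simp
  moreover have "circuit (VL \<union> U) (FL \<union> N) KL" if N: "\<forall>e\<in>N. e \<inter> KL = {}" for U N
    unfolding circuit_def
  proof (intro conjI allI impI)
    show "KL \<subseteq> VL \<union> U" "KL \<noteq> {}" using K_subset False by auto
    show "closed_in (FL \<union> N) KL" using K_closed(1) N by (auto simp: closed_in_def)
    fix A assume A: "A \<subseteq> KL" "A \<noteq> {}" "closed_in (FL \<union> N) A"
    have "closed_in FL A" using A(3) by (simp add: closed_in_def)
    moreover have "A \<inter> DL = {}" using A(1) assms by blast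
    ultimately show "A = KL" using K_minimal_L(1)[OF A(1,2)] by simp
  qed
  ultimately show ?thesis by (intro disjI1 conjI allI impI)
next
  case True
  have ne: "KR \<noteq> {}"
  proof
    assume "KR = {}"
    then have "card K = 0" using card_K True by simp
    moreover have "finite K" using K finite_subset[of K "verts F"] by (simp add: circuit_def verts_F)
    ultimately show False using K by (simp add: circuit_def)
  qed
  have disj: "KR \<inter> DR = {}"
  proof (rule ccontr)
    assume "KR \<inter> DR \<noteq> {}"
    then obtain v w where "(v, w) \<in> FT" "w \<in> KR" unfolding DR_def by force
    then show False using K_terminals True by blast
  qed
  have "circuit (verts R) (FR \<union> N) KR" if N: "\<forall>e\<in>N. e \<inter> KR = {}" for N
    unfolding circuit_def
  proof (intro conjI allI impI)
    show "KR \<subseteq> verts R" "KR \<noteq> {}" using K_subset ne by auto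
    show "closed_in (FR \<union> N) KR" using K_closed(2) N by (auto simp: closed_in_def)
    fix A assume A: "A \<subseteq> KR" "A \<noteq> {}" "closed_in (FR \<union> N) A"
    have "closed_in FR A" using A(3) by (simp add: closed_in_def)
    moreover have "A \<inter> DR = {}" using A(1) disj by blast
    ultimately show "A = KR" using K_minimal_R(1)[OF A(1,2)] by simp
  qed
  then show ?thesis using True by (intro disjI2 conjI allI impI)
qed

text \<open>By minimality of \<open>K\<close> no nonempty closed part of \<open>KL\<close> avoids
  the used terminals, which is the condition for closing it up. \<open>U0\<close> consists of the
  deleted vertices that the closed circuit runs through.\<close>

lemma K_touched_L:
  assumes "KL \<inter> DL = D" "D \<noteq> {}" "U \<inter> VL = {}" "U0 \<subseteq> U"
    and "\<And>e. e \<in> N \<Longrightarrow> e \<inter> (KL \<union> U0) \<noteq> {} \<Longrightarrow> e \<subseteq> D \<union> U0"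
    and "\<And>S. closed_in N S \<Longrightarrow> S \<inter> (D \<union> U0) \<noteq> {} \<Longrightarrow> D \<union> U0 \<subseteq> S"
  shows "circuit (VL \<union> U) (FL \<union> N) (KL \<union> U0)"
proof (rule circuit_completion)
  show "D \<subseteq> KL" using assms(1) by blast
  show "A \<inter> D \<noteq> {}" if "A \<subseteq> KL" "A \<noteq> {}" "closed_in FL A" for A
  proof
    assume "A \<inter> D = {}"
    then have "A \<inter> DL = {}" using assms(1) that(1) by blast
    then have "A = KL" using K_minimal_L(1)[OF that] by simp
    then show False using \<open>A \<inter> DL = {}\<close> assms(1,2) by blast
  qed
  show "e \<subseteq> D \<union> U0" if "e \<in> N" "e \<inter> (KL \<union> U0) \<noteq> {}" for e using assms(5) that .
  show "D \<union> U0 \<subseteq> S" if "closed_in N S" "S \<inter> (D \<union> U0) \<noteq> {}" for S using assms(6) that .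
qed (rule assms edge_FL(2) K_subset(1) K_closed(1) | assumption)+

text \<open>\<open>A\<close> may be only a part of \<open>KR\<close>, because the right half of a
  circuit through all four links splits into two circuits.\<close>

lemma K_touched_R:
  assumes A: "A \<subseteq> KR" "closed_in FR A" and D: "A \<inter> DR = D" "D \<noteq> {}"
    and "\<And>e. e \<in> N \<Longrightarrow> e \<inter> A \<noteq> {} \<Longrightarrow> e \<subseteq> D"
    and "\<And>S. closed_in N S \<Longrightarrow> S \<inter> D \<noteq> {} \<Longrightarrow> D \<subseteq> S"
  shows "circuit (verts R) (FR \<union> N) A"
proof -
  have "circuit (verts R \<union> {}) (FR \<union> N) (A \<union> {})"
  proof (rule circuit_completion)
    show "D \<subseteq> A" using D by blast
    show "B \<inter> D \<noteq> {}" if "B \<subseteq> A" "B \<noteq> {}" "closed_in FR B" for B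
    proof
      assume "B \<inter> D = {}"
      then have none: "B \<inter> DR = {}" using D(1) that(1) by blast
      then have "B = KR" using K_minimal_R(1)[of B] that A(1) by blast
      then show False using none D A(1) by blast
    qed
    show "A \<subseteq> verts R" using A(1) K_subset(2) by blast
    show "e \<subseteq> D \<union> {}" if "e \<in> N" "e \<inter> (A \<union> {}) \<noteq> {}" for e using assms(5)[of e] that by simp
    show "D \<union> {} \<subseteq> S" if "closed_in N S" "S \<inter> (D \<union> {}) \<noteq> {}" for S using assms(6)[of S] that by simp
  qed (use A(2) D(2) edge_FR(2) in auto)
  then show ?thesis by simp
qed

lemma pair_parity: "p \<noteq> q \<Longrightarrow> even (card (X \<inter> {p, q})) \<longleftrightarrow> (p \<in> X \<longleftrightarrow> q \<in> X)"
  by (cases "p \<in> X"; cases "q \<in> X") (simp_all add: Int_insert_right)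

end

lemma closed_in_insert:
  "closed_in (insert {p, q} N) S \<longleftrightarrow> (p \<in> S \<longleftrightarrow> q \<in> S) \<and> closed_in N S"
  "closed_in {} S"
  by (auto simp: closed_in_def)

lemma odd_circuit: "regular 2 (V, E) \<Longrightarrow> odd_cycles (V, E) \<Longrightarrow> circuit V E K \<Longrightarrow> odd (card K)"
  using odd_cycles_circuit[of "(V, E)"] by simp

section \<open>Odd cycles, by the set of connecting edges in use\<close>

context dot_factor
begin

lemma dot_circuitI: "circuit (verts F) (edges F) K \<Longrightarrow> dot_circuit L R x y r s t u a b c d F K"
  using dot_factor_axioms by (simp add: dot_circuit_def dot_circuit_axioms_def)

lemma odd_cycles_F:
  assumes "\<And>K. circuit (verts F) (edges F) K \<Longrightarrow> odd (card K)" shows "odd_cycles F"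
  using odd_cycles_circuit[OF regular_F] assms by blast

lemma FL_edges: "FL \<subseteq> edges L" and FR_edges: "FR \<subseteq> edges R - {{a, b}, {c, d}}"
  using edge_FL(4) edge_FR(1) by (auto simp: ER_def)

lemma xy_verts: "x \<in> verts L" "y \<in> verts L" "x \<notin> VL" "y \<notin> VL"
  using edge_L(1)[OF xy] by (auto simp: VL_def)

lemma neqs: "x \<noteq> y" "x \<noteq> r" "x \<noteq> s" "x \<noteq> t" "x \<noteq> u" "y \<noteq> r" "y \<noteq> s" "y \<noteq> t" "y \<noteq> u"
  "r \<noteq> s" "r \<noteq> t" "r \<noteq> u" "s \<noteq> t" "s \<noteq> u" "t \<noteq> u"
  "a \<noteq> b" "a \<noteq> c" "a \<noteq> d" "b \<noteq> c" "b \<noteq> d" "c \<noteq> d"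
  using distinct_L distinct_R by simp_all

lemmas neq = neqs neqs[symmetric]

text \<open>The right half alone would be a 2-factor of \<open>R\<close> avoiding both deleted
  edges, against (i).\<close>

lemma odd_no_links:
  assumes FT: "FT = {}" shows False
proof -
  have "regular 2 (verts R, FR \<union> {})"
    by (rule completion_R) (use FT in \<open>simp_all add: DR_def incident_empty\<close>)
  then have "two_factor (verts R, FR) R" using FR_edges by (auto simp: two_factor_def)
  then show False using gadget_conditions(1) FR_edges by fastforce
qed

text \<open>The left half is closed by the one vertex \<open>x\<close> to an odd circuit in a
  2-factor of \<open>L\<close> without \<open>y\<close>, so it is even; the right half is closed by
  \<open>ab\<close> and is odd by (ii).\<close>

lemma odd_two_links_same:
  assumes FT: "FT = {(r, a), (s, b)}" shows "odd_cycles F"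
proof (rule odd_cycles_F)
  fix K assume K: "circuit (verts F) (edges F) K"
  interpret dot_circuit L R x y r s t u a b c d F K by (rule dot_circuitI[OF K])
  have D: "DL = {r, s}" "DR = {a, b}" by (simp_all add: DL_def DR_def FT)
  let ?N = "{{x, r}, {x, s}}"
  have regL: "regular 2 (VL \<union> {x}, FL \<union> ?N)"
    by (rule completion_L)
      (use xy_verts terminals_L neq in \<open>auto simp: D incident_insert incident_empty doubleton_eq_iff\<close>)
  have "two_factor (VL \<union> {x}, FL \<union> ?N) (delete_verts L {y})"
    using regL xy_verts edges_xy FL_edges edge_FL(2) neq
    by (auto simp: two_factor_def delete_verts_def VL_def)
  then have oddL: "odd_cycles (VL \<union> {x}, FL \<union> ?N)" by (rule two_factor_L_minus_odd)
  have regR: "regular 2 (verts R, FR \<union> {{a, b}})"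
    by (rule completion_R)
      (use FR_edges terminals_R neq in \<open>auto simp: D incident_insert incident_empty\<close>)
  have "two_factor (verts R, FR \<union> {{a, b}}) R" "{c, d} \<notin> FR \<union> {{a, b}}"
    using regR ab FR_edges neq by (auto simp: two_factor_def doubleton_eq_iff)
  then have oddR: "odd_cycles (verts R, FR \<union> {{a, b}})" using gadget_conditions(2) by simp
  have same: "r \<in> KL \<longleftrightarrow> s \<in> KL" "r \<in> KL \<longleftrightarrow> a \<in> KR" "s \<in> KL \<longleftrightarrow> b \<in> KR"
    using K_parity(1) pair_parity[OF neq(10), of KL] K_terminals[of r a] K_terminals[of s b]
    by (simp_all add: D FT)
  have xKL: "x \<notin> KL" using K_subset xy_verts by blast
  show "odd (card K)"
  proof (cases "r \<in> KL")
    case True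
    have "circuit (VL \<union> {x}) (FL \<union> ?N) (KL \<union> {x})"
      by (rule K_touched_L[of "{r, s}"])
        (use True same xy_verts in \<open>auto simp: D closed_in_insert\<close>)
    then have "odd (card (KL \<union> {x}))" using odd_circuit[OF regL oddL] by blast
    then have "even (card KL)" using xKL by simp
    moreover have "circuit (verts R) (FR \<union> {{a, b}}) KR"
      by (rule K_touched_R[of _ "{a, b}"])
        (use True same K_closed(2) in \<open>auto simp: D closed_in_insert\<close>)
    then have "odd (card KR)" using odd_circuit[OF regR oddR] by blast
    ultimately show ?thesis by (simp add: card_K)
  next
    case False
    then have "KL \<inter> DL = {}" "\<forall>e\<in>?N. e \<inter> KL = {}" "\<forall>e\<in>{{a, b}}. e \<inter> KR = {}"
      using same xKL by (simp_all add: D)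
    from K_untouched[OF this(1)] this(2,3)
    consider "KR = {}" "circuit (VL \<union> {x}) (FL \<union> ?N) KL"
      | "KL = {}" "circuit (verts R) (FR \<union> {{a, b}}) KR" by meson
    then show ?thesis
      by cases (use odd_circuit[OF regL oddL] odd_circuit[OF regR oddR] in \<open>simp_all add: card_K\<close>)
  qed
qed

text \<open>A left half from \<open>r\<close> to \<open>t\<close> needs both \<open>x\<close> and
  \<open>y\<close> to close, so it is odd. This is balanced by (iv), which makes the circuit through
  the new edge \<open>ac\<close> even.\<close>

lemma odd_two_links_mixed:
  assumes FT: "FT = {(r, a), (t, c)}" shows "odd_cycles F"
proof (rule odd_cycles_F)
  fix K assume K: "circuit (verts F) (edges F) K"
  interpret dot_circuit L R x y r s t u a b c d F K by (rule dot_circuitI[OF K])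
  have D: "DL = {r, t}" "DR = {a, c}" by (simp_all add: DL_def DR_def FT)
  let ?N = "{{x, r}, {x, y}, {y, t}}"
  have regL: "regular 2 (VL \<union> {x, y}, FL \<union> ?N)"
    by (rule completion_L)
      (use xy_verts terminals_L neq in \<open>auto simp: D incident_insert incident_empty doubleton_eq_iff\<close>)
  have "two_factor (VL \<union> {x, y}, FL \<union> ?N) L"
    using regL xy_verts edges_xy xy FL_edges by (auto simp: two_factor_def VL_def)
  then have oddL: "odd_cycles (VL \<union> {x, y}, FL \<union> ?N)" by (rule two_factor_L_odd)
  have no_cross: "edges R \<inter> cross_edges {a, b} {c, d} = {}" by (rule gadget_pair_no_cross_edge[OF gadget])
  have ac: "{a, c} \<in> cross_edges {a, b} {c, d}" by (auto simp: cross_edges_def)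
  have FRcross: "FR \<inter> cross_edges {a, b} {c, d} = {}" using no_cross FR_edges by blast
  have acFR: "{a, c} \<notin> FR" using FRcross ac by blast
  let ?F = "(verts R, FR \<union> {{a, c}})"
  have regR: "regular 2 ?F"
    by (rule completion_R)
      (use acFR terminals_R neq in \<open>auto simp: D incident_insert incident_empty\<close>)
  have two: "two_factor ?F (add_edges (delete_edges R {{a, b}, {c, d}}) (cross_edges {a, b} {c, d}))"
    using regR ac FR_edges by (auto simp: two_factor_def add_edges_def delete_edges_def)
  have inter: "edges ?F \<inter> cross_edges {a, b} {c, d} = {{a, c}}"
    using ac unfolding snd_conv Int_Un_distrib2 FRcross by simp
  have iv: "if {a, c} \<in> cycle_edges p then even (length p) else odd (length p)" if "cycle ?F p" for p
    by (rule gadget_conditions(4)[rule_format, OF conjI[OF two inter] that])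
  \<comment> \<open>In the completion a circuit contains the edge \<open>ac\<close> exactly if it
    contains \<open>a\<close>, so (iv) becomes a statement about vertex sets.\<close>
  have parR: "even (card A) \<longleftrightarrow> a \<in> A" if A: "circuit (verts R) (FR \<union> {{a, c}}) A" for A
  proof -
    obtain p where p: "cycle ?F p" "set p = A" 
      using circuit_imp_cycle[OF regR, unfolded fst_conv snd_conv, OF A] by blast
    have "{a, c} \<in> cycle_edges p \<longleftrightarrow> a \<in> A"
    proof
      assume "{a, c} \<in> cycle_edges p"
      then show "a \<in> A" using cycle_edges_subset p(2) by fastforce
    next
      assume "a \<in> A"
      then show "{a, c} \<in> cycle_edges p" using p(2) by (intro cycle_edges_at[OF regR p(1)]) auto
    qed
    moreover have "card A = length p" using cycle_card[OF p(1)] p(2) by simp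
    ultimately show ?thesis using iv[OF p(1)] by (cases "a \<in> A") simp_all
  qed
  have same: "r \<in> KL \<longleftrightarrow> t \<in> KL" "r \<in> KL \<longleftrightarrow> a \<in> KR" "t \<in> KL \<longleftrightarrow> c \<in> KR"
    using K_parity(1) pair_parity[OF neq(11), of KL] K_terminals[of r a] K_terminals[of t c]
    by (simp_all add: D FT)
  have xKL: "x \<notin> KL" "y \<notin> KL" using K_subset xy_verts by blast+
  show "odd (card K)"
  proof (cases "r \<in> KL")
    case True
    have "circuit (VL \<union> {x, y}) (FL \<union> ?N) (KL \<union> {x, y})"
      by (rule K_touched_L[of "{r, t}"])
        (use True same xy_verts in \<open>auto simp: D closed_in_insert\<close>)
    then have "odd (card (KL \<union> {x, y}))" using odd_circuit[OF regL oddL] by blast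
    then have "odd (card KL)" using xKL neq(1) by simp
    moreover have "circuit (verts R) (FR \<union> {{a, c}}) KR"
      by (rule K_touched_R[of _ "{a, c}"])
        (use True same K_closed(2) in \<open>auto simp: D closed_in_insert\<close>)
    then have "even (card KR)" using parR True same by blast
    ultimately show ?thesis by (simp add: card_K)
  next
    case False
    then have "KL \<inter> DL = {}" "\<forall>e\<in>?N. e \<inter> KL = {}" "\<forall>e\<in>{{a, c}}. e \<inter> KR = {}"
      using same xKL by (simp_all add: D)
    from K_untouched[OF this(1)] this(2,3)
    consider "KR = {}" "circuit (VL \<union> {x, y}) (FL \<union> ?N) KL"
      | "KL = {}" "circuit (verts R) (FR \<union> {{a, c}}) KR" by meson
    then show ?thesis
      by cases (use odd_circuit[OF regL oddL] parR False same in \<open>simp_all add: card_K\<close>)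
  qed
qed

end

lemma closed_in_Un: "closed_in (E \<union> N) S \<longleftrightarrow> closed_in E S \<and> closed_in N S"
  by (simp add: closed_in_def ball_Un)

text \<open>This lets \<open>x\<close> and \<open>y\<close> be added to or dropped from a set
  without affecting closedness in \<open>FL\<close>.\<close>

lemma closed_in_cong:
  assumes "\<And>e. e \<in> E \<Longrightarrow> e \<subseteq> V" "A \<inter> V = B \<inter> V"
  shows "closed_in E A \<longleftrightarrow> closed_in E B"
  unfolding closed_in_def
proof (rule ball_cong[OF refl])
  fix e assume "e \<in> E"
  then have "e \<inter> A = e \<inter> (A \<inter> V)" "e \<inter> B = e \<inter> (B \<inter> V)" using assms(1) by blast+
  then have "e \<inter> A = e \<inter> B" using assms(2) by simp
  then show "(e \<inter> A \<noteq> {} \<longrightarrow> e \<subseteq> A) = (e \<inter> B \<noteq> {} \<longrightarrow> e \<subseteq> B)" by (simp only: inf.absorb_iff1)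
qed

context dot_factor
begin

text \<open>The left half is completed by the edges from \<open>x\<close> and \<open>y\<close> to
  their terminals, without \<open>xy\<close>, the right half by \<open>ab\<close> and
  \<open>cd\<close>. By (iii) the right half joins \<open>a\<close> to \<open>b\<close> and
  \<open>c\<close> to \<open>d\<close>, whatever the pairing on the left, so a circuit uses the two
  links at one end of \<open>xy\<close> together.\<close>

lemma odd_four_links:
  assumes FT: "FT = T" shows "odd_cycles F"
proof (rule odd_cycles_F)
  fix K assume K: "circuit (verts F) (edges F) K"
  interpret dot_circuit L R x y r s t u a b c d F K by (rule dot_circuitI[OF K])
  have D: "DL = {r, s, t, u}" "DR = {a, b, c, d}" by (simp_all add: DL_def DR_def FT T_def)
  let ?N = "{{x, r}, {x, s}, {y, t}, {y, u}}"
  have regL: "regular 2 (VL \<union> {x, y}, FL \<union> ?N)"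
    by (rule completion_L)
      (use xy_verts terminals_L neq in \<open>auto simp: D incident_insert incident_empty doubleton_eq_iff\<close>)
  have "two_factor (VL \<union> {x, y}, FL \<union> ?N) L"
    using regL xy_verts edges_xy xy FL_edges by (auto simp: two_factor_def VL_def)
  then have oddL: "odd_cycles (VL \<union> {x, y}, FL \<union> ?N)" by (rule two_factor_L_odd)
  let ?F = "(verts R, FR \<union> {{a, b}, {c, d}})"
  have notFR: "{a, b} \<notin> FR" "{c, d} \<notin> FR" using FR_edges by blast+
  have regR: "regular 2 ?F"
    by (rule completion_R)
      (use notFR terminals_R neq in \<open>auto simp: D incident_insert incident_empty doubleton_eq_iff\<close>)
  have "FR \<union> {{a, b}, {c, d}} \<subseteq> edges R" using ab cd FR_edges by blast
  then have "two_factor ?F R \<and> {a, b} \<in> edges ?F \<and> {c, d} \<in> edges ?F"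
    using regR by (simp add: two_factor_def)
  note iii = gadget_conditions(3)[THEN spec, THEN mp, OF this]
  note oddR = iii[THEN conjunct1] and apart = iii[THEN conjunct2]
  \<comment> \<open>\<open>M\<close> is the circuit of the completed right half through
    \<open>ab\<close>; by (iii) it misses \<open>cd\<close>.\<close>
  have "closed_in (FR \<union> {{a, b}, {c, d}}) (verts R)"
    using edge_FR(2) terminals_R unfolding closed_in_def by blast
  then obtain M where M: "circuit (verts R) (FR \<union> {{a, b}, {c, d}}) M" "a \<in> M"
    using ex_circuit[of "verts R" a] terminals_R by auto
  have "closed_in (FR \<union> {{a, b}, {c, d}}) M" using M(1) by (simp add: circuit_def)
  then have "closed_in FR M" "closed_in {{a, b}, {c, d}} M" unfolding closed_in_Un by simp_all
  then have Mclosed: "closed_in FR M" "b \<in> M" "c \<in> M \<longleftrightarrow> d \<in> M"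
    using M(2) by (simp_all add: closed_in_insert)
  have cM: "c \<notin> M"
  proof
    assume c: "c \<in> M"
    obtain p where p: "cycle ?F p" "set p = M"
      using circuit_imp_cycle[OF regR, unfolded fst_conv snd_conv, OF M(1)] by blast
    have "{a, b} \<in> cycle_edges p" "{c, d} \<in> cycle_edges p"
      using M(2) c p(2) by (auto intro!: cycle_edges_at[OF regR p(1)])
    then show False using apart p(1) by blast
  qed
  then have dM: "d \<notin> M" using Mclosed(3) by simp
  \<comment> \<open>Cutting \<open>KR\<close> along \<open>M\<close> separates the ends
    \<open>a\<close>, \<open>b\<close> from \<open>c\<close>, \<open>d\<close>, and each part has
    evenly many used terminals.\<close>
  have closedR: "closed_in FR (KR \<inter> M)" "closed_in FR (KR - M)"
    using closed_in_Int closed_in_Diff K_closed(2) Mclosed(1) by blast+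
  have "even (card ((KR \<inter> M) \<inter> DR))" "even (card ((KR - M) \<inter> DR))"
    using K_subset(2) by (intro even_closed_FR closedR; blast)+
  moreover have "(KR \<inter> M) \<inter> DR = KR \<inter> {a, b}" "(KR - M) \<inter> DR = KR \<inter> {c, d}"
    using M(2) Mclosed(2) cM dM by (auto simp: D)
  ultimately have sameR: "a \<in> KR \<longleftrightarrow> b \<in> KR" "c \<in> KR \<longleftrightarrow> d \<in> KR"
    using pair_parity[OF neq(16), of KR] pair_parity[OF neq(21), of KR] by simp_all
  have link: "r \<in> KL \<longleftrightarrow> a \<in> KR" "s \<in> KL \<longleftrightarrow> b \<in> KR" "t \<in> KL \<longleftrightarrow> c \<in> KR" "u \<in> KL \<longleftrightarrow> d \<in> KR"
    using K_terminals by (simp_all add: FT T_def)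
  have xKL: "x \<notin> KL" "y \<notin> KL" using K_subset xy_verts by blast+
  have Uv: "{x, y} \<inter> VL = {}" using xy_verts by simp
  consider "r \<notin> KL" "t \<notin> KL" | "r \<in> KL" "t \<notin> KL" | "r \<notin> KL" "t \<in> KL" | "r \<in> KL" "t \<in> KL" by blast
  then show "odd (card K)"
  proof cases
    case 1
    then have "KL \<inter> DL = {}" "\<forall>e\<in>?N. e \<inter> KL = {}" "\<forall>e\<in>{{a, b}, {c, d}}. e \<inter> KR = {}"
      using sameR link xKL by (simp_all add: D)
    from K_untouched[OF this(1)] this(2,3)
    consider "KR = {}" "circuit (VL \<union> {x, y}) (FL \<union> ?N) KL"
      | "KL = {}" "circuit (verts R) (FR \<union> {{a, b}, {c, d}}) KR" by meson
    then show ?thesis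
      by cases (use odd_circuit[OF regL oddL] odd_circuit[OF regR oddR] in \<open>simp_all add: card_K\<close>)
  next
    case 2
    have "circuit (VL \<union> {x, y}) (FL \<union> ?N) (KL \<union> {x})"
      by (rule K_touched_L[of "{r, s}"])
        (use 2 sameR link xKL Uv neq in \<open>auto simp: D closed_in_insert\<close>)
    then have "odd (card (KL \<union> {x}))" using odd_circuit[OF regL oddL] by blast
    then have "even (card KL)" using xKL by simp
    moreover have "circuit (verts R) (FR \<union> {{a, b}, {c, d}}) KR"
      by (rule K_touched_R[of _ "{a, b}"])
        (use 2 sameR link K_closed(2) in \<open>auto simp: D closed_in_insert\<close>)
    then have "odd (card KR)" using odd_circuit[OF regR oddR] by blast
    ultimately show ?thesis by (simp add: card_K)
  next
    case 3
    have "circuit (VL \<union> {x, y}) (FL \<union> ?N) (KL \<union> {y})"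
      by (rule K_touched_L[of "{t, u}"])
        (use 3 sameR link xKL Uv neq in \<open>auto simp: D closed_in_insert\<close>)
    then have "odd (card (KL \<union> {y}))" using odd_circuit[OF regL oddL] by blast
    then have "even (card KL)" using xKL by simp
    moreover have "circuit (verts R) (FR \<union> {{a, b}, {c, d}}) KR"
      by (rule K_touched_R[of _ "{c, d}"])
        (use 3 sameR link K_closed(2) in \<open>auto simp: D closed_in_insert\<close>)
    then have "odd (card KR)" using odd_circuit[OF regR oddR] by blast
    ultimately show ?thesis by (simp add: card_K)
  next
    case 4
    have all: "r \<in> KL" "s \<in> KL" "t \<in> KL" "u \<in> KL" "a \<in> KR" "b \<in> KR" "c \<in> KR" "d \<in> KR"
      using 4 sameR link by simp_all
    \<comment> \<open>With all four links in \<open>K\<close> the right half closes up to two odd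
      circuits, so it is even. The left half must then be odd.\<close>
    have "circuit (verts R) (FR \<union> {{a, b}, {c, d}}) (KR \<inter> M)"
      by (rule K_touched_R[of _ "{a, b}"])
        (use all M(2) Mclosed cM dM closedR in \<open>auto simp: D closed_in_insert\<close>)
    moreover have "circuit (verts R) (FR \<union> {{a, b}, {c, d}}) (KR - M)"
      by (rule K_touched_R[of _ "{c, d}"])
        (use all M(2) Mclosed cM dM closedR in \<open>auto simp: D closed_in_insert\<close>)
    ultimately have "odd (card (KR \<inter> M))" "odd (card (KR - M))"
      using odd_circuit[OF regR oddR] by blast+
    moreover have "card KR = card (KR \<inter> M) + card (KR - M)" by (rule card_Int_Diff) simp
    ultimately have evenR: "even (card KR)" by simp
    \<comment> \<open>The new edges at \<open>x\<close> and those at \<open>y\<close> are not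
      connected to each other, so \<open>K_touched_L\<close> does not apply. A closed part
      containing only one of \<open>x\<close> and \<open>y\<close> would, with the part of
      \<open>KR\<close> on the corresponding side of \<open>M\<close>, give a proper closed part of
      \<open>K\<close>.\<close>
    have "circuit (VL \<union> {x, y}) (FL \<union> ?N) (KL \<union> {x, y})"
      unfolding circuit_def
    proof (intro conjI allI impI)
      show "KL \<union> {x, y} \<subseteq> VL \<union> {x, y}" "KL \<union> {x, y} \<noteq> {}" using K_subset by auto
      have "closed_in FL (KL \<union> {x, y})"
        using K_closed(1) closed_in_cong[OF edge_FL(2), where A = "KL \<union> {x, y}" and B = KL] Uv
        by (simp add: Int_Un_distrib2)
      moreover have "closed_in ?N (KL \<union> {x, y})" using all by (simp add: closed_in_insert)
      ultimately show "closed_in (FL \<union> ?N) (KL \<union> {x, y})"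
        unfolding closed_in_Un by (rule conjI)
      fix A assume A: "A \<subseteq> KL \<union> {x, y}" "A \<noteq> {}" "closed_in (FL \<union> ?N) A"
      have closedA: "closed_in FL A" "closed_in ?N A" using A(3) unfolding closed_in_Un by simp_all
      from closedA(2) have AN: "(x \<in> A \<longleftrightarrow> r \<in> A) \<and> (x \<in> A \<longleftrightarrow> s \<in> A) \<and> (y \<in> A \<longleftrightarrow> t \<in> A) \<and> (y \<in> A \<longleftrightarrow> u \<in> A)"
        unfolding closed_in_insert by (elim conjE) (intro conjI; assumption)
      define B where "B = A - {x, y}"
      have B: "B \<subseteq> KL" using A(1) by (auto simp: B_def)
      have closedB: "closed_in FL B"
        using closedA(1) closed_in_cong[OF edge_FL(2), where A = A and B = B] Uv by (simp add: B_def Diff_Int_distrib2)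
      have BT: "r \<in> B \<longleftrightarrow> x \<in> A" "s \<in> B \<longleftrightarrow> x \<in> A" "t \<in> B \<longleftrightarrow> y \<in> A" "u \<in> B \<longleftrightarrow> y \<in> A"
      proof -
        have "r \<in> B \<longleftrightarrow> r \<in> A" "s \<in> B \<longleftrightarrow> s \<in> A" "t \<in> B \<longleftrightarrow> t \<in> A" "u \<in> B \<longleftrightarrow> u \<in> A"
          by (simp_all add: B_def neq)
        then show "r \<in> B \<longleftrightarrow> x \<in> A" "s \<in> B \<longleftrightarrow> x \<in> A" "t \<in> B \<longleftrightarrow> y \<in> A" "u \<in> B \<longleftrightarrow> y \<in> A"
          using AN by blast+
      qed
      consider "x \<notin> A" "y \<notin> A" | "x \<in> A" "y \<notin> A" | "x \<notin> A" "y \<in> A" | "x \<in> A" "y \<in> A" by blast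
      then show "A = KL \<union> {x, y}"
      proof cases
        case 1
        have "B \<noteq> {}" using A(2) 1 by (auto simp: B_def)
        moreover have "B \<inter> DL = {}" using BT 1 by (simp add: D)
        ultimately have "B = KL" using K_minimal_L(1)[OF B _ closedB] by blast
        then show ?thesis using BT 1 all by blast
      next
        case 2
        have "B = KL"
        proof (rule K_minimal(1)[of B "KR \<inter> M"])
          show "v \<in> B \<longleftrightarrow> w \<in> KR \<inter> M" if "(v, w) \<in> FT" for v w
            using that BT 2 all M(2) Mclosed(2) cM dM by (auto simp: FT T_def)
        qed (use B closedB closedR all M(2) in auto)
        then show ?thesis using BT 2 all by blast
      next
        case 3
        have "B = KL"
        proof (rule K_minimal(1)[of B "KR - M"])
          show "v \<in> B \<longleftrightarrow> w \<in> KR - M" if "(v, w) \<in> FT" for v w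
            using that BT 3 all M(2) Mclosed(2) cM dM by (auto simp: FT T_def)
        qed (use B closedB closedR all cM in auto)
        then show ?thesis using BT 3 all by blast
      next
        case 4
        have "KL - B = {}"
        proof (rule ccontr)
          assume ne: "KL - B \<noteq> {}"
          have "(KL - B) \<inter> DL = {}" using BT 4 by (auto simp: D)
          then have "KL - B = KL"
            using K_minimal_L(1)[OF Diff_subset ne closed_in_Diff[OF K_closed(1) closedB]] by blast
          then show False using BT 4 all by blast
        qed
        then show ?thesis using A(1) 4 by (auto simp: B_def)
      qed
    qed
    then have "odd (card (KL \<union> {x, y}))" using odd_circuit[OF regL oddL] by blast
    then have "odd (card KL)" using xKL neq(1) by simp
    then show ?thesis using evenR by (simp add: card_K)
  qed
qed

end

section \<open>Symmetries of the construction and the conclusion\<close>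

lemma bold_edge_commute:
  assumes "bold_edge L x y" shows "bold_edge L y x"
  using assms unfolding bold_edge_def insert_commute[of y x "{}"] by (elim conjE, intro conjI)

lemma dot_factor_swap_x:
  assumes "dot_factor L R x y r s t u a b c d F" shows "dot_factor L R x y s r t u b a c d F"
proof -
  interpret dot_factor L R x y r s t u a b c d F by (rule assms)
  interpret swapped: dot L R x y s r t u b a c d
    using snark_L snark_R xy neighbours_x neighbours_y ab cd disjoint_ab_cd
    by unfold_locales (simp_all add: insert_commute)
  have "swapped.H = H"
    unfolding dot_graph_eq[symmetric] swapped.dot_graph_eq[symmetric] dot_graph_def
    by (simp add: insert_commute)
  then show ?thesis using bold gadget F by unfold_locales (simp_all add: insert_commute)
qed

text \<open>Exchanging the ends of \<open>xy\<close> along with the two deleted edges leaves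
  \<open>H\<close> unchanged, and bold-edges and gadget-pairs are symmetric notions.\<close>

lemma dot_factor_swap_sides:
  assumes "dot_factor L R x y r s t u a b c d F" shows "dot_factor L R y x t u r s c d a b F"
proof -
  interpret dot_factor L R x y r s t u a b c d F by (rule assms)
  interpret swapped: dot L R y x t u r s c d a b
    using snark_L snark_R xy neighbours_x neighbours_y ab cd disjoint_ab_cd
    by unfold_locales (simp_all add: insert_commute Int_commute)
  have "swapped.H = H"
    unfolding dot_graph_eq[symmetric] swapped.dot_graph_eq[symmetric] dot_graph_def
    by (simp add: insert_commute)
  then show ?thesis using bold_edge_commute[OF bold] gadget_pair_commute[OF gadget] F
    by unfold_locales simp_all
qed

text \<open>The swap at \<open>x\<close>, conjugated by the exchange of the two ends.\<close>

lemma dot_factor_swap_y: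
  assumes "dot_factor L R x y r s t u a b c d F" shows "dot_factor L R x y r s u t a b d c F"
  by (rule dot_factor_swap_sides[OF dot_factor_swap_x[OF dot_factor_swap_sides[OF assms]]])

text \<open>Evenness leaves eight possible sets of used links, and the symmetries reduce them to
  four types.\<close>

lemma (in dot_factor) odd_cycles: "odd_cycles F"
proof -
  note this_axioms = dot_factor_axioms
  interpret x': dot_factor L R x y s r t u b a c d F by (rule dot_factor_swap_x[OF this_axioms])
  interpret y': dot_factor L R x y r s u t a b d c F by (rule dot_factor_swap_y[OF this_axioms])
  interpret xy': dot_factor L R x y s r u t b a d c F
    by (rule dot_factor_swap_x[OF dot_factor_swap_y[OF this_axioms]])
  interpret sides: dot_factor L R y x t u r s c d a b F by (rule dot_factor_swap_sides[OF this_axioms])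
  define p q v w where "p \<longleftrightarrow> (r, a) \<in> FT" and "q \<longleftrightarrow> (s, b) \<in> FT"
    and "v \<longleftrightarrow> (t, c) \<in> FT" and "w \<longleftrightarrow> (u, d) \<in> FT"
  note pqvw = this
  have FT_eq: "FT = (if p then {(r, a)} else {}) \<union> ((if q then {(s, b)} else {}) \<union>
      ((if v then {(t, c)} else {}) \<union> (if w then {(u, d)} else {})))"
    using FT_subset unfolding pqvw T_def by auto
  have "distinct [(r, a), (s, b), (t, c), (u, d)]" using neq by simp
  from card_filter_four[OF this, of "\<lambda>z. z \<in> FT"]
  have "card {z \<in> T. z \<in> FT} = of_bool p + of_bool q + of_bool v + of_bool w"
    unfolding T_def pqvw .
  moreover have "{z \<in> T. z \<in> FT} = FT" using FT_subset by blast
  ultimately have even: "even (of_bool p + of_bool q + of_bool v + of_bool w :: nat)"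
    using even_card_FT by simp
  consider "\<not> p" "\<not> q" "\<not> v" "\<not> w" | "p" "q" "\<not> v" "\<not> w" | "\<not> p" "\<not> q" "v" "w"
    | "p" "\<not> q" "v" "\<not> w" | "p" "\<not> q" "\<not> v" "w" | "\<not> p" "q" "v" "\<not> w"
    | "\<not> p" "q" "\<not> v" "w" | "p" "q" "v" "w"
    using even by (cases p; cases q; cases v; cases w; simp)
  then show ?thesis
  proof cases
    case 1
    then show ?thesis using odd_no_links FT_eq by (simp add: insert_commute)
  next
    case 2
    then show ?thesis using odd_two_links_same FT_eq by (simp add: insert_commute)
  next
    case 3
    then show ?thesis using sides.odd_two_links_same FT_eq by (simp add: insert_commute)
  next
    case 4
    then show ?thesis using odd_two_links_mixed FT_eq by (simp add: insert_commute)
  next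
    case 5
    then show ?thesis using y'.odd_two_links_mixed FT_eq by (simp add: insert_commute)
  next
    case 6
    then show ?thesis using x'.odd_two_links_mixed FT_eq by (simp add: insert_commute)
  next
    case 7
    then show ?thesis using xy'.odd_two_links_mixed FT_eq by (simp add: insert_commute)
  next
    case 8
    then show ?thesis using odd_four_links FT_eq by (simp add: T_def insert_commute)
  qed
qed

theorem theorem3p5:
  fixes L :: "'a graph" and R :: "'b graph" and H :: "('a + 'b) graph"
    and x y :: 'a and a b c d :: 'b
  assumes "snark L" and "snark R"
    and "bold_edge L x y"
    and "gadget_pair R {a, b} {c, d}"
    and "dot_product L x y R {a, b} {c, d} H"
  shows "snark H \<and> odd_two_factored H"
proof -
  obtain r s t u a' b' c' d' where nb: "neighbours L x - {y} = {r, s}" "neighbours L y - {x} = {t, u}"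
    and ends: "{a', b'} = {a, b} \<and> {c', d'} = {c, d} \<or> {a', b'} = {c, d} \<and> {c', d'} = {a, b}"
    and H: "H = dot_graph L x y R r s t u a' b' c' d'"
    and edges: "{x, y} \<in> edges L" "{a, b} \<in> edges R" "{c, d} \<in> edges R" "{a, b} \<inter> {c, d} = {}"
    using assms(5) unfolding dot_product_def by (elim conjE exE)
  \<comment> \<open>The links may attach the neighbours of \<open>x\<close> to \<open>cd\<close>
    instead of \<open>ab\<close>; the symmetry of gadget-pairs absorbs this by renaming.\<close>
  have gadget: "gadget_pair R {a', b'} {c', d'}" "{a', b'} \<in> edges R" "{c', d'} \<in> edges R"
    "{a', b'} \<inter> {c', d'} = {}"
    using ends assms(4) gadget_pair_commute[OF assms(4)] edges by (elim disjE; simp add: Int_commute)+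
  interpret bold_gadget_dot L R x y r s t u a' b' c' d'
    using assms(1-3) nb edges gadget by unfold_locales
  have Heq: "H = dot.H L R x y r s t u a' b' c' d'" using H dot_graph_eq by simp
  have "odd_cycles F" if "two_factor F H" for F
  proof -
    interpret dot_factor L R x y r s t u a' b' c' d' F using that Heq by unfold_locales simp
    show ?thesis by (rule odd_cycles)
  qed
  then have "odd_two_factored H" by (simp add: odd_two_factored_def)
  then show ?thesis using odd_two_factored_imp_snark_H Heq by simp
qed

end
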